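(* For every integer $N\ge 2$ there is a constant $C(N)$, depending only on $N$, such that for all integers $L\ge 2$ and all real $\beta\ge 1$, $$T^{\mathrm f}_{\rm rel}(L,\beta)\le C(N)\,L^2\,\beta^{(N+1)/2}.$$ In particular, for each fixed $N$, the relaxation time with free boundary conditions grows at most polynomially in $\beta$.
   Context: Let $N\ge2$, $L\ge2$ be integers, $\mathbb S^{N-1}\subset\mathbb R^N$ the unit sphere with its standard Riemannian metric, and $\Omega_L=(\mathbb S^{N-1})^L$, with configurations $S=(S_1,\dots,S_L)$. The free boundary Hamiltonian is $H^{\mathrm f}_L(S)=-\sum_{i=1}^{L-1}S_i\cdot S_{i+1}$. Let $\nu$ be the Lebesgue (surface) measure on $\mathbb S^{N-1}$ and $\nu_L$ its $L$-fold product on $\Omega_L$. For $\beta>0$ the Gibbs measure is the probability measure $\mu^{\mathrm f}_{L,\beta}(dS)=\frac{1}{Z^{\mathrm f}_{L,\beta}}e^{-\beta H^{\mathrm f}_L(S)}\nu_L(dS)$, with $Z^{\mathrm f}_{L,\beta}$ the normalizing constant. For smooth $f:\Omega_L\to\mathbb R$, let $D_if$ be the gradient on $\mathbb S^{N-1}$ of $f$ with respect to the $i$-th spin. The Dirichlet form is $\mathcal D^{\mathrm f}_{L,\beta}(f,f)=\frac1\beta\sum_{i=1}^L\int_{\Omega_L}\|D_if(S)\|^2\,\mu^{\mathrm f}_{L,\beta}(dS)$. The spectral gap is $\mathrm{gap}^{\mathrm f}_{L,\beta}=\inf_f \mathcal D^{\mathrm f}_{L,\beta}(f,f)/\mathrm{Var}_{\mu^{\mathrm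 f}_{L,\beta}}(f)$, the infimum being over non-constant smooth $f:\Omega_L\to\mathbb R$, and the relaxation time is $T^{\mathrm f}_{\rm rel}(L,\beta)=1/\mathrm{gap}^{\mathrm f}_{L,\beta}$. *)

theory Defs
  imports "HOL-Probability.Probability"
begin

text \<open>
  The dimension \<open>N\<close> is the cardinality of the index type \<open>'n\<close>. The number of spins \<open>L\<close> is a natural
  number, so an element of \<open>(\<real>\<^sup>N)\<^sup>L\<close> is a function that is \<^const>\<open>undefined\<close> outside \<open>{1..L}\<close>.
\<close>

type_synonym 'n config = "nat \<Rightarrow> real ^ 'n"

definition euclidean_configs :: "nat \<Rightarrow> ('n::finite) config topology" where
  "euclidean_configs L = product_topology (\<lambda>_. euclidean) {1..L}"

definition spin_configs :: "nat \<Rightarrow> ('n::finite) config set" where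
  "spin_configs L = (\<Pi>\<^sub>E i\<in>{1..L}. sphere 0 1)"

text \<open>
  Surface measure of the unit sphere in polar coordinates: the measure of a Borel set \<open>A\<close> is \<open>N\<close> times
  the volume of the cone \<open>{x. 0 < norm x < 1 \<and> x / norm x \<in> A}\<close>.
\<close>

definition surface_measure :: "(real ^ 'n::finite) measure" where
  "surface_measure =
     scale_measure (of_nat CARD('n))
       (distr (restrict_space lborel (ball 0 1 - {0})) (restrict_space borel (sphere 0 1)) sgn)"

definition spin_measure :: "nat \<Rightarrow> ('n::finite) config measure" where
  "spin_measure L = (\<Pi>\<^sub>M i\<in>{1..L}. surface_measure)"

definition hamiltonian :: "nat \<Rightarrow> ('n::finite) config \<Rightarrow> real" where
  "hamiltonian L S = - (\<Sum>i=1..L-1. S i \<bullet> S (i + 1))"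

definition partition_function :: "'n::finite itself \<Rightarrow> nat \<Rightarrow> real \<Rightarrow> real" where
  "partition_function _ L \<beta> = (\<integral>S. exp (- \<beta> * hamiltonian L S) \<partial>(spin_measure L :: 'n config measure))"

definition gibbs_measure :: "nat \<Rightarrow> real \<Rightarrow> ('n::finite) config measure" where
  "gibbs_measure L \<beta> =
     density (spin_measure L)
       (\<lambda>S. ennreal (exp (- \<beta> * hamiltonian L S) / partition_function TYPE('n) L \<beta>))"

text \<open>
  \<open>C_on k L U F\<close>: all iterated partial derivatives of \<open>F\<close> up to order \<open>k\<close>, with respect to the
  coordinates of \<open>(\<real>\<^sup>N)\<^sup>L\<close>, exist and are continuous on the open set \<open>U\<close>.
\<close>

primrec C_on :: "nat \<Rightarrow> nat \<Rightarrow> ('n::finite) config set \<Rightarrow> ('n config \<Rightarrow> real) \<Rightarrow> bool" where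
  "C_on 0 L U F \<longleftrightarrow> continuous_map (subtopology (euclidean_configs L) U) euclideanreal F"
| "C_on (Suc k) L U F \<longleftrightarrow>
     continuous_map (subtopology (euclidean_configs L) U) euclideanreal F \<and>
     (\<forall>i\<in>{1..L}. \<forall>j. \<exists>G.
        (\<forall>x\<in>U. ((\<lambda>t. F (x(i := x i + t *\<^sub>R axis j 1))) has_real_derivative G x) (at 0)) \<and>
        C_on k L U G)"

text \<open>
  Smoothness on the submanifold \<open>spin_configs L\<close>, defined by local smooth extensions to open subsets of \<open>(\<real>\<^sup>N)\<^sup>L\<close>.
\<close>

definition smooth :: "nat \<Rightarrow> (('n::finite) config \<Rightarrow> real) \<Rightarrow> bool" where
  "smooth L f \<longleftrightarrow>
     (\<forall>S\<in>spin_configs L. \<exists>U F.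
        openin (euclidean_configs L) U \<and> S \<in> U \<and> (\<forall>k. C_on k L U F) \<and>
        (\<forall>S'\<in>U \<inter> spin_configs L. F S' = f S'))"

text \<open>
  The gradient on the sphere with respect to the \<open>i\<close>-th spin: the tangent vector at \<open>S i\<close> representing the
  derivative along the sphere. The derivative within the sphere is determined only on
  tangent vectors; requiring orthogonality to \<open>S i\<close> makes the representing vector unique.
\<close>

definition spin_gradient :: "nat \<Rightarrow> (('n::finite) config \<Rightarrow> real) \<Rightarrow> 'n config \<Rightarrow> real ^ 'n" where
  "spin_gradient i f S =
     (THE v. v \<bullet> S i = 0 \<and>
        ((\<lambda>y. f (S(i := y))) has_derivative (\<lambda>h. v \<bullet> h)) (at (S i) within sphere 0 1))"

definition dirichlet_form :: "nat \<Rightarrow> real \<Rightarrow> (('n::finite) config \<Rightarrow> real) \<Rightarrow> real" where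
  "dirichlet_form L \<beta> f =
     1 / \<beta> * (\<Sum>i=1..L. \<integral>S. (norm (spin_gradient i f S))\<^sup>2 \<partial>gibbs_measure L \<beta>)"

text \<open>
  The gap and the relaxation time take values in \<open>[0, \<infinity>]\<close>, so that a vanishing gap would give an
  infinite relaxation time rather than the real value \<open>1 / 0 = 0\<close>.
\<close>

definition spectral_gap :: "'n::finite itself \<Rightarrow> nat \<Rightarrow> real \<Rightarrow> ennreal" where
  "spectral_gap _ L \<beta> =
     (INF f\<in>{f :: 'n config \<Rightarrow> real. smooth L f \<and> \<not> f constant_on spin_configs L}.
        ennreal (dirichlet_form L \<beta> f / prob_space.variance (gibbs_measure L \<beta>) f))"

definition relaxation_time :: "'n::finite itself \<Rightarrow> nat \<Rightarrow> real \<Rightarrow> ennreal" where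
  "relaxation_time n L \<beta> = 1 / spectral_gap n L \<beta>"

end

theory Submission imports Defs begin

text \<open>
  Read from its last spin downwards, the free boundary Gibbs measure is a Markov chain: \<open>S\<^sub>L\<close> is uniform and the law of
  \<open>S\<^sub>i\<close> given \<open>S\<^sub>i\<^sub>+\<^sub>1 = p\<close> has density \<open>exp (\<beta> * (x \<bullet> p)) / z\<close>, where \<open>z\<close> does not depend on \<open>p\<close>. The variance is
  decomposed along this chain. Since the law of the spins below \<open>S\<^sub>i\<close> rotates with \<open>S\<^sub>i\<close>, the derivative of the
  conditional expectation of \<open>f\<close> with respect to \<open>S\<^sub>i\<close> is bounded by the sum of the gradients of \<open>f\<close> in the spins
  \<open>1, \<dots>, i\<close>, and the factor \<open>L\<^sup>2\<close> comes from the Cauchy--Schwarz inequality and the sum over \<open>i\<close>.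

  This needs a Poincare inequality for one spin with density \<open>w (x \<bullet> p)\<close>, \<open>w\<close> increasing. Two points \<open>x\<close>, \<open>y\<close> divide
  their great circle into two arcs, on one of which the density is at least its minimum at \<open>x\<close> and \<open>y\<close>; there it can
  be moved inside the integral of the squared gradient at the cost of a factor \<open>sup w\<close>.
  A point at a fixed angle from \<open>x\<close> on the great circle through independent uniform \<open>x\<close> and \<open>y\<close> is uniform, so the
  Poincare constant is at most \<open>2 * pi\<^sup>2\<close> times the supremum of the density relative to the uniform law. This is
  \<open>O(\<beta> powr ((N - 1) / 2))\<close> because a cap of radius \<open>\<beta> powr (-1/2)\<close> has measure of order \<open>\<beta> powr (-(N - 1) / 2)\<close>.
\<close>

section \<open>Surface measure of the sphere\<close>

text \<open>The obstacle is concentration: the one spin density varies by a factor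
  \<open>exp (2 * \<beta>)\<close> over the sphere, and a plain comparison with the uniform law
  would lose that factor in the Poincare inequality. The arcs make a lower bound on the density
  unnecessary: of the two weights at \<open>x\<close> and \<open>y\<close> the larger is given up
  for the supremum, while the smaller survives as a weight under the gradient integral. So only the
  supremum counts, and relative to the uniform law it is polynomial in \<open>\<beta>\<close>.

  A second loss threatens in the coupling of the spins. Differentiating the kernel in
  \<open>p\<close> would bring down a factor \<open>\<beta>\<close> and a covariance at every step.
  Turning all lower spins together with \<open>p\<close> is an exact symmetry of the chain, so the
  kernel is never differentiated and the gradients of \<open>f\<close> enter with coefficient 1.

  The exponent \<open>(N + 1) / 2\<close> is \<open>(N - 1) / 2\<close> from the supremum plus 1,
  because the Dirichlet form carries a factor \<open>1 / \<beta>\<close>.\<close>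

abbreviation surf :: "(real ^ 'n::finite) measure" where "surf \<equiv> surface_measure"

abbreviation mass :: "'n::finite itself \<Rightarrow> ennreal" where
  "mass _ \<equiv> emeasure (surf :: (real ^ 'n) measure) (sphere 0 1)"

lemma ennreal_mult_right_cancel:
  fixes a b c :: ennreal
  assumes "a * c = b * c" "c \<noteq> 0" "c \<noteq> \<infinity>"
  shows "a = b"
proof -
  have "a * c / c = b * c / c" using assms(1) by simp
  thus ?thesis using assms(2,3) by (simp add: ennreal_mult_divide_eq)
qed

lemma space_surface_measure [simp]: "space (surf :: (real ^ 'n) measure) = sphere 0 1"
  by (simp add: surface_measure_def space_scale_measure space_restrict_space)

lemma sets_surface_measure [measurable_cong]:
  "sets (surf :: (real ^ 'n) measure) = sets (restrict_space borel (sphere 0 1))"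
  by (simp add: surface_measure_def)

lemma sets_surface_measure_iff:
  "A \<in> sets (surf :: (real ^ 'n) measure) \<longleftrightarrow> A \<in> sets borel \<and> A \<subseteq> sphere 0 1"
  by (auto simp: sets_surface_measure sets_restrict_space_iff)

lemma borel_measurable_sgn [measurable]:
  "sgn \<in> borel_measurable (borel :: 'a::{real_normed_vector,second_countable_topology} measure)"
  unfolding sgn_div_norm[abs_def] by measurable

lemma measurable_into_surface_measure:
  assumes "f \<in> borel_measurable M" "\<And>x. x \<in> space M \<Longrightarrow> norm (f x) = 1"
  shows "f \<in> measurable M (surf :: (real ^ 'n) measure)"
  unfolding measurable_cong_sets[OF refl sets_surface_measure]
  using assms by (intro measurable_restrict_space2) auto

lemma borel_measurable_surface_id [measurable]:
  "(\<lambda>x. x) \<in> borel_measurable (surf :: (real ^ 'n) measure)"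
  unfolding measurable_cong_sets[OF sets_surface_measure refl]
  by (intro measurable_restrict_space1) auto

lemma continuous_on_orthogonal_transformation:
  "orthogonal_transformation (Q :: 'a::euclidean_space \<Rightarrow> 'a) \<Longrightarrow> continuous_on S Q"
  by (simp add: orthogonal_transformation_linear linear_continuous_on linear_linear)

lemma measurable_orthogonal_surface:
  fixes Q :: "real ^ 'n::finite \<Rightarrow> real ^ 'n"
  assumes "orthogonal_transformation Q"
  shows "Q \<in> measurable surf surf"
proof -
  have Qb: "Q \<in> borel_measurable borel"
    by (rule borel_measurable_continuous_onI[OF continuous_on_orthogonal_transformation[OF assms]])
  show ?thesis
    using assms by (intro measurable_into_surface_measure measurable_compose[OF borel_measurable_surface_id Qb])
     (auto simp: orthogonal_transformation_norm)
qed

lemma emeasure_surface_measure: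
  fixes A :: "(real ^ 'n::finite) set"
  assumes "A \<in> sets surf"
  shows "emeasure surf A = of_nat CARD('n) * emeasure lborel {x. x \<noteq> 0 \<and> norm x < 1 \<and> sgn x \<in> A}"
proof -
  let ?R = "restrict_space lborel (ball (0::real^'n) 1 - {0})"
  have A: "A \<in> sets (restrict_space borel (sphere 0 1))" using assms by (simp add: sets_surface_measure)
  have m: "sgn \<in> measurable ?R (restrict_space borel (sphere (0::real^'n) 1))"
    by (intro measurable_restrict_space2)
       (auto simp: space_restrict_space norm_sgn intro!: measurable_restrict_space1)
  have "emeasure surf A = of_nat CARD('n) *
     emeasure (distr ?R (restrict_space borel (sphere 0 1)) sgn) A"
    by (simp add: surface_measure_def)
  also have "emeasure (distr ?R (restrict_space borel (sphere 0 1)) sgn) A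
    = emeasure ?R (sgn -` A \<inter> space ?R)"
    by (rule emeasure_distr[OF m A])
  also have "\<dots> = emeasure lborel (sgn -` A \<inter> space ?R)"
    by (subst emeasure_restrict_space) (auto simp: space_restrict_space)
  also have "sgn -` A \<inter> space ?R = {x. x \<noteq> 0 \<and> norm x < 1 \<and> sgn x \<in> A}"
    by (auto simp: space_restrict_space)
  finally show ?thesis .
qed

lemma sets_cone:
  fixes A :: "(real ^ 'n::finite) set"
  assumes "A \<in> sets surf"
  shows "{x. x \<noteq> 0 \<and> norm x < 1 \<and> sgn x \<in> A} \<in> sets borel"
proof -
  have A: "A \<in> sets borel" using assms by (simp add: sets_surface_measure_iff)
  have [measurable]: "Measurable.pred borel (\<lambda>x. x \<in> A)" using A by simp
  show ?thesis by measurable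
qed

lemma finite_surface_measure: "finite_measure (surf :: (real ^ 'n) measure)"
proof (rule finite_measureI)
  have "emeasure (surf :: (real ^ 'n) measure) (space surf)
     \<le> of_nat CARD('n) * emeasure lborel (ball (0::real^'n) 1)"
    by (subst emeasure_surface_measure) (auto simp: sets.top[of surf, simplified] intro!: mult_left_mono emeasure_mono)
  also have "\<dots> < \<infinity>"
    using emeasure_lborel_ball_finite[of "0::real^'n" 1]
    by (simp add: ennreal_mult_less_top of_nat_less_top)
  finally show "emeasure (surf :: (real ^ 'n) measure) (space surf) \<noteq> \<infinity>" by auto
qed

interpretation surf: finite_measure "surf :: (real ^ 'n::finite) measure"
  by (rule finite_surface_measure)

text \<open>
  Uniqueness of translation invariant measures, applied to the image of Lebesgue measure under \<open>Q\<close>: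
  \<open>\<integral>\<integral> 1\<^sub>A(Q x - y) 1\<^sub>B(Q x)\<close> is computed in two orders for the unit ball \<open>B\<close>, which \<open>Q\<close> preserves.
\<close>

lemma distr_lborel_orthogonal:
  fixes Q :: "'a::euclidean_space \<Rightarrow> 'a"
  assumes Q: "orthogonal_transformation Q"
  shows "distr lborel borel Q = lborel"
proof (rule measure_eqI)
  have lin: "linear Q" using Q by (simp add: orthogonal_transformation_linear)
  have Qm [measurable]: "Q \<in> borel_measurable borel"
    by (rule borel_measurable_continuous_onI[OF continuous_on_orthogonal_transformation[OF Q]])
  have bij: "bij Q" using Q orthogonal_transformation_bij by blast
  have plus: "(\<integral>\<^sup>+y. f (y + x) \<partial>lborel) = (\<integral>\<^sup>+y. f y \<partial>lborel)"
    if [measurable]: "f \<in> borel_measurable borel" for f :: "'a \<Rightarrow> ennreal" and x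
    by (subst lborel_distr_plus[symmetric, of x], subst nn_integral_distr) (auto simp: add.commute)
  have refl: "(\<integral>\<^sup>+y. f (x - y) \<partial>lborel) = (\<integral>\<^sup>+y. f y \<partial>lborel)"
    if [measurable]: "f \<in> borel_measurable borel" for f :: "'a \<Rightarrow> ennreal" and x
    by (subst (2) lborel_affine[of "-1" x], simp, subst nn_integral_density, simp, simp, subst nn_integral_distr)
      auto
  fix A assume "A \<in> sets (distr lborel borel Q)"
  hence A [measurable]: "A \<in> sets borel" by simp
  define B where "B = ball (0::'a) 1"
  have B [measurable]: "B \<in> sets borel" by (simp add: B_def)
  have Qs [measurable]: "Q -` A \<in> sets borel" using measurable_sets_borel[OF Qm A] by simp
  have QB: "Q -` B = B" using orthogonal_transformation_norm[OF Q] by (auto simp: B_def)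
  have iQ: "indicator A (Q x) = (indicator (Q -` A) x :: ennreal)" for x by (simp add: indicator_def)
  have iB: "indicator B (Q x) = (indicator B x :: ennreal)" for x using QB by (auto simp: indicator_def)
  have "emeasure lborel (Q -` A) * emeasure lborel B = (\<integral>\<^sup>+x. (\<integral>\<^sup>+y. indicator A (Q x) * indicator B y \<partial>lborel) \<partial>lborel)"
    by (simp add: nn_integral_cmult nn_integral_multc iQ)
  also have "\<dots> = (\<integral>\<^sup>+x. (\<integral>\<^sup>+y. indicator A (Q x) * indicator B (y + Q x) \<partial>lborel) \<partial>lborel)"
    by (intro nn_integral_cong plus[symmetric]) measurable
  also have "\<dots> = (\<integral>\<^sup>+y. (\<integral>\<^sup>+x. indicator A (Q x) * indicator B (y + Q x) \<partial>lborel) \<partial>lborel)"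
    by (rule lborel_pair.Fubini') measurable
  also have "\<dots> = (\<integral>\<^sup>+y. (\<integral>\<^sup>+x. indicator A (Q x - y) * indicator B (Q x) \<partial>lborel) \<partial>lborel)"
  proof (rule nn_integral_cong)
    fix y
    \<comment> \<open>Writing the shift as \<open>Q z\<close> turns a translation after
      \<open>Q\<close> into one before it, under which Lebesgue measure is known to be
      invariant.\<close>
    obtain z where "y = Q z" using bij by (metis bij_pointE)
    thus "(\<integral>\<^sup>+x. indicator A (Q x) * indicator B (y + Q x) \<partial>lborel) = (\<integral>\<^sup>+x. indicator A (Q x - y) * indicator B (Q x) \<partial>lborel)"
      by (subst plus[of "\<lambda>x. indicator A (Q x - y) * indicator B (Q x)" z, symmetric])
        (simp_all add: linear_add[OF lin] add.commute)
  qed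
  also have "\<dots> = (\<integral>\<^sup>+x. (\<integral>\<^sup>+y. indicator A (Q x - y) * indicator B (Q x) \<partial>lborel) \<partial>lborel)"
    by (rule lborel_pair.Fubini'[symmetric]) measurable
  also have "\<dots> = (\<integral>\<^sup>+x. (\<integral>\<^sup>+y. indicator A y * indicator B (Q x) \<partial>lborel) \<partial>lborel)"
  proof (rule nn_integral_cong)
    fix x
    show "(\<integral>\<^sup>+y. indicator A (Q x - y) * indicator B (Q x) \<partial>lborel) = (\<integral>\<^sup>+y. indicator A y * indicator B (Q x) \<partial>lborel)"
      by (rule refl[of "\<lambda>y. indicator A y * indicator B (Q x)" "Q x"]) measurable
  qed
  also have "\<dots> = emeasure lborel A * emeasure lborel B"
    by (simp add: nn_integral_cmult nn_integral_multc iB)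
  finally have eq: "emeasure lborel (Q -` A) * emeasure lborel B = emeasure lborel A * emeasure lborel B" .
  have "emeasure lborel B \<noteq> \<infinity>" using emeasure_lborel_ball_finite[of "0::'a" 1] by (auto simp: B_def)
  moreover have "emeasure lborel B \<noteq> 0"
    using content_ball_pos[of 1 "0::'a"] by (auto simp: B_def measure_def)
  ultimately have "emeasure lborel (Q -` A) = emeasure lborel A"
    using eq ennreal_mult_right_cancel by blast
  thus "emeasure (distr lborel borel Q) A = emeasure lborel A" by (simp add: emeasure_distr)
qed simp

text \<open>Since \<open>sgn\<close> commutes with \<open>Q\<close>, the cone over a preimage is the
  preimage of the cone, and the invariance of Lebesgue measure carries over.\<close>

lemma distr_surface_orthogonal:
  fixes Q :: "real ^ 'n::finite \<Rightarrow> real ^ 'n"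
  assumes Q: "orthogonal_transformation Q"
  shows "distr surf surf Q = surf"
proof (rule measure_eqI)
  have Qm: "Q \<in> measurable surf surf" by (rule measurable_orthogonal_surface[OF Q])
  have Qb: "Q \<in> borel_measurable lborel"
    using borel_measurable_continuous_onI[OF continuous_on_orthogonal_transformation[OF Q]] by simp
  fix A assume "A \<in> sets (distr surf surf Q)"
  hence A: "A \<in> sets surf" by simp
  let ?B = "Q -` A \<inter> space surf" and ?c = "\<lambda>A. {x::real^'n. x \<noteq> 0 \<and> norm x < 1 \<and> sgn x \<in> A}"
  have B: "?B \<in> sets surf" using measurable_sets[OF Qm A] .
  have sg: "sgn (Q x) = Q (sgn x)" for x
    using Q by (simp add: sgn_div_norm orthogonal_transformation_norm orthogonal_transformation_scaleR)
  have n0: "Q x = 0 \<longleftrightarrow> x = 0" for x using orthogonal_transformation_norm[OF Q, of x]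
    by (metis norm_eq_zero)
  have "?c ?B = Q -` ?c A \<inter> space lborel"
    by (auto simp: n0 sg orthogonal_transformation_norm[OF Q] norm_sgn)
  hence "emeasure lborel (?c ?B) = emeasure (distr lborel borel Q) (?c A)"
    by (simp only: emeasure_distr[OF Qb sets_cone[OF A]])
  hence "emeasure lborel (?c ?B) = emeasure lborel (?c A)" by (simp only: distr_lborel_orthogonal[OF Q])
  hence "emeasure surf ?B = emeasure surf A"
    unfolding emeasure_surface_measure[OF A] emeasure_surface_measure[OF B] by (rule arg_cong)
  thus "emeasure (distr surf surf Q) A = emeasure surf A" by (simp only: emeasure_distr[OF Qm A])
qed simp

text \<open>The cone over an antipodal pair lies in a line, which is a Lebesgue null set once the
  dimension is at least 2. This makes the degenerate case of \<open>great\<close> harmless.\<close>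

lemma emeasure_surface_pair:
  fixes x :: "real ^ 'n::finite"
  assumes N: "CARD('n) \<ge> 2" and x: "norm x = 1"
  shows "emeasure surf {x, -x} = 0"
proof -
  have m: "{x, -x} \<in> sets surf" using x by (simp add: sets_surface_measure_iff)
  have "{y. y \<noteq> 0 \<and> norm y < 1 \<and> sgn y \<in> {x, -x}} \<subseteq> span {x}"
  proof
    fix y assume "y \<in> {y. y \<noteq> 0 \<and> norm y < 1 \<and> sgn y \<in> {x, -x}}"
    hence "y = norm y *\<^sub>R sgn y" "sgn y \<in> {x, -x}" by (auto simp: sgn_div_norm)
    hence "y = norm y *\<^sub>R x \<or> y = (- norm y) *\<^sub>R x" by auto
    thus "y \<in> span {x}" by (metis singletonI span_base span_scale)
  qed
  moreover have "negligible (span {x})"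
  proof (rule negligible_lowdim)
    have "dim (span {x}) \<le> 1" by (simp add: dim_singleton)
    thus "dim (span {x}) < DIM(real ^ 'n)" using N by simp
  qed
  ultimately have "negligible {y. y \<noteq> 0 \<and> norm y < 1 \<and> sgn y \<in> {x, -x}}"
    using negligible_subset by blast
  hence "emeasure lebesgue {y. y \<noteq> 0 \<and> norm y < 1 \<and> sgn y \<in> {x, -x}} = 0"
    by (simp add: negligible_iff_null_sets null_setsD1)
  hence "emeasure lborel {y. y \<noteq> 0 \<and> norm y < 1 \<and> sgn y \<in> {x, -x}} = 0"
    using sets_cone[OF m] by simp
  thus ?thesis unfolding emeasure_surface_measure[OF m] by simp
qed

section \<open>Spherical caps and uniqueness of the invariant measure\<close>

lemma sets_cap: "{x. norm x = 1 \<and> x \<bullet> p \<ge> t} \<in> sets (surf :: (real ^ 'n) measure)"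
proof -
  have "{x. norm x = 1 \<and> x \<bullet> p \<ge> t} \<in> sets (borel :: (real ^ 'n::finite) measure)" by measurable
  thus ?thesis by (auto simp: sets_surface_measure_iff)
qed

text \<open>Orthogonal maps act transitively on unit vectors. The measure is kept general because
  the uniqueness proof compares caps under the surface measure and under another invariant
  measure.\<close>

lemma emeasure_cap_invariant:
  fixes \<mu> :: "(real ^ 'n::finite) measure"
  assumes sets: "sets \<mu> = sets surf" and inv: "\<And>Q. orthogonal_transformation Q \<Longrightarrow> distr \<mu> \<mu> Q = \<mu>"
    and pq: "norm p = 1" "norm q = 1"
  shows "emeasure \<mu> {x. norm x = 1 \<and> x \<bullet> p \<ge> t} = emeasure \<mu> {x. norm x = 1 \<and> x \<bullet> q \<ge> t}"
proof -
  let ?cap = "\<lambda>p. {x. norm x = 1 \<and> x \<bullet> p \<ge> t}"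
  obtain Q where Q: "orthogonal_transformation Q" "Q p = q"
    using orthogonal_transformation_exists[of p q] pq by auto
  have Qm: "Q \<in> measurable \<mu> \<mu>"
    using measurable_orthogonal_surface[OF Q(1)] by (simp add: measurable_cong_sets[OF sets sets])
  have "emeasure \<mu> (?cap q) = emeasure (distr \<mu> \<mu> Q) (?cap q)" by (simp add: inv[OF Q(1)])
  also have "\<dots> = emeasure \<mu> (Q -` ?cap q \<inter> space \<mu>)"
    by (rule emeasure_distr[OF Qm]) (simp add: sets sets_cap)
  also have "Q -` ?cap q \<inter> space \<mu> = ?cap p"
    using Q orthogonal_transformation_norm[OF Q(1)] sets_eq_imp_space_eq[OF sets]
    by (auto simp: orthogonal_transformation_def)
  finally show ?thesis by simp
qed

lemmas emeasure_cap_orthogonal = emeasure_cap_invariant[OF refl distr_surface_orthogonal]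

text \<open>
  The cone over the cap contains a box of length \<open>1/4\<close> along the axis and width of order
  \<open>sqrt s\<close> in the other directions.
\<close>

lemma emeasure_cap_ge:
  fixes p :: "real ^ 'n::finite"
  assumes p: "norm p = 1" and s: "0 < s" "s \<le> 1"
  shows "emeasure surf {x. norm x = 1 \<and> x \<bullet> p \<ge> 1 - s}
     \<ge> ennreal (1/4 * (sqrt s / (2 * real CARD('n))) ^ (CARD('n) - 1))"
proof -
  define N where "N = real CARD('n)"
  have N1: "N \<ge> 1" unfolding N_def using zero_less_card_finite[where 'a='n] by linarith
  define k :: 'n where "k = undefined"
  define e :: "real ^ 'n" where "e = axis k 1"
  \<comment> \<open>With this width the transverse coordinates add at most \<open>s / 16\<close> to
    the squared norm. The matching \<open>1 / 16\<close> is the least value of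
    \<open>(x $ k)\<^sup>2\<close> on the box, and the two cancel in the bound on
    \<open>(1 - s) * norm x\<close>.\<close>
  define d where "d = sqrt s / (4 * N)"
  have d: "d > 0" using s N1 by (simp add: d_def)
  define a b :: "real ^ 'n" where "a = (\<chi> i. if i = k then 1/4 else - d)" and "b = (\<chi> i. if i = k then 1/2 else d)"
  let ?cap = "{x::real^'n. norm x = 1 \<and> x \<bullet> e \<ge> 1 - s}"
  let ?C = "{x::real^'n. x \<noteq> 0 \<and> norm x < 1 \<and> sgn x \<in> ?cap}"
  have sub: "cbox a b \<subseteq> ?C"
  proof
    fix x assume x: "x \<in> cbox a b"
    have xk: "1/4 \<le> x $ k" "x $ k \<le> 1/2"
      using x by (auto simp: mem_box_cart a_def b_def dest!: spec[of _ k])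
    have xi: "\<bar>x $ i\<bar> \<le> d" if "i \<noteq> k" for i
      using x that by (auto simp: mem_box_cart a_def b_def dest!: spec[of _ i])
    have x0: "x \<noteq> 0" using xk by auto
    have "(norm x)\<^sup>2 = (\<Sum>i\<in>UNIV. (x $ i)\<^sup>2)"
      by (simp add: norm_vec_def L2_set_def sum_nonneg)
    also have "\<dots> = (x $ k)\<^sup>2 + (\<Sum>i\<in>UNIV - {k}. (x $ i)\<^sup>2)"
      by (subst sum.remove[of _ k]) auto
    also have "(\<Sum>i\<in>UNIV - {k}. (x $ i)\<^sup>2) \<le> (\<Sum>i\<in>UNIV - {k}. d\<^sup>2)"
      by (intro sum_mono) (metis Diff_iff singletonI xi d abs_le_square_iff abs_of_pos)
    also have "\<dots> \<le> N * d\<^sup>2" by (auto simp: N_def card_Diff_singleton intro!: mult_right_mono)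
    also have "N * d\<^sup>2 = s / (16 * N)" using N1 s by (simp add: d_def power2_eq_square field_simps)
    also have "\<dots> \<le> s / 16" using N1 s by (simp add: field_simps)
    finally have nx: "(norm x)\<^sup>2 \<le> (x $ k)\<^sup>2 + s / 16" by simp
    have xk2: "(x $ k)\<^sup>2 \<le> 1/4" using xk power_mono[of "x $ k" "1/2" 2] by (simp add: power2_eq_square)
    have xk3: "(x $ k)\<^sup>2 \<ge> 1/16" using xk power_mono[of "1/4" "x $ k" 2] by (simp add: power2_eq_square)
    have "(norm x)\<^sup>2 < 1" using nx xk2 s by linarith
    hence n1: "norm x < 1" by (metis abs_norm_cancel abs_square_less_1)
    have "((1 - s) * norm x)\<^sup>2 \<le> (1 - s) * (norm x)\<^sup>2"
    proof -
      have "(1 - s)\<^sup>2 \<le> 1 - s" using s by (simp add: power2_eq_square mult_left_le_one_le)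
      thus ?thesis unfolding power_mult_distrib by (rule mult_right_mono) simp
    qed
    also have "\<dots> \<le> (1 - s) * ((x $ k)\<^sup>2 + s / 16)" using nx s by (intro mult_left_mono) auto
    also have "\<dots> \<le> (x $ k)\<^sup>2"
    proof -
      have "s * (1/16) \<le> s * (x $ k)\<^sup>2" using xk3 s by (intro mult_left_mono) auto
      moreover have "0 \<le> s * s" by simp
      moreover have "(1 - s) * ((x $ k)\<^sup>2 + s / 16) = (x $ k)\<^sup>2 + s * (1/16) - s * (x $ k)\<^sup>2 - s * s / 16"
        by (simp add: field_simps)
      ultimately show ?thesis by linarith
    qed
    finally have "(1 - s) * norm x \<le> x $ k"
      by (rule power2_le_imp_le) (use xk in linarith)
    hence "sgn x \<bullet> e \<ge> 1 - s"
    proof -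
      have "sgn x \<bullet> e = x $ k / norm x"
        unfolding e_def inner_axis by (simp add: sgn_div_norm divide_real_def mult.commute)
      moreover have "1 - s \<le> x $ k / norm x"
        using \<open>(1 - s) * norm x \<le> x $ k\<close> x0 by (subst pos_le_divide_eq) auto
      ultimately show ?thesis by simp
    qed
    thus "x \<in> ?C" using x0 n1 by (simp add: norm_sgn)
  qed
  have ab: "\<forall>i. a $ i \<le> b $ i" using d by (auto simp: a_def b_def)
  have "1/4 * (sqrt s / (2 * N)) ^ (CARD('n) - 1) = (1/4) * (\<Prod>i\<in>UNIV - {k}. 2 * d)"
    by (simp add: d_def card_Diff_singleton)
  also have "\<dots> = (\<Prod>i\<in>UNIV. b $ i - a $ i)"
    by (subst (2) prod.remove[of _ k]) (auto simp: a_def b_def intro!: prod.cong)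
  also have "\<dots> = measure lborel (cbox a b)"
    using ab content_cbox_cart[of a b] by (simp add: interval_eq_empty_cart not_less interval_ne_empty_cart)
  finally have "ennreal (1/4 * (sqrt s / (2 * N)) ^ (CARD('n) - 1)) = emeasure lborel (cbox a b)"
    using emeasure_lborel_cbox_finite[of a b] by (simp add: emeasure_eq_ennreal_measure)
  also have "\<dots> \<le> emeasure lborel ?C"
    by (intro emeasure_mono sub) (use sets_cone[OF sets_cap[of "1 - s" e]] in simp)
  also have "\<dots> \<le> of_nat CARD('n) * emeasure lborel ?C"
  proof -
    have "(1::ennreal) \<le> of_nat CARD('n)"
      by (metis One_nat_def Suc_leI of_nat_1 of_nat_mono zero_less_card_finite)
    from mult_right_mono[OF this, of "emeasure lborel ?C"] show ?thesis by simp
  qed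
  also have "\<dots> = emeasure surf ?cap" by (rule emeasure_surface_measure[OF sets_cap, symmetric])
  also have "\<dots> = emeasure surf {x. norm x = 1 \<and> x \<bullet> p \<ge> 1 - s}"
    by (rule emeasure_cap_orthogonal) (simp_all add: p e_def)
  finally show ?thesis unfolding N_def .
qed

lemma emeasure_cap_pos:
  fixes p :: "real ^ 'n::finite"
  assumes "norm p = 1" "t < 1"
  shows "emeasure surf {x. norm x = 1 \<and> x \<bullet> p \<ge> t} > 0"
proof -
  define s where "s = min 1 (1 - t)"
  have s: "0 < s" "s \<le> 1" using assms by (auto simp: s_def)
  have "0 < ennreal (1/4 * (sqrt s / (2 * real CARD('n))) ^ (CARD('n) - 1))"
    using s by simp
  also have "\<dots> \<le> emeasure surf {x. norm x = 1 \<and> x \<bullet> p \<ge> 1 - s}" by (rule emeasure_cap_ge[OF assms(1) s])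
  also have "\<dots> \<le> emeasure surf {x. norm x = 1 \<and> x \<bullet> p \<ge> t}"
    by (intro emeasure_mono sets_cap) (auto simp: s_def)
  finally show ?thesis .
qed

lemma norm_diff_unit:
  fixes x y :: "'a::real_inner"
  assumes "norm x = 1" "norm y = 1"
  shows "(dist x y)\<^sup>2 = 2 - 2 * (x \<bullet> y)"
  using assms by (simp add: dist_norm power2_norm_eq_inner algebra_simps inner_commute norm_eq_1)

text \<open>Every ball around \<open>p\<close> contains a cap: an inner product of at least
  \<open>1 - e\<^sup>2 / 4\<close> with \<open>p\<close> means a squared distance of at most
  \<open>e\<^sup>2 / 2\<close>.\<close>

lemma emeasure_surface_open_pos:
  fixes p :: "real ^ 'n::finite"
  assumes "norm p = 1" "open U" "p \<in> U"
  shows "emeasure surf (U \<inter> sphere 0 1) > 0"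
proof -
  obtain e where e: "e > 0" "ball p e \<subseteq> U" using assms openE by blast
  have "0 < emeasure surf {x. norm x = 1 \<and> x \<bullet> p \<ge> 1 - e\<^sup>2 / 4}"
    using e by (intro emeasure_cap_pos[OF assms(1)]) auto
  also have "\<dots> \<le> emeasure surf (U \<inter> sphere 0 1)"
  proof (intro emeasure_mono)
    show "{x. norm x = 1 \<and> 1 - e\<^sup>2 / 4 \<le> x \<bullet> p} \<subseteq> U \<inter> sphere 0 1"
    proof safe
      fix x assume x: "norm x = 1" "1 - e\<^sup>2 / 4 \<le> x \<bullet> p"
      have "0 < e\<^sup>2" using e by simp
      hence "(dist x p)\<^sup>2 < e\<^sup>2" using norm_diff_unit[OF x(1) assms(1)] x(2) by linarith
      hence "dist p x < e" using e by (metis dist_commute power2_less_imp_less less_imp_le)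
      thus "x \<in> U" using e by auto
    qed auto
  qed (use assms in \<open>auto simp: sets_surface_measure_iff\<close>)
  finally show ?thesis .
qed

text \<open>
  Averaging the indicator of an open set \<open>A\<close> over caps of radius tending to 0 gives
  \<open>\<mu> A \<le> surf A\<close> by Fatou, because by invariance all caps of a given radius have the same \<open>\<mu>\<close>-measure.
  Outer regularity extends this to Borel sets, and the total masses agree.
\<close>

lemma invariant_eq_surface_measure:
  fixes \<mu> :: "(real ^ 'n::finite) measure"
  assumes sets: "sets \<mu> = sets surf"
    and mass: "emeasure \<mu> (sphere 0 1) = mass TYPE('n)"
    and inv: "\<And>Q. orthogonal_transformation Q \<Longrightarrow> distr \<mu> \<mu> Q = \<mu>"
  shows "\<mu> = surf"
proof -
  have space: "space \<mu> = sphere 0 1" using sets_eq_imp_space_eq[OF sets] by simp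
  note [measurable_cong] = sets
  interpret m: finite_measure \<mu>
    by (rule finite_measureI) (simp add: space mass)
  interpret P: pair_sigma_finite \<mu> "surf :: (real^'n) measure" ..
  define cap where "cap t y = {x :: real^'n. norm x = 1 \<and> x \<bullet> y \<ge> t}" for t y
  define c where "c t = emeasure surf (cap t (axis undefined 1))" for t
  have surf_cap: "emeasure surf (cap t y) = c t" if "norm y = 1" for t y
    unfolding c_def cap_def by (rule emeasure_cap_orthogonal) (auto simp: that)
  have [measurable]: "cap t y \<in> sets surf" for t y unfolding cap_def by (rule sets_cap)
  have mu_cap: "emeasure \<mu> (cap t p) = emeasure \<mu> (cap t q)" if "norm p = 1" "norm q = 1" for t p q
    unfolding cap_def by (rule emeasure_cap_invariant[OF sets inv that])
  have s0: "mass TYPE('n) > 0"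
    using emeasure_surface_open_pos[of "axis undefined 1 :: real^'n" UNIV] by simp
  have sfin: "mass TYPE('n) < \<infinity>"
    by (simp add: less_top[symmetric])
  \<comment> \<open>The relation \<open>x \<bullet> y \<ge> t\<close> is symmetric. Its indicator,
    integrated against both measures, has a constant inner integral in either order, so equal total
    masses force equal cap measures.\<close>
  have cap_eq: "emeasure \<mu> (cap t q) = c t" if q: "norm q = 1" for t q
  proof -
    have [measurable]: "(\<lambda>z. indicator (cap t (snd z)) (fst z) :: ennreal) \<in> borel_measurable (\<mu> \<Otimes>\<^sub>M surf)"
    proof -
      have "(\<lambda>z. indicator (cap t (snd z)) (fst z) :: ennreal) =
        (\<lambda>z. if norm (fst z) = 1 \<and> fst z \<bullet> snd z \<ge> t then 1 else 0)"
        by (auto simp: cap_def indicator_def)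
      moreover have "\<dots> \<in> borel_measurable (\<mu> \<Otimes>\<^sub>M surf)" by measurable
      ultimately show ?thesis by simp
    qed
    have "(\<integral>\<^sup>+y. emeasure \<mu> (cap t y) \<partial>surf) = (\<integral>\<^sup>+y. (\<integral>\<^sup>+x. indicator (cap t y) x \<partial>\<mu>) \<partial>surf)"
      by (intro nn_integral_cong) (simp add: sets)
    also have "\<dots> = (\<integral>\<^sup>+x. (\<integral>\<^sup>+y. indicator (cap t y) x \<partial>surf) \<partial>\<mu>)"
      by (rule P.Fubini') (simp add: case_prod_unfold)
    also have "\<dots> = (\<integral>\<^sup>+x. emeasure surf (cap t x) \<partial>\<mu>)"
    proof (rule nn_integral_cong)
      fix x assume x: "x \<in> space \<mu>"
      have "(\<integral>\<^sup>+y. indicator (cap t y) x \<partial>surf) = (\<integral>\<^sup>+y. indicator (cap t x) y \<partial>surf)"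
        using x by (intro nn_integral_cong) (auto simp: space cap_def indicator_def inner_commute)
      thus "(\<integral>\<^sup>+y. indicator (cap t y) x \<partial>surf) = emeasure surf (cap t x)" by simp
    qed
    also have "\<dots> = (\<integral>\<^sup>+x. c t \<partial>\<mu>)" by (intro nn_integral_cong) (simp add: space surf_cap)
    also have "\<dots> = c t * mass TYPE('n)" by (simp add: space mass)
    finally have "(\<integral>\<^sup>+y. emeasure \<mu> (cap t y) \<partial>surf) = c t * mass TYPE('n)" .
    moreover have "(\<integral>\<^sup>+y. emeasure \<mu> (cap t y) \<partial>surf) = (\<integral>\<^sup>+y. emeasure \<mu> (cap t q) \<partial>(surf :: (real^'n) measure))"
      by (intro nn_integral_cong mu_cap) (auto simp: q)
    ultimately have "emeasure \<mu> (cap t q) * mass TYPE('n) = c t * mass TYPE('n)"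
      by simp
    thus ?thesis by (rule ennreal_mult_right_cancel) (use s0 in simp_all)
  qed
  have open_le: "emeasure \<mu> (U \<inter> sphere 0 1) \<le> emeasure surf (U \<inter> sphere 0 1)" if U: "open U" for U
  proof -
    define A where "A = U \<inter> sphere 0 1"
    have A: "A \<in> sets surf" using U by (auto simp: sets_surface_measure_iff A_def)
    have A' [measurable]: "A \<in> sets \<mu>" using A by (simp add: sets)
    note A[measurable]
    define t where "t n = 1 - 1 / real (Suc n)" for n
    have ct: "c (t n) > 0" for n unfolding c_def cap_def by (rule emeasure_cap_pos) (auto simp: t_def)
    have cf: "c (t n) < \<infinity>" for n
      unfolding c_def by (simp add: less_top[symmetric])
    \<comment> \<open>The fraction of a small cap around \<open>x\<close> that lies in
      \<open>A\<close>. Its \<open>\<mu>\<close>-integral is \<open>emeasure surf A\<close> for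
      every \<open>n\<close>, while at points of the relatively open set \<open>A\<close> it is
      eventually 1.\<close>
    define h where "h n x = emeasure surf (cap (t n) x \<inter> A) / c (t n)" for n x
    let ?i = "\<lambda>n x. \<integral>\<^sup>+y. indicator (cap (t n) x \<inter> A) y \<partial>surf"
    let ?j = "\<lambda>n y. \<integral>\<^sup>+x. indicator (cap (t n) x \<inter> A) y \<partial>\<mu>"
    have [measurable]: "(\<lambda>z. indicator (cap t (fst z) \<inter> A) (snd z) :: ennreal) \<in> borel_measurable (\<mu> \<Otimes>\<^sub>M surf)" for t
    proof -
      have "(\<lambda>z. indicator (cap t (fst z) \<inter> A) (snd z) :: ennreal) =
        (\<lambda>z. if norm (snd z) = 1 \<and> snd z \<bullet> fst z \<ge> t then indicator A (snd z) else 0)"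
        by (auto simp: cap_def indicator_def)
      moreover have "\<dots> \<in> borel_measurable (\<mu> \<Otimes>\<^sub>M surf)" by measurable
      ultimately show ?thesis by simp
    qed
    have hi: "h n x = ?i n x / c (t n)" for n x
      by (simp add: h_def)
    have im [measurable]: "(\<lambda>x. \<integral>\<^sup>+y. indicator (cap t x \<inter> A) y \<partial>surf) \<in> borel_measurable \<mu>" for t
      by (rule surf.borel_measurable_nn_integral) (simp add: case_prod_unfold)
    have hm [measurable]: "h n \<in> borel_measurable \<mu>" for n
      unfolding hi[abs_def] by (intro borel_measurable_divide_ennreal im borel_measurable_const)
    have hint: "(\<integral>\<^sup>+x. h n x \<partial>\<mu>) = emeasure surf A" for n
    proof -
      have "(\<integral>\<^sup>+x. h n x \<partial>\<mu>) = (\<integral>\<^sup>+x. ?i n x \<partial>\<mu>) / c (t n)"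
        unfolding hi by (rule nn_integral_divide[OF im])
      also have "(\<integral>\<^sup>+x. ?i n x \<partial>\<mu>) =
         (\<integral>\<^sup>+y. ?j n y \<partial>surf)"
        by (rule P.Fubini'[symmetric]) (simp add: case_prod_unfold)
      also have "\<dots> = (\<integral>\<^sup>+y. c (t n) * indicator A y \<partial>surf)"
      proof (rule nn_integral_cong)
        fix y :: "real^'n" assume y: "y \<in> space surf"
        have "?j n y = (\<integral>\<^sup>+x. indicator A y * indicator (cap (t n) y) x \<partial>\<mu>)"
          using y by (intro nn_integral_cong) (auto simp: space cap_def indicator_def inner_commute)
        also have "\<dots> = indicator A y * emeasure \<mu> (cap (t n) y)" by (simp add: nn_integral_cmult sets)
        also have "\<dots> = c (t n) * indicator A y" using y by (simp add: cap_eq mult.commute)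
        finally show "?j n y = c (t n) * indicator A y" .
      qed
      also have "\<dots> = c (t n) * emeasure surf A" by (simp add: nn_integral_cmult)
      also have "\<dots> / c (t n) = emeasure surf A"
        using ct[of n] cf[of n] by (subst mult.commute, subst ennreal_mult_divide_eq) auto
      finally show ?thesis .
    qed
    have lim: "indicator A x \<le> liminf (\<lambda>n. h n x)" if x: "x \<in> space \<mu>" for x
    proof (cases "x \<in> A")
      case True
      then obtain e where e: "e > 0" "ball x e \<subseteq> U" using U openE by (auto simp: A_def)
      obtain m :: nat where m: "2 / e\<^sup>2 < real m" using reals_Archimedean2 by blast
      have "h n x = 1" if n: "n \<ge> m" for n
      proof -
        have "cap (t n) x \<inter> A = cap (t n) x"
        proof -
          have "y \<in> U" if y: "norm y = 1" "y \<bullet> x \<ge> t n" for y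
          proof -
            have "(dist y x)\<^sup>2 \<le> 2 * (1 / real (Suc n))"
              using norm_diff_unit[of y x] y x by (simp add: space t_def)
            also have "\<dots> < e\<^sup>2"
            proof -
              have "2 / e\<^sup>2 < real (Suc n)" using m n by linarith
              thus ?thesis using e by (simp add: field_simps)
            qed
            finally have "dist x y < e" using e by (metis dist_commute power2_less_imp_less less_imp_le)
            thus ?thesis using e by auto
          qed
          thus ?thesis by (auto simp: cap_def A_def)
        qed
        hence "h n x = c (t n) / c (t n)" using x by (simp add: h_def surf_cap space)
        thus ?thesis using ct[of n] cf[of n] by (simp add: ennreal_divide_self)
      qed
      hence "(1::ennreal) \<le> liminf (\<lambda>n. h n x)"
        by (intro Liminf_bounded) (auto simp: eventually_sequentially intro!: exI[of _ m])
      thus ?thesis using True by simp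
    qed simp
    have "emeasure \<mu> A = (\<integral>\<^sup>+x. indicator A x \<partial>\<mu>)" by simp
    also have "\<dots> \<le> (\<integral>\<^sup>+x. liminf (\<lambda>n. h n x) \<partial>\<mu>)" by (intro nn_integral_mono lim)
    also have "\<dots> \<le> liminf (\<lambda>n. \<integral>\<^sup>+x. h n x \<partial>\<mu>)" by (rule nn_integral_liminf) measurable
    also have "\<dots> = emeasure surf A" by (simp add: hint Liminf_const)
    finally show ?thesis by (simp add: A_def)
  qed
  have le: "emeasure \<mu> A \<le> emeasure surf A" if A: "A \<in> sets surf" for A
  proof -
    let ?s = "distr surf borel (\<lambda>x. x)"
    have Ab: "A \<in> sets borel" "A \<subseteq> sphere 0 1" using A by (auto simp: sets_surface_measure_iff)
    have se: "emeasure ?s B = emeasure surf (B \<inter> sphere 0 1)" if "B \<in> sets borel" for B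
      using that by (subst emeasure_distr) auto
    have "emeasure ?s A = (INF K\<in>{K. A \<subseteq> K \<and> open K}. emeasure ?s K)"
    proof (rule outer_regular)
      show "emeasure ?s (space ?s) \<noteq> \<infinity>" by (simp add: se surf.emeasure_finite)
    qed (use Ab in auto)
    moreover have "emeasure \<mu> A \<le> (INF K\<in>{K. A \<subseteq> K \<and> open K}. emeasure ?s K)"
    proof (rule INF_greatest)
      fix K assume K: "K \<in> {K. A \<subseteq> K \<and> open K}"
      have "emeasure \<mu> A \<le> emeasure \<mu> (K \<inter> sphere 0 1)"
        using K Ab by (intro emeasure_mono) (auto simp: sets sets_surface_measure_iff)
      also have "\<dots> \<le> emeasure surf (K \<inter> sphere 0 1)" using K open_le by blast
      also have "\<dots> = emeasure ?s K" using K by (simp add: se)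
      finally show "emeasure \<mu> A \<le> emeasure ?s K" .
    qed
    moreover have "emeasure ?s A = emeasure surf A" using se[OF Ab(1)] Ab(2) by (simp add: Int_absorb2)
    ultimately show ?thesis by simp
  qed
  show ?thesis
  proof (rule measure_eqI[OF sets])
    fix A assume A: "A \<in> sets \<mu>"
    hence A': "A \<in> sets surf" by (simp add: sets)
    \<comment> \<open>The inequality holds for \<open>A\<close> and for its complement, and the
      totals are equal and finite, so neither can be strict.\<close>
    have "emeasure surf A + emeasure surf (sphere 0 1 - A) = mass TYPE('n)"
      using A' sets.top[of "surf :: (real^'n) measure"] by (subst plus_emeasure) (auto simp: Un_absorb1 sets_surface_measure_iff)
    moreover have "emeasure \<mu> A + emeasure \<mu> (sphere 0 1 - A) = emeasure \<mu> (sphere 0 1)"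
      using A sets.top[of "\<mu>"] sets.sets_into_space[OF A] by (subst plus_emeasure) (auto simp: space Un_absorb1)
    moreover have "emeasure \<mu> A \<le> emeasure surf A" by (rule le[OF A'])
    moreover have "emeasure \<mu> (sphere 0 1 - A) \<le> emeasure surf (sphere 0 1 - A)"
      using A' sets.top[of "surf :: (real^'n) measure"] by (intro le) auto
    ultimately have le1: "emeasure \<mu> A \<le> emeasure surf A"
      and "emeasure surf (sphere 0 1 - A) + emeasure surf A \<le> emeasure surf (sphere 0 1 - A) + emeasure \<mu> A"
      unfolding mass by (simp_all add: add.commute) (metis add.commute add_left_mono)
    moreover have "emeasure surf (sphere 0 1 - A) \<noteq> \<top>" by simp
    ultimately show "emeasure \<mu> A = emeasure surf A"
      unfolding ennreal_add_left_cancel_le by auto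
  qed
qed

section \<open>Poincare inequality on the sphere\<close>

definition circ :: "'a::real_vector \<Rightarrow> 'a \<Rightarrow> real \<Rightarrow> 'a" where
  "circ u v \<theta> = cos \<theta> *\<^sub>R u + sin \<theta> *\<^sub>R v"

text \<open>The Gram-Schmidt direction. For a unit vector \<open>x\<close>, \<open>sgn\<close> makes
  it 0 exactly when \<open>y\<close> is a multiple of \<open>x\<close>, which serves as the test for
  a degenerate circle.\<close>

definition perp :: "'a::real_inner \<Rightarrow> 'a \<Rightarrow> 'a" where
  "perp x y = sgn (y - (x \<bullet> y) *\<^sub>R x)"

lemma norm_circ:
  fixes u v :: "'a::real_inner"
  assumes "norm u = 1" "norm v = 1" "u \<bullet> v = 0"
  shows "norm (circ u v \<theta>) = 1"
proof -
  have "(norm (circ u v \<theta>))\<^sup>2 = (cos \<theta>)\<^sup>2 + (sin \<theta>)\<^sup>2"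
    unfolding power2_norm_eq_inner circ_def using assms
    by (simp add: inner_add_left inner_add_right norm_eq_1 inner_commute power2_eq_square)
  hence "(norm (circ u v \<theta>))\<^sup>2 = 1\<^sup>2" by simp
  thus ?thesis by (metis abs_norm_cancel abs_one power2_eq_iff_nonneg norm_ge_zero zero_le_one)
qed

lemma perp_orthonormal:
  fixes x y :: "'a::real_inner"
  assumes "norm x = 1" "perp x y \<noteq> 0"
  shows "norm (perp x y) = 1" "x \<bullet> perp x y = 0"
  using assms by (auto simp: perp_def norm_sgn sgn_zero_iff sgn_div_norm inner_diff_right norm_eq_1)

text \<open>The angle is the arc cosine of the inner product, whose sine is the length of the part
  of \<open>y\<close> orthogonal to \<open>x\<close>. At \<open>x\<close> and \<open>-x\<close> both
  vanish, so the degenerate case is included.\<close>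

lemma circ_through:
  fixes x y :: "'a::real_inner"
  assumes x: "norm x = 1" and y: "norm y = 1"
  obtains \<alpha> where "0 \<le> \<alpha>" "\<alpha> \<le> pi" "circ x (perp x y) \<alpha> = y"
proof
  define c where "c = x \<bullet> y"
  have c: "\<bar>c\<bar> \<le> 1" using Cauchy_Schwarz_ineq2[of x y] by (simp add: c_def x y)
  show "0 \<le> arccos c" "arccos c \<le> pi" using c by (auto intro: arccos_lbound arccos_ubound)
  have "(norm (y - c *\<^sub>R x))\<^sup>2 = 1 - c\<^sup>2"
    unfolding power2_norm_eq_inner using x y
    by (simp add: inner_diff_left inner_diff_right norm_eq_1 inner_commute c_def power2_eq_square)
  hence n: "norm (y - c *\<^sub>R x) = sqrt (1 - c\<^sup>2)" by (metis norm_ge_zero real_sqrt_unique)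
  have "sin (arccos c) = norm (y - c *\<^sub>R x)" using c n by (simp add: sin_arccos_abs)
  hence "sin (arccos c) *\<^sub>R perp x y = norm (y - c *\<^sub>R x) *\<^sub>R sgn (y - c *\<^sub>R x)"
    unfolding perp_def c_def[symmetric] by simp
  also have "\<dots> = y - c *\<^sub>R x" by (cases "y - c *\<^sub>R x = 0") (simp_all add: sgn_div_norm)
  finally show "circ x (perp x y) (arccos c) = y"
    using c by (simp add: circ_def cos_arccos_abs)
qed

lemma perp_eq_0:
  fixes x y :: "'a::real_inner"
  assumes x: "norm x = 1" and y: "norm y = 1" and "perp x y = 0"
  shows "y \<in> {x, -x}"
proof -
  have e: "y = (x \<bullet> y) *\<^sub>R x" using assms(3) by (simp add: perp_def sgn_zero_iff)
  hence "\<bar>x \<bullet> y\<bar> = 1" using x y by (metis mult.right_neutral norm_scaleR)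
  hence "x \<bullet> y = 1 \<or> x \<bullet> y = -1" by linarith
  thus ?thesis using e by (metis insertCI scaleR_minus1_left scaleR_one)
qed

text \<open>From 0 to \<open>2 * pi\<close> the cosine falls to its minimum at \<open>pi\<close> and
  then rises, so on a subinterval it is largest at an end point.\<close>

lemma cos_le_max:
  assumes "0 \<le> a" "a \<le> t" "t \<le> b" "b \<le> 2 * pi"
  shows "cos t \<le> max (cos a) (cos b)"
proof (cases "t \<le> pi")
  case True
  hence "cos t \<le> cos a" using assms by (intro cos_monotone_0_pi_le) auto
  thus ?thesis by simp
next
  case False
  have "cos (2 * pi - t) \<le> cos (2 * pi - b)" using assms False by (intro cos_monotone_0_pi_le) auto
  thus ?thesis by (simp add: cos_diff)
qed

text \<open>The arc that avoids the minimum of the sinusoid stays above the minimum of its end points.\<close>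

lemma sinusoid_arc:
  assumes "0 \<le> \<alpha>" "\<alpha> \<le> 2 * pi"
  shows "(\<forall>\<theta>\<in>{0..\<alpha>}. min (a * cos 0 + b * sin 0) (a * cos \<alpha> + b * sin \<alpha>) \<le> a * cos \<theta> + b * sin \<theta>) \<or>
         (\<forall>\<theta>\<in>{\<alpha>..2*pi}. min (a * cos 0 + b * sin 0) (a * cos \<alpha> + b * sin \<alpha>) \<le> a * cos \<theta> + b * sin \<theta>)"
proof -
  let ?f = "\<lambda>\<theta>. a * cos \<theta> + b * sin \<theta>"
  define r where "r = sqrt (a\<^sup>2 + b\<^sup>2)"
  show ?thesis
  proof (cases "r = 0")
    case True
    hence "a = 0" "b = 0" by (auto simp: r_def sum_power2_eq_zero_iff)
    thus ?thesis by simp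
  next
    case False
    moreover have "r \<ge> 0" by (simp add: r_def)
    ultimately have r: "r > 0" by linarith
    have "(- a / r)\<^sup>2 + (- b / r)\<^sup>2 = (a\<^sup>2 + b\<^sup>2) / r\<^sup>2" by (simp add: power_divide add_divide_distrib)
    also have "\<dots> = 1"
    proof -
      have "r\<^sup>2 = a\<^sup>2 + b\<^sup>2" by (simp add: r_def)
      thus ?thesis using r by (metis divide_self less_irrefl power_not_zero)
    qed
    \<comment> \<open>The minus signs make \<open>\<phi>\<close> the angle of the minimum: the
      sinusoid is \<open>- r * cos (\<phi> - \<theta>)\<close>, and the arc to choose is the one
      without \<open>\<phi>\<close> in its interior.\<close>
    finally obtain \<phi> where \<phi>: "0 \<le> \<phi>" "\<phi> < 2 * pi" "- a / r = cos \<phi>" "- b / r = sin \<phi>"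
      using sincos_total_2pi by metis
    have ab: "a = - r * cos \<phi>" "b = - r * sin \<phi>" using \<phi>(3,4) r by (auto simp: field_simps)
    have f: "a * cos \<theta> + b * sin \<theta> = - r * cos (\<phi> - \<theta>)" for \<theta>
      unfolding ab by (simp add: cos_diff algebra_simps)
    have key: "min (- r * cos s) (- r * cos t) \<le> - r * cos c" if "cos c \<le> max (cos s) (cos t)" for c s t
      using that r by (auto simp: min_def max_def not_le intro: mult_left_mono split: if_splits)
    show ?thesis
    proof (cases "\<alpha> \<le> \<phi>")
      case True
      have "min (?f 0) (?f \<alpha>) \<le> ?f \<theta>"
        if "\<theta> \<in> {0..\<alpha>}" for \<theta>
      proof -
        have "cos (\<phi> - \<theta>) \<le> max (cos (\<phi> - \<alpha>)) (cos (\<phi> - 0))"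
          using that True \<phi> by (intro cos_le_max) auto
        hence "cos (\<phi> - \<theta>) \<le> max (cos (\<phi> - 0)) (cos (\<phi> - \<alpha>))" by (simp add: max.commute)
        thus ?thesis unfolding f by (rule key)
      qed
      thus ?thesis by blast
    next
      case False
      have "min (?f 0) (?f \<alpha>) \<le> ?f \<theta>"
        if "\<theta> \<in> {\<alpha>..2*pi}" for \<theta>
      proof -
        have "cos (\<theta> - \<phi>) \<le> max (cos (\<alpha> - \<phi>)) (cos (2 * pi - \<phi>))"
          using that False \<phi> by (intro cos_le_max) auto
        also have "max (cos (\<alpha> - \<phi>)) (cos (2 * pi - \<phi>)) = max (cos (\<phi> - 0)) (cos (\<phi> - \<alpha>))"
          by (simp add: cos_diff max.commute mult.commute)
        also have "cos (\<theta> - \<phi>) = cos (\<phi> - \<theta>)" by (simp add: cos_diff mult.commute)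
        finally show ?thesis unfolding f by (rule key)
      qed
      thus ?thesis by blast
    qed
  qed
qed

text \<open>
  Motion of \<open>x\<close> by the angle \<open>\<theta>\<close> on the great circle through \<open>x\<close> and \<open>y\<close>. In the degenerate case \<open>y = \<plusminus>x\<close>, a null
  event, the value \<open>x\<close> keeps \<open>great\<close> on the sphere and equivariant under orthogonal maps.
\<close>

definition great :: "real \<Rightarrow> 'a::real_inner \<Rightarrow> 'a \<Rightarrow> 'a" where
  "great \<theta> x y = (if perp x y = 0 then x else circ x (perp x y) \<theta>)"

lemma norm_great: "norm x = 1 \<Longrightarrow> norm (great \<theta> x y) = 1"
  using perp_orthonormal[of x y] by (simp add: great_def norm_circ)

lemma great_orthogonal:
  assumes Q: "orthogonal_transformation Q"
  shows "great \<theta> (Q x) (Q y) = Q (great \<theta> x y)"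
proof -
  have lin: "linear Q" using Q by (simp add: orthogonal_transformation_linear)
  have i: "Q a \<bullet> Q b = a \<bullet> b" for a b using Q by (simp add: orthogonal_transformation_def)
  have "Q y - (x \<bullet> y) *\<^sub>R Q x = Q (y - (x \<bullet> y) *\<^sub>R x)"
    by (simp add: linear_diff[OF lin] linear_scale[OF lin])
  hence p: "perp (Q x) (Q y) = Q (perp x y)"
    by (simp add: perp_def i sgn_div_norm orthogonal_transformation_norm[OF Q] linear_scale[OF lin])
  have "Q (perp x y) = 0 \<longleftrightarrow> perp x y = 0"
    using orthogonal_transformation_norm[OF Q, of "perp x y"] by (metis norm_eq_zero)
  thus ?thesis by (simp add: great_def p circ_def linear_add[OF lin] linear_scale[OF lin])
qed

lemma measurable_great [measurable]:
  assumes [measurable]: "f \<in> borel_measurable M" "g \<in> measurable M surf" "h \<in> measurable M surf"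
  shows "(\<lambda>z. great (f z) (g z) (h z)) \<in> measurable M (surf :: (real ^ 'n) measure)"
proof (rule measurable_into_surface_measure)
  have [measurable]: "g \<in> borel_measurable M" "h \<in> borel_measurable M"
    using measurable_compose[OF assms(2) borel_measurable_surface_id]
      measurable_compose[OF assms(3) borel_measurable_surface_id] by auto
  show "(\<lambda>z. great (f z) (g z) (h z)) \<in> borel_measurable M"
    unfolding great_def perp_def circ_def by measurable
  fix z assume "z \<in> space M"
  hence "g z \<in> space surf" using assms(2) by (rule measurable_space[rotated])
  thus "norm (great (f z) (g z) (h z)) = 1" by (intro norm_great) simp
qed

lemma mass_pos: "mass TYPE('n::finite) > 0"
  using emeasure_surface_open_pos[of "axis undefined 1 :: real^'n" UNIV] by simp

text \<open>By equivariance of \<open>great\<close> the image of the product measure is invariant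
  under orthogonal maps, and uniqueness identifies it up to its total mass. No density of the image
  has to be computed.\<close>

lemma nn_integral_great:
  fixes \<Phi> :: "real ^ 'n::finite \<Rightarrow> ennreal"
  assumes \<Phi>: "\<Phi> \<in> borel_measurable surf"
  shows "(\<integral>\<^sup>+x. \<integral>\<^sup>+y. \<Phi> (great \<theta> x y) \<partial>surf \<partial>surf) = mass TYPE('n) * (\<integral>\<^sup>+x. \<Phi> x \<partial>surf)"
proof -
  define s where "s = mass TYPE('n)"
  have s: "s > 0" "s \<noteq> \<top>" using mass_pos[where 'n='n] by (auto simp: s_def)
  let ?P = "(surf \<Otimes>\<^sub>M surf) :: ((real^'n) \<times> (real^'n)) measure"
  interpret P: pair_sigma_finite "surf :: (real^'n) measure" "surf :: (real^'n) measure" ..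
  define w where "w = (\<lambda>z :: (real^'n) \<times> (real^'n). great \<theta> (fst z) (snd z))"
  have w [measurable]: "w \<in> measurable ?P surf" unfolding w_def by measurable
  define \<mu>' where "\<mu>' = distr ?P surf w"
  \<comment> \<open>The product has total mass \<open>s * s\<close>, and uniqueness compares
    measures of equal mass; hence the factor \<open>1 / s\<close>.\<close>
  define \<mu> where "\<mu> = scale_measure (1 / s) \<mu>'"
  have inv': "distr \<mu>' surf Q = \<mu>'" if Q: "orthogonal_transformation Q" for Q
  proof -
    have Qm [measurable]: "Q \<in> measurable surf surf" by (rule measurable_orthogonal_surface[OF Q])
    have "distr \<mu>' surf Q = distr ?P surf (Q \<circ> w)" unfolding \<mu>'_def by (rule distr_distr[OF Qm w])
    also have "Q \<circ> w = w \<circ> (\<lambda>(x, y). (Q x, Q y))" by (auto simp: w_def great_orthogonal[OF Q])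
    also have "distr ?P surf (w \<circ> (\<lambda>(x, y). (Q x, Q y))) = distr (distr ?P ?P (\<lambda>(x, y). (Q x, Q y))) surf w"
      by (rule distr_distr[OF w, symmetric]) measurable
    also have "distr ?P ?P (\<lambda>(x, y). (Q x, Q y)) = distr surf surf Q \<Otimes>\<^sub>M distr surf surf Q"
      by (rule pair_measure_distr[symmetric])
         (simp_all add: distr_surface_orthogonal[OF Q] surf.sigma_finite_measure_axioms)
    finally show ?thesis by (simp add: distr_surface_orthogonal[OF Q] \<mu>'_def)
  qed
  have "\<mu> = surf"
  proof (rule invariant_eq_surface_measure)
    show sets: "sets \<mu> = sets surf" by (simp add: \<mu>_def \<mu>'_def)
    have sp: "sphere 0 1 \<in> sets (surf :: (real^'n) measure)"
      using sets.top[of "surf :: (real^'n) measure"] by simp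
    have "emeasure \<mu>' (sphere 0 1) = emeasure ?P (space ?P)"
      unfolding \<mu>'_def using measurable_space[OF w]
      by (subst emeasure_distr[OF w sp]) (auto intro!: arg_cong2[where f=emeasure])
    also have "\<dots> = s * s"
      by (simp add: space_pair_measure surf.emeasure_pair_measure_Times sp s_def)
    finally have "emeasure \<mu>' (sphere 0 1) = s * s" .
    hence "emeasure \<mu> (sphere 0 1) = 1 / s * (s * s)" by (simp add: \<mu>_def)
    also have "\<dots> = s * s / s" by (simp add: ennreal_times_divide mult.commute)
    also have "\<dots> = s" using s by (subst ennreal_mult_divide_eq) auto
    finally show "emeasure \<mu> (sphere 0 1) = mass TYPE('n)" by (simp add: s_def)
    fix Q :: "real^'n \<Rightarrow> real^'n" assume Q: "orthogonal_transformation Q"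
    have Qm: "Q \<in> measurable surf surf" by (rule measurable_orthogonal_surface[OF Q])
    show "distr \<mu> \<mu> Q = \<mu>"
    proof (rule measure_eqI)
      fix A assume "A \<in> sets (distr \<mu> \<mu> Q)"
      hence A: "A \<in> sets surf" by (simp add: sets)
      have sp: "space \<mu> = space \<mu>'" by (simp add: \<mu>_def space_scale_measure)
      have "emeasure (distr \<mu> \<mu> Q) A = emeasure \<mu> (Q -` A \<inter> space \<mu>)"
        using A Qm by (intro emeasure_distr) (simp_all add: sets measurable_cong_sets[OF sets sets])
      also have "\<dots> = 1 / s * emeasure \<mu>' (Q -` A \<inter> space \<mu>')" unfolding sp by (simp add: \<mu>_def)
      also have "emeasure \<mu>' (Q -` A \<inter> space \<mu>') = emeasure (distr \<mu>' surf Q) A"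
        using Qm A by (intro emeasure_distr[symmetric]) (simp_all add: \<mu>'_def)
      also have "1 / s * \<dots> = emeasure \<mu> A" by (simp add: inv'[OF Q] \<mu>_def)
      finally show "emeasure (distr \<mu> \<mu> Q) A = emeasure \<mu> A" .
    qed simp
  qed
  hence "s * (\<integral>\<^sup>+x. \<Phi> x \<partial>surf) = s * (\<integral>\<^sup>+x. \<Phi> x \<partial>\<mu>)" by simp
  also have "\<dots> = s * (1 / s * (\<integral>\<^sup>+x. \<Phi> x \<partial>\<mu>'))"
    unfolding \<mu>_def by (subst nn_integral_scale_measure) (use \<Phi> in \<open>simp_all add: \<mu>'_def\<close>)
  also have "\<dots> = (s / s) * (\<integral>\<^sup>+x. \<Phi> x \<partial>\<mu>')"
    by (simp add: mult.assoc[symmetric] ennreal_times_divide)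
  also have "s / s = 1" using s by (intro ennreal_divide_self) (auto simp: less_top)
  also have "1 * (\<integral>\<^sup>+x. \<Phi> x \<partial>\<mu>') = (\<integral>\<^sup>+z. \<Phi> (w z) \<partial>?P)"
    unfolding \<mu>'_def using \<Phi> by (simp add: nn_integral_distr[OF w])
  also have "\<dots> = (\<integral>\<^sup>+x. \<integral>\<^sup>+y. \<Phi> (w (x, y)) \<partial>surf \<partial>surf)"
    by (rule surf.nn_integral_fst[symmetric]) (rule measurable_compose[OF w \<Phi>])
  finally show ?thesis by (simp add: s_def w_def)
qed

text \<open>The product of the two weights is at most \<open>M\<close> times the smaller one,
  \<open>w l\<close>, and on the chosen arc \<open>w l\<close> is a lower bound for the density.
  Thus one weight is lost to its supremum and the other moves under the integral.\<close>

lemma arc_bound: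
  fixes x y p :: "'a::euclidean_space" and \<Phi> :: "'a \<Rightarrow> ennreal"
  assumes x: "norm x = 1" and y: "norm y = 1" and xy: "perp x y \<noteq> 0"
    and mono: "mono w" and w: "\<And>t. 0 \<le> w t" "\<And>t. \<bar>t\<bar> \<le> 1 \<Longrightarrow> w t \<le> M" and p: "norm p = 1"
    and m: "(\<lambda>\<theta>. \<Phi> (circ x (perp x y) \<theta>)) \<in> borel_measurable borel"
    and arc: "\<And>a b. 0 \<le> a \<Longrightarrow> a \<le> b \<Longrightarrow> b \<le> 2 * pi \<Longrightarrow>
       ennreal ((g (circ x (perp x y) b) - g (circ x (perp x y) a))\<^sup>2)
       \<le> ennreal (2 * pi) * (\<integral>\<^sup>+\<theta>. indicator {a..b} \<theta> * \<Phi> (circ x (perp x y) \<theta>) \<partial>lborel)"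
  shows "ennreal ((g x - g y)\<^sup>2 * (w (x \<bullet> p) * w (y \<bullet> p)))
    \<le> ennreal (2 * pi * M) * (\<integral>\<^sup>+\<theta>. indicator {0..2*pi} \<theta> * (\<Phi> (great \<theta> x y) * ennreal (w (great \<theta> x y \<bullet> p))) \<partial>lborel)"
proof -
  let ?g = "\<lambda>\<theta>. \<Phi> (great \<theta> x y) * ennreal (w (great \<theta> x y \<bullet> p))"
  define v where "v = perp x y"
  have gr: "great \<theta> x y = circ x v \<theta>" for \<theta> using xy by (simp add: great_def v_def)
  obtain \<alpha> where \<alpha>: "0 \<le> \<alpha>" "\<alpha> \<le> pi" "circ x v \<alpha> = y" using circ_through[OF x y] by (auto simp: v_def)
  have c0: "circ x v 0 = x" "circ x v (2 * pi) = x" by (auto simp: circ_def)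
  define l where "l = min (x \<bullet> p) (y \<bullet> p)"
  have M: "0 \<le> M" using w(1)[of 0] w(2)[of 0] by simp
  have cp: "circ x v \<theta> \<bullet> p = (x \<bullet> p) * cos \<theta> + (v \<bullet> p) * sin \<theta>" for \<theta>
    by (simp add: circ_def inner_add_left mult.commute)
  have ya: "y \<bullet> p = (x \<bullet> p) * cos \<alpha> + (v \<bullet> p) * sin \<alpha>" using cp[of \<alpha>] \<alpha>(3) by simp
  have "(\<forall>\<theta>\<in>{0..\<alpha>}. l \<le> circ x v \<theta> \<bullet> p) \<or> (\<forall>\<theta>\<in>{\<alpha>..2*pi}. l \<le> circ x v \<theta> \<bullet> p)"
    using sinusoid_arc[of \<alpha> "x \<bullet> p" "v \<bullet> p"] \<alpha> pi_ge_zero unfolding cp l_def ya by simp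
  then obtain a b where ab: "0 \<le> a" "a \<le> b" "b \<le> 2 * pi" "\<And>\<theta>. \<theta> \<in> {a..b} \<Longrightarrow> l \<le> circ x v \<theta> \<bullet> p"
    and ends: "(circ x v a = x \<and> circ x v b = y) \<or> (circ x v a = y \<and> circ x v b = x)"
  proof (elim disjE)
    assume "\<forall>\<theta>\<in>{0..\<alpha>}. l \<le> circ x v \<theta> \<bullet> p"
    thus ?thesis using that[of 0 \<alpha>] \<alpha> c0 pi_ge_zero by auto
  next
    assume "\<forall>\<theta>\<in>{\<alpha>..2*pi}. l \<le> circ x v \<theta> \<bullet> p"
    thus ?thesis using that[of \<alpha> "2*pi"] \<alpha> c0 pi_ge_zero by auto
  qed
  let ?P = "\<integral>\<^sup>+\<theta>. indicator {a..b} \<theta> * \<Phi> (circ x v \<theta>) \<partial>lborel"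
  have cs: "\<bar>z \<bullet> p\<bar> \<le> 1" if "norm z = 1" for z using Cauchy_Schwarz_ineq2[of z p] that p by simp
  have "w (x \<bullet> p) * w (y \<bullet> p) \<le> M * w l"
  proof (cases "x \<bullet> p \<le> y \<bullet> p")
    case True
    hence "l = x \<bullet> p" by (simp add: l_def)
    thus ?thesis using mult_right_mono[OF w(2)[OF cs[OF y]] w(1)[of l]] by (simp add: mult.commute)
  next
    case False
    hence "l = y \<bullet> p" by (simp add: l_def)
    thus ?thesis using mult_right_mono[OF w(2)[OF cs[OF x]] w(1)[of l]] by simp
  qed
  hence "(g x - g y)\<^sup>2 * (w (x \<bullet> p) * w (y \<bullet> p)) \<le> (g x - g y)\<^sup>2 * (M * w l)"
    by (rule mult_left_mono) simp
  hence "ennreal ((g x - g y)\<^sup>2 * (w (x \<bullet> p) * w (y \<bullet> p))) \<le> ennreal ((g x - g y)\<^sup>2 * (M * w l))"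
    by (rule ennreal_leI)
  also have "\<dots> = ennreal ((g x - g y)\<^sup>2) * (ennreal M * ennreal (w l))"
    using M w by (simp add: ennreal_mult)
  also have "\<dots> \<le>
     (ennreal (2 * pi) * ?P) * (ennreal M * ennreal (w l))"
  proof (rule mult_right_mono)
    have "(g x - g y)\<^sup>2 = (g (circ x v b) - g (circ x v a))\<^sup>2" using ends by (auto simp: power2_commute)
    thus "ennreal ((g x - g y)\<^sup>2) \<le> ennreal (2 * pi) * ?P"
      using arc[OF ab(1-3)] unfolding v_def[symmetric] by simp
  qed simp
  also have "\<dots> = ennreal (2 * pi * M) * (?P * ennreal (w l))"
    using M by (simp add: ennreal_mult mult_ac)
  also have "?P * ennreal (w l) =
     (\<integral>\<^sup>+\<theta>. indicator {a..b} \<theta> * \<Phi> (circ x v \<theta>) * ennreal (w l) \<partial>lborel)"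
    using m unfolding v_def[symmetric] by (intro nn_integral_multc[symmetric]) simp
  \<comment> \<open>Enlarging the arc to the full circle makes the range of angles independent of
    \<open>x\<close> and \<open>y\<close>, as required for exchanging the integrals.\<close>
  also have "\<dots> \<le> (\<integral>\<^sup>+\<theta>. indicator {0..2*pi} \<theta> * ?g \<theta> \<partial>lborel)"
  proof (rule nn_integral_mono)
    fix \<theta>
    show "indicator {a..b} \<theta> * \<Phi> (circ x v \<theta>) * ennreal (w l) \<le>
      indicator {0..2*pi} \<theta> * ?g \<theta>"
    proof (cases "\<theta> \<in> {a..b}")
      case True
      have "w l \<le> w (circ x v \<theta> \<bullet> p)" using ab(4)[OF True] mono by (simp add: monoD)
      thus ?thesis using True ab by (auto simp: gr intro!: mult_left_mono ennreal_leI)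
    qed simp
  qed
  finally show ?thesis by (simp add: mult_left_mono)
qed

text \<open>Fubini puts the angle outside, and for each fixed angle the moved point is uniform, so
  the double integral collapses to a single one. Cauchy-Schwarz on an arc gives one factor
  \<open>2 * pi\<close>, the integration over the angle the other.\<close>

lemma nn_integral_great_circle_bound:
  fixes p :: "real ^ 'n::finite" and \<Phi> :: "real ^ 'n \<Rightarrow> ennreal"
  assumes N: "CARD('n) \<ge> 2" and p: "norm p = 1"
    and mono: "mono w" and w: "\<And>t. 0 \<le> w t" "\<And>t. \<bar>t\<bar> \<le> 1 \<Longrightarrow> w t \<le> M"
    and [measurable]: "\<Phi> \<in> borel_measurable surf"
    and arc: "\<And>u v a b. norm u = 1 \<Longrightarrow> norm v = 1 \<Longrightarrow> u \<bullet> v = 0 \<Longrightarrow> 0 \<le> a \<Longrightarrow> a \<le> b \<Longrightarrow> b \<le> 2 * pi \<Longrightarrow>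
       ennreal ((g (circ u v b) - g (circ u v a))\<^sup>2)
       \<le> ennreal (2 * pi) * (\<integral>\<^sup>+\<theta>. indicator {a..b} \<theta> * \<Phi> (circ u v \<theta>) \<partial>lborel)"
  shows "(\<integral>\<^sup>+x. \<integral>\<^sup>+y. ennreal ((g x - g y)\<^sup>2 * (w (x \<bullet> p) * w (y \<bullet> p))) \<partial>surf \<partial>surf)
    \<le> ennreal (4 * pi\<^sup>2 * M) * mass TYPE('n) * (\<integral>\<^sup>+x. \<Phi> x * ennreal (w (x \<bullet> p)) \<partial>surf)"
proof -
  have M: "0 \<le> M" using w(1)[of 0] w(2)[of 0] by simp
  have [measurable]: "w \<in> borel_measurable borel" using mono by (rule borel_measurable_mono)
  define \<Psi> where "\<Psi> x = \<Phi> x * ennreal (w (x \<bullet> p))" for x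
  have \<Psi>m [measurable]: "\<Psi> \<in> borel_measurable surf" unfolding \<Psi>_def by measurable
  interpret P: pair_sigma_finite "surf :: (real^'n) measure" "lborel :: real measure" ..
  let ?F = "\<lambda>x y \<theta>. indicator {0..2*pi} \<theta> * \<Psi> (great \<theta> x y)" and ?G = "\<lambda>x y. ennreal ((g x - g y)\<^sup>2 * (w (x \<bullet> p) * w (y \<bullet> p)))"
  let ?N = "\<integral>\<^sup>+x. \<Psi> x \<partial>surf" and ?I = "\<lambda>x y. \<integral>\<^sup>+\<theta>. ?F x y \<theta> \<partial>lborel"
  let ?T = "\<integral>\<^sup>+x. \<integral>\<^sup>+y. ?I x y \<partial>surf \<partial>surf"
  have "(\<integral>\<^sup>+x. \<integral>\<^sup>+y. ?G x y \<partial>surf \<partial>surf) \<le>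
     (\<integral>\<^sup>+x. \<integral>\<^sup>+y. ennreal (2 * pi * M) * ?I x y \<partial>surf \<partial>surf)"
  proof (rule nn_integral_mono)
    fix x :: "real^'n" assume "x \<in> space surf"
    hence x: "norm x = 1" by simp
    have null: "AE y in surf. y \<notin> {x, -x}"
      by (rule AE_not_in) (use emeasure_surface_pair[OF N x] x in \<open>auto simp: null_sets_def sets_surface_measure_iff\<close>)
    show "(\<integral>\<^sup>+y. ?G x y \<partial>surf) \<le>
       (\<integral>\<^sup>+y. ennreal (2 * pi * M) * ?I x y \<partial>surf)"
    proof (rule nn_integral_mono_AE)
      have "?G x y \<le> ennreal (2 * pi * M) * ?I x y"
        if ys: "y \<in> space surf" and yn: "y \<notin> {x, - x}" for y
      proof -
        have y: "norm y = 1" using ys by simp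
        have xy: "perp x y \<noteq> 0" using perp_eq_0[OF x y] yn by blast
        note on = perp_orthonormal[OF x xy]
        have "(\<lambda>\<theta>. circ x (perp x y) \<theta>) \<in> measurable borel surf"
          by (rule measurable_into_surface_measure, unfold circ_def[abs_def], measurable)
            (simp add: circ_def[symmetric] norm_circ x on)
        hence m: "(\<lambda>\<theta>. \<Phi> (circ x (perp x y) \<theta>)) \<in> borel_measurable borel" by measurable
        show ?thesis unfolding \<Psi>_def
          by (rule arc_bound[OF x y xy mono w p m]) (use arc[OF x on] in auto)
      qed
      note bound = this
      show "AE y in surf. ?G x y \<le>
          ennreal (2 * pi * M) * ?I x y"
        using AE_space null by eventually_elim (rule bound)
    qed
  qed
  also have "\<dots> = ennreal (2 * pi * M) * ?T"
  proof -
    have "(\<integral>\<^sup>+x. \<integral>\<^sup>+y. ennreal (2 * pi * M) * ?I x y \<partial>surf \<partial>surf) =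
       (\<integral>\<^sup>+x. ennreal (2 * pi * M) * (\<integral>\<^sup>+y. \<integral>\<^sup>+\<theta>. ?F x y \<theta> \<partial>lborel \<partial>surf) \<partial>surf)"
      by (rule nn_integral_cong, rule nn_integral_cmult) measurable
    also have "\<dots> = ennreal (2 * pi * M) * ?T"
      by (rule nn_integral_cmult) measurable
    finally show ?thesis .
  qed
  also have "?T =
     (\<integral>\<^sup>+x. \<integral>\<^sup>+\<theta>. \<integral>\<^sup>+y. ?F x y \<theta> \<partial>surf \<partial>lborel \<partial>surf)"
    by (rule nn_integral_cong, rule P.Fubini'[symmetric]) measurable
  also have "\<dots> = (\<integral>\<^sup>+\<theta>. \<integral>\<^sup>+x. \<integral>\<^sup>+y. ?F x y \<theta> \<partial>surf \<partial>surf \<partial>lborel)"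
    by (rule P.Fubini'[symmetric]) measurable
  also have "\<dots> = (\<integral>\<^sup>+\<theta>. indicator {0..2*pi} \<theta> * (mass TYPE('n) * ?N) \<partial>lborel)"
  proof (rule nn_integral_cong)
    fix \<theta> :: real
    have "(\<integral>\<^sup>+x. \<integral>\<^sup>+y. ?F x y \<theta> \<partial>surf \<partial>surf) =
       indicator {0..2*pi} \<theta> * (\<integral>\<^sup>+x. \<integral>\<^sup>+y. \<Psi> (great \<theta> x y) \<partial>surf \<partial>surf)"
      by (cases "\<theta> \<in> {0..2*pi}") auto
    thus "(\<integral>\<^sup>+x. \<integral>\<^sup>+y. ?F x y \<theta> \<partial>surf \<partial>surf) =
        indicator {0..2*pi} \<theta> * (mass TYPE('n) * ?N)"
      by (simp add: nn_integral_great[OF \<Psi>m])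
  qed
  also have "\<dots> = ennreal (2 * pi) * (mass TYPE('n) * ?N)"
    by (simp add: nn_integral_multc)
  also have "ennreal (2 * pi * M) * \<dots> = ennreal (4 * pi\<^sup>2 * M) * mass TYPE('n) * ?N"
    using M by (simp add: ennreal_mult[symmetric] mult.assoc[symmetric] power2_eq_square) (simp add: mult_ac)
  finally show ?thesis by (simp add: \<Psi>_def)
qed

section \<open>Variance identities and the one spin inequality\<close>

lemma (in prob_space) integrable_bounded:
  fixes X :: "'a \<Rightarrow> real"
  assumes X: "X \<in> borel_measurable M" and B: "\<And>x. x \<in> space M \<Longrightarrow> \<bar>X x\<bar> \<le> B"
  shows "integrable M X" "integrable M (\<lambda>x. (X x - c)\<^sup>2)"
proof -
  show i: "integrable M X" by (rule integrable_const_bound[of _ B]) (use X B in auto)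
  have "(X x)\<^sup>2 \<le> B\<^sup>2" if "x \<in> space M" for x using B[OF that] by (metis abs_ge_zero power2_abs power_mono)
  hence "integrable M (\<lambda>x. (X x)\<^sup>2)" by (intro integrable_const_bound[of _ "B\<^sup>2"]) (use X in auto)
  thus "integrable M (\<lambda>x. (X x - c)\<^sup>2)" using i by (simp add: power2_diff)
qed

text \<open>Besides the double integral formula this yields the decomposition along the chain, and
  the fact that replacing any centre \<open>c\<close> by the mean does not increase the left
  side.\<close>

lemma (in prob_space) nn_variance_shift:
  fixes X :: "'a \<Rightarrow> real"
  assumes X: "X \<in> borel_measurable M" and B: "\<And>x. x \<in> space M \<Longrightarrow> \<bar>X x\<bar> \<le> B"
  shows "(\<integral>\<^sup>+x. ennreal ((X x - c)\<^sup>2) \<partial>M) = (\<integral>\<^sup>+x. ennreal ((X x - expectation X)\<^sup>2) \<partial>M) + ennreal ((expectation X - c)\<^sup>2)"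
proof -
  note i1 = integrable_bounded(1)[OF X B] and iv = integrable_bounded(2)[OF X B]
  have i2: "integrable M (\<lambda>x. (X x)\<^sup>2)" using iv[of 0] by simp
  have eq: "(\<integral>x. (X x - c)\<^sup>2 \<partial>M) = expectation (\<lambda>x. (X x)\<^sup>2) - 2 * c * expectation X + c\<^sup>2" for c
    using i1 i2 by (simp add: power2_diff prob_space)
  have nn: "(\<integral>\<^sup>+x. ennreal ((X x - c)\<^sup>2) \<partial>M) = ennreal (\<integral>x. (X x - c)\<^sup>2 \<partial>M)" for c
    by (intro nn_integral_eq_integral iv AE_I2 zero_le_power2)
  have "(\<integral>x. (X x - c)\<^sup>2 \<partial>M) = (\<integral>x. (X x - expectation X)\<^sup>2 \<partial>M) + (expectation X - c)\<^sup>2"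
    unfolding eq by (simp add: power2_eq_square algebra_simps)
  thus ?thesis unfolding nn by (simp add: ennreal_plus)
qed

lemma (in prob_space) nn_variance_double_integral:
  fixes g :: "'a \<Rightarrow> real"
  assumes g: "g \<in> borel_measurable M" and B: "\<And>x. x \<in> space M \<Longrightarrow> \<bar>g x\<bar> \<le> B"
  shows "(\<integral>\<^sup>+x. \<integral>\<^sup>+y. ennreal ((g x - g y)\<^sup>2) \<partial>M \<partial>M) = 2 * (\<integral>\<^sup>+x. ennreal ((g x - expectation g)\<^sup>2) \<partial>M)"
proof -
  note g [measurable]
  let ?V = "\<integral>\<^sup>+x. ennreal ((g x - expectation g)\<^sup>2) \<partial>M"
  have "(\<integral>\<^sup>+x. \<integral>\<^sup>+y. ennreal ((g x - g y)\<^sup>2) \<partial>M \<partial>M) = (\<integral>\<^sup>+x. ?V + ennreal ((g x - expectation g)\<^sup>2) \<partial>M)"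
  proof (rule nn_integral_cong)
    fix x
    have "(\<integral>\<^sup>+y. ennreal ((g x - g y)\<^sup>2) \<partial>M) = (\<integral>\<^sup>+y. ennreal ((g y - g x)\<^sup>2) \<partial>M)"
      by (intro nn_integral_cong arg_cong[where f = ennreal] power2_commute)
    also have "\<dots> = ?V + ennreal ((expectation g - g x)\<^sup>2)"
      by (rule nn_variance_shift[OF g B])
    finally show "(\<integral>\<^sup>+y. ennreal ((g x - g y)\<^sup>2) \<partial>M) = ?V + ennreal ((g x - expectation g)\<^sup>2)"
      by (simp only: power2_commute[of "expectation g"])
  qed
  also have "\<dots> = (\<integral>\<^sup>+x. ?V \<partial>M) + ?V" by (rule nn_integral_add) measurable
  also have "(\<integral>\<^sup>+x. ?V \<partial>M) = ?V" by (simp only: nn_integral_const emeasure_space_1 mult_1_right)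
  finally show ?thesis by (simp only: mult_2)
qed

text \<open>The gradient enters only as a function \<open>\<Phi>\<close> controlling increments
  along arcs. Differentiability of \<open>g\<close> is not assumed, because \<open>g\<close> will be
  a conditional expectation whose derivative is never formed. The constant is half of
  \<open>4 * pi\<^sup>2\<close> because the double integral is twice the variance.\<close>

lemma sphere_poincare:
  fixes p :: "real ^ 'n::finite" and \<Phi> :: "real ^ 'n \<Rightarrow> ennreal" and w :: "real \<Rightarrow> real"
  defines "\<kappa> \<equiv> density surf (\<lambda>x. ennreal (w (x \<bullet> p)))"
  assumes N: "CARD('n) \<ge> 2" and p: "norm p = 1"
    and mono: "mono w" and w: "\<And>t. 0 \<le> w t" "\<And>t. \<bar>t\<bar> \<le> 1 \<Longrightarrow> w t \<le> M"
    and prob: "prob_space \<kappa>"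
    and \<Phi> [measurable]: "\<Phi> \<in> borel_measurable surf"
    and g [measurable]: "g \<in> borel_measurable surf" and B: "\<And>x. norm x = 1 \<Longrightarrow> \<bar>g x\<bar> \<le> B"
    and arc: "\<And>u v a b. norm u = 1 \<Longrightarrow> norm v = 1 \<Longrightarrow> u \<bullet> v = 0 \<Longrightarrow> 0 \<le> a \<Longrightarrow> a \<le> b \<Longrightarrow> b \<le> 2 * pi \<Longrightarrow>
       ennreal ((g (circ u v b) - g (circ u v a))\<^sup>2)
       \<le> ennreal (2 * pi) * (\<integral>\<^sup>+\<theta>. indicator {a..b} \<theta> * \<Phi> (circ u v \<theta>) \<partial>lborel)"
  shows "(\<integral>\<^sup>+x. ennreal ((g x - (\<integral>y. g y \<partial>\<kappa>))\<^sup>2) \<partial>\<kappa>)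
    \<le> ennreal (2 * pi\<^sup>2 * M) * mass TYPE('n) * (\<integral>\<^sup>+x. \<Phi> x \<partial>\<kappa>)"
proof -
  interpret \<kappa>: prob_space \<kappa> by (rule prob)
  have M: "0 \<le> M" using w(1)[of 0] w(2)[of 0] by simp
  have [measurable]: "w \<in> borel_measurable borel" using mono by (rule borel_measurable_mono)
  have \<kappa>: "(\<integral>\<^sup>+x. h x \<partial>\<kappa>) = (\<integral>\<^sup>+x. ennreal (w (x \<bullet> p)) * h x \<partial>surf)" if "h \<in> borel_measurable surf" for h
    unfolding \<kappa>_def using that by (intro nn_integral_density) auto
  have [measurable_cong]: "sets \<kappa> = sets surf" by (simp add: \<kappa>_def)
  have "2 * (\<integral>\<^sup>+x. ennreal ((g x - (\<integral>y. g y \<partial>\<kappa>))\<^sup>2) \<partial>\<kappa>) = (\<integral>\<^sup>+x. \<integral>\<^sup>+y. ennreal ((g x - g y)\<^sup>2) \<partial>\<kappa> \<partial>\<kappa>)"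
    by (rule \<kappa>.nn_variance_double_integral[symmetric, of _ B]) (auto simp: \<kappa>_def B)
  also have "\<dots> = (\<integral>\<^sup>+x. \<integral>\<^sup>+y. ennreal ((g x - g y)\<^sup>2 * (w (x \<bullet> p) * w (y \<bullet> p))) \<partial>surf \<partial>surf)"
  proof -
    have "(\<integral>\<^sup>+x. \<integral>\<^sup>+y. ennreal ((g x - g y)\<^sup>2) \<partial>\<kappa> \<partial>\<kappa>) = (\<integral>\<^sup>+x. ennreal (w (x \<bullet> p)) * (\<integral>\<^sup>+y. ennreal (w (y \<bullet> p)) * ennreal ((g x - g y)\<^sup>2) \<partial>surf) \<partial>surf)"
      by (subst \<kappa>, measurable, subst \<kappa>) (auto intro!: nn_integral_cong)
    also have "\<dots> = (\<integral>\<^sup>+x. \<integral>\<^sup>+y. ennreal (w (x \<bullet> p)) * (ennreal (w (y \<bullet> p)) * ennreal ((g x - g y)\<^sup>2)) \<partial>surf \<partial>surf)"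
      by (intro nn_integral_cong nn_integral_cmult[symmetric]) measurable
    finally show ?thesis using w(1) by (simp add: ennreal_mult'[symmetric] mult_ac)
  qed
  also have "\<dots> \<le> ennreal (4 * pi\<^sup>2 * M) * mass TYPE('n) * (\<integral>\<^sup>+x. \<Phi> x * ennreal (w (x \<bullet> p)) \<partial>surf)"
    by (rule nn_integral_great_circle_bound[OF N p mono w \<Phi> arc])
  also have "(\<integral>\<^sup>+x. \<Phi> x * ennreal (w (x \<bullet> p)) \<partial>surf) = (\<integral>\<^sup>+x. \<Phi> x \<partial>\<kappa>)" by (simp add: \<kappa> mult.commute)
  also have "ennreal (4 * pi\<^sup>2 * M) * mass TYPE('n) * (\<integral>\<^sup>+x. \<Phi> x \<partial>\<kappa>) =
    2 * (ennreal (2 * pi\<^sup>2 * M) * mass TYPE('n) * (\<integral>\<^sup>+x. \<Phi> x \<partial>\<kappa>))"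
  proof -
    have "ennreal (4 * pi\<^sup>2 * M) = 2 * ennreal (2 * pi\<^sup>2 * M)"
      using M by (subst ennreal_numeral[symmetric], subst ennreal_mult[symmetric]) auto
    thus ?thesis by (simp add: mult.assoc)
  qed
  finally show ?thesis by (simp add: ennreal_mult_le_mult_iff)
qed

section \<open>Chains of spins\<close>

declare One_nat_def [simp del]

section \<open>Rotations of segments of the chain\<close>

text \<open>For orthonormal \<open>u\<close> and \<open>v\<close>, the rotation of their plane that
  fixes its orthogonal complement, written as the identity plus a correction. It extends the motion
  \<open>circ u v\<close> of \<open>u\<close> to all vectors, so that many spins can be turned
  rigidly.\<close>

definition plane_rot :: "'a::real_inner \<Rightarrow> 'a \<Rightarrow> real \<Rightarrow> 'a \<Rightarrow> 'a" where
  "plane_rot u v \<theta> y = y + ((cos \<theta> - 1) * (y \<bullet> u) - sin \<theta> * (y \<bullet> v)) *\<^sub>R u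
                         + (sin \<theta> * (y \<bullet> u) + (cos \<theta> - 1) * (y \<bullet> v)) *\<^sub>R v"

lemma orthogonal_plane_rot:
  fixes u v :: "'a::real_inner"
  assumes "norm u = 1" "norm v = 1" "u \<bullet> v = 0"
  shows "orthogonal_transformation (plane_rot u v \<theta>)"
  unfolding orthogonal_transformation
proof safe
  show "linear (plane_rot u v \<theta>)"
    by (rule linearI) (simp_all add: plane_rot_def inner_add_left algebra_simps)
  fix y
  define s c p q where "s = sin \<theta>" "c = cos \<theta>" "p = y \<bullet> u" "q = y \<bullet> v"
  have sc: "s\<^sup>2 + c\<^sup>2 = 1" by (simp add: s_c_p_q_def)
  define a b where "a = (c - 1) * p - s * q" and "b = s * p + (c - 1) * q"
  have r: "plane_rot u v \<theta> y = y + a *\<^sub>R u + b *\<^sub>R v" by (simp add: plane_rot_def s_c_p_q_def a_def b_def)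
  have "(norm (plane_rot u v \<theta> y))\<^sup>2 = (norm y)\<^sup>2 + (2 * a * p + 2 * b * q + a\<^sup>2 + b\<^sup>2)"
    unfolding power2_norm_eq_inner r using assms
    by (simp add: inner_add_left inner_add_right norm_eq_1 inner_commute power2_eq_square s_c_p_q_def algebra_simps)
  also have "2 * a * p + 2 * b * q + a\<^sup>2 + b\<^sup>2 = (p\<^sup>2 + q\<^sup>2) * (s\<^sup>2 + c\<^sup>2 - 1)"
    unfolding a_def b_def by (simp add: power2_eq_square algebra_simps)
  finally show "norm (plane_rot u v \<theta> y) = norm y" by (simp add: sc)
qed

lemma plane_rot_axis:
  fixes u v :: "'a::real_inner"
  assumes "norm u = 1" "u \<bullet> v = 0"
  shows "plane_rot u v \<theta> u = circ u v \<theta>"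
  using assms by (simp add: plane_rot_def circ_def norm_eq_1 algebra_simps)

definition on_first :: "nat \<Rightarrow> ('a \<Rightarrow> 'a) \<Rightarrow> (nat \<Rightarrow> 'a) \<Rightarrow> nat \<Rightarrow> 'a" where
  "on_first m Q S = (\<lambda>i. if i \<in> {1..m} then Q (S i) else S i)"

abbreviation cfg :: "nat \<Rightarrow> ('n::finite) config measure" where
  "cfg L \<equiv> PiM {1..L} (\<lambda>_. surf)"

lemma space_cfg: "space (cfg L) = spin_configs L"
  by (simp add: space_PiM spin_configs_def)

interpretation cfg: product_sigma_finite "\<lambda>_::nat. surf :: (real^'n::finite) measure"
  by standard

lemma measurable_upd_Suc [measurable]:
  assumes "f \<in> measurable N (cfg L)" "g \<in> measurable N surf"
  shows "(\<lambda>z. (f z)(Suc L := g z)) \<in> measurable N (cfg (Suc L))"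
  by (rule measurable_fun_upd[OF _ assms]) auto

lemma sigma_finite_cfg: "sigma_finite_measure (cfg L)"
  by (rule cfg.sigma_finite) simp

text \<open>
  All that the induction over the chain uses about a smooth \<open>F\<close>; there \<open>\<Delta> j\<close> is the squared length of the gradient
  with respect to the \<open>j\<close>-th spin.
\<close>

definition path_bound :: "nat \<Rightarrow> (('n::finite) config \<Rightarrow> real) \<Rightarrow> (nat \<Rightarrow> 'n config \<Rightarrow> ennreal) \<Rightarrow> bool" where
  "path_bound L F \<Delta> \<longleftrightarrow>
    (\<forall>u v m S a b. norm u = 1 \<longrightarrow> norm v = 1 \<longrightarrow> u \<bullet> v = 0 \<longrightarrow> m \<le> L \<longrightarrow> S \<in> spin_configs L \<longrightarrow>
       0 \<le> a \<longrightarrow> a \<le> b \<longrightarrow> b \<le> 2 * pi \<longrightarrow>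
       ennreal ((F (on_first m (plane_rot u v b) S) - F (on_first m (plane_rot u v a) S))\<^sup>2) \<le>
       ennreal (2 * pi * real m) *
         (\<integral>\<^sup>+\<theta>. indicator {a..b} \<theta> * (\<Sum>j=1..m. \<Delta> j (on_first m (plane_rot u v \<theta>) S)) \<partial>lborel))"

lemma spin_configs_upd:
  assumes "S \<in> spin_configs L" "norm x = 1"
  shows "S(Suc L := x) \<in> spin_configs (Suc L)"
  using assms by (auto simp: spin_configs_def PiE_def Pi_def extensional_def)

lemma on_first_upd: "m \<le> L \<Longrightarrow> on_first m Q (S(Suc L := x)) = (on_first m Q S)(Suc L := x)"
  by (auto simp: on_first_def fun_eq_iff)

lemma on_first_Suc_upd: "on_first (Suc L) Q (S(Suc L := x)) = (on_first L Q S)(Suc L := Q x)"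
  by (auto simp: on_first_def fun_eq_iff)

text \<open>A rotation of at most the first \<open>L\<close> spins leaves spin \<open>Suc L\<close>
  alone. This is why \<open>path_bound\<close> speaks of all segment lengths \<open>m\<close>: the
  induction passes to \<open>F\<close> with its last spin frozen.\<close>

lemma path_bound_fix_last:
  fixes F :: "('n::finite) config \<Rightarrow> real"
  assumes "path_bound (Suc L) F \<Delta>" "norm x = 1"
  shows "path_bound L (\<lambda>S. F (S(Suc L := x))) (\<lambda>j S. \<Delta> j (S(Suc L := x)))"
  unfolding path_bound_def
proof (intro allI impI)
  fix u v :: "real^'n" and m and S :: "'n config" and a b :: real
  assume h: "norm u = 1" "norm v = 1" "u \<bullet> v = 0" "m \<le> L" "S \<in> spin_configs L" "0 \<le> a" "a \<le> b" "b \<le> 2 * pi"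
  have "S(Suc L := x) \<in> spin_configs (Suc L)" using spin_configs_upd h assms(2) by blast
  from assms(1)[unfolded path_bound_def, rule_format, OF h(1-3) _ this h(6-8), of m]
  show "ennreal ((F ((on_first m (plane_rot u v b) S)(Suc L := x)) - F ((on_first m (plane_rot u v a) S)(Suc L := x)))\<^sup>2) \<le>
       ennreal (2 * pi * real m) *
         (\<integral>\<^sup>+\<theta>. indicator {a..b} \<theta> * (\<Sum>j=1..m. \<Delta> j ((on_first m (plane_rot u v \<theta>) S)(Suc L := x))) \<partial>lborel)"
    using h(4) by (simp add: on_first_upd)
qed

text \<open>The map may depend on the parameter \<open>z\<close>, since Fubini requires joint
  measurability in the angle and the configuration.\<close>

lemma measurable_on_first:
  assumes "\<And>i. i \<in> {1..m} \<Longrightarrow> (\<lambda>z. Q z (f z i)) \<in> measurable N surf" and f: "f \<in> measurable N (cfg L)" and "m \<le> L"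
  shows "(\<lambda>z. on_first m (Q z) (f z)) \<in> measurable N (cfg L)"
proof (rule measurable_PiM_single')
  fix i assume i: "i \<in> {1..L}"
  have "(\<lambda>z. f z i) \<in> measurable N surf" using measurable_compose[OF f measurable_component_singleton[OF i]] .
  thus "(\<lambda>z. on_first m (Q z) (f z) i) \<in> measurable N surf"
    using assms(1)[of i] unfolding on_first_def by (cases "i \<in> {1..m}") (simp_all del: atLeastAtMost_iff)
  next
  have "on_first m (Q z) (f z) \<in> (\<Pi>\<^sub>E i\<in>{1..L}. space surf)" if z: "z \<in> space N" for z
  proof -
    have "f z \<in> (\<Pi>\<^sub>E i\<in>{1..L}. space surf)" using measurable_space[OF f z] by (simp add: space_PiM)
    moreover have "Q z (f z i) \<in> space surf" if "i \<in> {1..m}" for i using measurable_space[OF assms(1)[OF that] z] .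
    ultimately show ?thesis using \<open>m \<le> L\<close> by (auto simp: on_first_def PiE_def Pi_def extensional_def)
  qed
  thus "(\<lambda>z. on_first m (Q z) (f z)) \<in> space N \<rightarrow> (\<Pi>\<^sub>E i\<in>{1..L}. space surf)" by blast
qed

lemma measurable_on_first_orthogonal:
  fixes Q :: "real ^ 'n::finite \<Rightarrow> real ^ 'n"
  assumes Q: "orthogonal_transformation Q"
  shows "on_first L Q \<in> measurable (cfg L) (cfg L)"
proof (rule measurable_on_first)
  fix i assume i: "i \<in> {1..L}"
  have "(\<lambda>S. S i) \<in> measurable (cfg L) surf" by (rule measurable_component_singleton[OF i])
  thus "(\<lambda>S. Q (S i)) \<in> measurable (cfg L) surf"
    by (rule measurable_compose[OF _ measurable_orthogonal_surface[OF Q]])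
qed auto

section \<open>The Markov chain and its Poincare inequality\<close>

text \<open>All that the induction asks of the kernel: it is an increasing function of the inner
  product, bounded by \<open>M\<close>, with mass 1 for every \<open>p\<close>. Dependence on the
  inner product alone is the source of the rotation symmetry, monotonicity that of the arc
  bound.\<close>

locale spin_chain =
  fixes w :: "real \<Rightarrow> real" and M :: real and W :: "real ^ 'n::finite \<Rightarrow> real ^ 'n \<Rightarrow> real"
  assumes N: "CARD('n) \<ge> 2"
    and mono_w: "mono w" and w_nonneg: "0 \<le> w t" and w_le: "\<bar>t\<bar> \<le> 1 \<Longrightarrow> w t \<le> M"
    and W: "W p x = w (x \<bullet> p)"
    and W_mass: "norm p = 1 \<Longrightarrow> (\<integral>\<^sup>+x. ennreal (W p x) \<partial>surf) = 1"
begin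

lemma w_measurable [measurable]: "w \<in> borel_measurable borel"
  using mono_w by (rule borel_measurable_mono)

lemma measurable_W [measurable]:
  assumes "f \<in> measurable N surf" "g \<in> measurable N surf"
  shows "(\<lambda>z. W (f z) (g z)) \<in> borel_measurable N"
proof -
  have [measurable]: "f \<in> borel_measurable N" "g \<in> borel_measurable N"
    using assms measurable_compose[OF _ borel_measurable_surface_id] by blast+
  show ?thesis unfolding W by measurable
qed

text \<open>With \<open>L\<close> factors this involves \<open>L + 1\<close> spins: spin
  \<open>Suc L\<close> is the boundary value on which spin \<open>L\<close> depends.\<close>

definition dens :: "nat \<Rightarrow> 'n config \<Rightarrow> real" where
  "dens L S = (\<Prod>i=1..L. W (S (Suc i)) (S i))"

lemma dens_nonneg: "0 \<le> dens L S" by (simp add: dens_def W w_nonneg prod_nonneg)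

lemma dens_Suc: "dens (Suc L) S = dens L S * W (S (Suc (Suc L))) (S (Suc L))"
  by (simp add: dens_def mult.commute)

lemma dens_upd: "dens L (S(Suc (Suc L) := x)) = dens L S"
  by (auto simp: dens_def intro!: prod.cong)

lemma measurable_dens [measurable]: "dens L \<in> borel_measurable (cfg (Suc L))"
proof -
  have [measurable]: "(\<lambda>S. S i) \<in> measurable (cfg (Suc L)) surf" if "i \<in> {1..Suc L}" for i
    by (rule measurable_component_singleton[OF that])
  show ?thesis unfolding dens_def[abs_def]
    by (intro borel_measurable_prod measurable_W) auto
qed

text \<open>
  \<open>chain L p\<close> is the law of the spins \<open>1, \<dots>, L\<close> given that the spin \<open>L + 1\<close> equals \<open>p\<close>; \<open>joint \<omega> L\<close> is the law of
  \<open>L + 1\<close> spins of which the last one has density \<open>\<omega>\<close>.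
\<close>

definition joint :: "(real ^ 'n \<Rightarrow> real) \<Rightarrow> nat \<Rightarrow> 'n config measure" where
  "joint \<omega> L = density (cfg (Suc L)) (\<lambda>S. ennreal (\<omega> (S (Suc L)) * dens L S))"

definition chain :: "nat \<Rightarrow> real ^ 'n \<Rightarrow> 'n config measure" where
  "chain L p = density (cfg L) (\<lambda>S. ennreal (dens L (S(Suc L := p))))"

lemma sets_chain [measurable_cong, simp]: "sets (chain L p) = sets (cfg L)" by (simp add: chain_def)
lemma space_chain [simp]: "space (chain L p) = spin_configs L" by (simp add: chain_def space_cfg)
lemma sets_joint [measurable_cong, simp]: "sets (joint \<omega> L) = sets (cfg (Suc L))" by (simp add: joint_def)
lemma space_joint [simp]: "space (joint \<omega> L) = spin_configs (Suc L)" by (simp add: joint_def space_cfg)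

text \<open>The spin next to the boundary becomes a last spin with density \<open>W p\<close>. As
  the Gibbs measure is the same construction with a constant density, one Poincare step for
  \<open>joint\<close> serves both the induction and the conclusion.\<close>

lemma chain_Suc: "chain (Suc L) p = joint (W p) L"
  by (simp add: chain_def joint_def dens_Suc dens_upd mult.commute)

lemma measurable_dens_upd [measurable]:
  assumes "norm p = 1"
  shows "(\<lambda>S. dens L (S(Suc L := p))) \<in> borel_measurable (cfg L)"
  by (rule measurable_compose[OF measurable_upd_Suc measurable_dens]) (use assms in auto)

lemma nn_integral_chain:
  assumes "norm p = 1" "h \<in> borel_measurable (cfg L)"
  shows "(\<integral>\<^sup>+S. h S \<partial>chain L p) = (\<integral>\<^sup>+S. ennreal (dens L (S(Suc L := p))) * h S \<partial>cfg L)"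
  unfolding chain_def using assms measurable_dens_upd[OF assms(1)] by (intro nn_integral_density) auto

text \<open>The measure itself varies with \<open>x\<close>. Moving its density into the integrand
  leaves the fixed measure \<open>cfg L\<close>, for which measurability in a parameter is
  standard.\<close>

lemma measurable_nn_integral_chain [measurable]:
  assumes [measurable]: "h \<in> borel_measurable (cfg (Suc L))"
  shows "(\<lambda>x. \<integral>\<^sup>+S. h (S(Suc L := x)) \<partial>chain L x) \<in> borel_measurable surf"
proof -
  interpret sigma_finite_measure "cfg L :: 'n config measure" by (rule sigma_finite_cfg)
  have "(\<lambda>x. \<integral>\<^sup>+S. h (S(Suc L := x)) \<partial>chain L x) \<in> borel_measurable surf \<longleftrightarrow>
    (\<lambda>x. \<integral>\<^sup>+S. ennreal (dens L (S(Suc L := x))) * h (S(Suc L := x)) \<partial>cfg L) \<in> borel_measurable surf"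
    by (rule measurable_cong, rule nn_integral_chain) (auto intro!: measurable_compose[OF _ assms])
  also have "\<dots>" by measurable
  finally show ?thesis .
qed

lemma nn_integral_joint:
  assumes [measurable]: "\<omega> \<in> borel_measurable surf" "h \<in> borel_measurable (cfg (Suc L))" and "\<And>x. 0 \<le> \<omega> x"
  shows "(\<integral>\<^sup>+S. h S \<partial>joint \<omega> L) = (\<integral>\<^sup>+x. ennreal (\<omega> x) * (\<integral>\<^sup>+S. h (S(Suc L := x)) \<partial>chain L x) \<partial>surf)"
proof -
  let ?H = "\<lambda>x. \<integral>\<^sup>+S. h (S(Suc L := x)) \<partial>chain L x"
  have [measurable]: "(\<lambda>S. S (Suc L)) \<in> measurable (cfg (Suc L)) surf"
    by (rule measurable_component_singleton) simp
  have ins: "{1..Suc L} = insert (Suc L) {1..L}" by auto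
  have "(\<integral>\<^sup>+S. h S \<partial>joint \<omega> L) = (\<integral>\<^sup>+S. ennreal (\<omega> (S (Suc L)) * dens L S) * h S \<partial>cfg (Suc L))"
    unfolding joint_def by (rule nn_integral_density) measurable
  also have "\<dots> = (\<integral>\<^sup>+x. \<integral>\<^sup>+S. ennreal (\<omega> x * dens L (S(Suc L := x))) * h (S(Suc L := x)) \<partial>cfg L \<partial>surf)"
  proof -
    have m: "(\<lambda>S. ennreal (\<omega> (S (Suc L)) * dens L S) * h S) \<in> borel_measurable (PiM (insert (Suc L) {1..L}) (\<lambda>_. surf))"
      unfolding ins[symmetric] by measurable
    show ?thesis unfolding ins by (subst cfg.product_nn_integral_insert_rev[OF _ _ m]) auto
  qed
  also have "\<dots> = (\<integral>\<^sup>+x. ennreal (\<omega> x) * ?H x \<partial>surf)"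
  proof (rule nn_integral_cong)
    fix x :: "real^'n" assume x: "x \<in> space surf"
    have [measurable]: "(\<lambda>S. h (S(Suc L := x))) \<in> borel_measurable (cfg L)"
      "(\<lambda>S. dens L (S(Suc L := x))) \<in> borel_measurable (cfg L)" using x by measurable
    have "(\<integral>\<^sup>+S. ennreal (\<omega> x * dens L (S(Suc L := x))) * h (S(Suc L := x)) \<partial>cfg L) =
       (\<integral>\<^sup>+S. ennreal (\<omega> x) * (ennreal (dens L (S(Suc L := x))) * h (S(Suc L := x))) \<partial>cfg L)"
      by (simp add: ennreal_mult assms(3) dens_nonneg mult.assoc)
    also have "\<dots> = ennreal (\<omega> x) * ?H x"
      using x by (subst nn_integral_chain) (simp_all add: nn_integral_cmult)
    finally show "(\<integral>\<^sup>+S. ennreal (\<omega> x * dens L (S(Suc L := x))) * h (S(Suc L := x)) \<partial>cfg L) =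
       ennreal (\<omega> x) * ?H x" .
  qed
  finally show ?thesis .
qed

lemma W_nonneg: "0 \<le> W p x" by (simp add: W w_nonneg)

lemma W_measurable1 [measurable]: "W p \<in> borel_measurable surf"
  unfolding W[abs_def] by measurable

lemma prob_space_chain: "norm p = 1 \<Longrightarrow> prob_space (chain L p)"
proof (induction L arbitrary: p)
  case 0
  show ?case
    by (rule prob_spaceI) (simp add: chain_def dens_def emeasure_density space_PiM PiM_empty)
next
  case (Suc L)
  show ?case
  proof (rule prob_spaceI)
    have "emeasure (chain (Suc L) p) (space (chain (Suc L) p)) = (\<integral>\<^sup>+S. 1 \<partial>joint (W p) L)"
      unfolding chain_Suc by simp
    also have "\<dots> = (\<integral>\<^sup>+x. ennreal (W p x) * (\<integral>\<^sup>+S. 1 \<partial>chain L x) \<partial>surf)"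
      by (rule nn_integral_joint) (auto simp: W_nonneg)
    also have "\<dots> = (\<integral>\<^sup>+x. ennreal (W p x) \<partial>surf)"
      using prob_space.emeasure_space_1[OF Suc.IH] by (intro nn_integral_cong) simp
    finally show "emeasure (chain (Suc L) p) (space (chain (Suc L) p)) = 1" by (simp add: W_mass Suc.prems)
  qed
qed

text \<open>The kernel sees inner products only and the surface measure is invariant, so turning the
  boundary together with all spins is a symmetry. The induction substitutes \<open>Q x\<close> for
  the top spin and then treats that spin as the boundary of the shorter chain.\<close>

lemma nn_integral_chain_orthogonal:
  assumes Q: "orthogonal_transformation Q" and "norm p = 1" "h \<in> borel_measurable (cfg L)"
  shows "(\<integral>\<^sup>+S. h S \<partial>chain L (Q p)) = (\<integral>\<^sup>+S. h (on_first L Q S) \<partial>chain L p)"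
  using assms(2,3)
proof (induction L arbitrary: p h)
  case 0
  then show ?case by (simp add: chain_def dens_def on_first_def)
next
  case (Suc L)
  note [measurable] = Suc.prems(2) measurable_orthogonal_surface[OF Q]
  have nQ: "norm (Q x) = norm x" for x using Q by (rule orthogonal_transformation_norm)
  have WQ: "W (Q a) (Q b) = W a b" for a b using Q by (simp add: W orthogonal_transformation_def)
  note om = measurable_on_first_orthogonal[OF Q, of "Suc L"]
  define G where "G x = ennreal (W (Q p) x) * (\<integral>\<^sup>+S. h (S(Suc L := x)) \<partial>chain L x)" for x
  have G [measurable]: "G \<in> borel_measurable surf" unfolding G_def by measurable
  have "(\<integral>\<^sup>+S. h S \<partial>chain (Suc L) (Q p)) = (\<integral>\<^sup>+x. G x \<partial>surf)"
    unfolding chain_Suc G_def by (rule nn_integral_joint) (auto simp: W_nonneg Suc.prems)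
  also have "\<dots> = (\<integral>\<^sup>+x. G x \<partial>distr surf surf Q)" by (simp add: distr_surface_orthogonal[OF Q])
  also have "\<dots> = (\<integral>\<^sup>+x. G (Q x) \<partial>surf)" by (rule nn_integral_distr) measurable
  also have "\<dots> = (\<integral>\<^sup>+x. ennreal (W p x) * (\<integral>\<^sup>+S. h (on_first (Suc L) Q (S(Suc L := x))) \<partial>chain L x) \<partial>surf)"
  proof (rule nn_integral_cong)
    fix x :: "real^'n" assume x: "x \<in> space surf"
    hence Qx: "Q x \<in> space surf" by (simp add: nQ)
    have "(\<integral>\<^sup>+S. h (S(Suc L := Q x)) \<partial>chain L (Q x)) = (\<integral>\<^sup>+S. h ((on_first L Q S)(Suc L := Q x)) \<partial>chain L x)"
    proof (rule Suc.IH)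
      show "norm x = 1" using x by simp
      show "(\<lambda>S. h (S(Suc L := Q x))) \<in> borel_measurable (cfg L)" using Qx by measurable
    qed
    thus "G (Q x) = ennreal (W p x) * (\<integral>\<^sup>+S. h (on_first (Suc L) Q (S(Suc L := x))) \<partial>chain L x)"
      by (simp add: G_def WQ on_first_Suc_upd)
  qed
  also have "\<dots> = (\<integral>\<^sup>+S. h (on_first (Suc L) Q S) \<partial>chain (Suc L) p)"
    unfolding chain_Suc
    by (rule nn_integral_joint[symmetric]) (auto simp: W_nonneg intro!: measurable_compose[OF om Suc.prems(2)])
  finally show ?case .
qed

text \<open>The form needed for signed integrals, hence for conditional expectations.\<close>

lemma chain_orthogonal:
  assumes Q: "orthogonal_transformation Q" and p: "norm p = 1"
  shows "chain L (Q p) = distr (chain L p) (cfg L) (on_first L Q)"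
proof (rule measure_eqI)
  fix A assume "A \<in> sets (chain L (Q p))"
  hence A [measurable]: "A \<in> sets (cfg L)" by simp
  have om: "on_first L Q \<in> measurable (chain L p) (cfg L)"
    using measurable_on_first_orthogonal[OF Q] by (simp add: measurable_cong_sets[OF sets_chain refl])
  have "emeasure (chain L (Q p)) A = (\<integral>\<^sup>+S. indicator A S \<partial>chain L (Q p))"
    by (rule nn_integral_indicator[symmetric]) simp
  also have "\<dots> = (\<integral>\<^sup>+S. indicator A (on_first L Q S) \<partial>chain L p)"
    by (rule nn_integral_chain_orthogonal[OF Q p]) measurable
  also have "\<dots> = (\<integral>\<^sup>+S. indicator A S \<partial>distr (chain L p) (cfg L) (on_first L Q))"
    by (rule nn_integral_distr[OF om, symmetric]) measurable
  also have "\<dots> = emeasure (distr (chain L p) (cfg L) (on_first L Q)) A"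
    by (rule nn_integral_indicator) simp
  finally show "emeasure (chain L (Q p)) A = emeasure (distr (chain L p) (cfg L) (on_first L Q)) A" .
qed simp

lemma integral_chain:
  assumes p: "norm p = 1" and [measurable]: "h \<in> borel_measurable (cfg L)"
  shows "(\<integral>S. h S \<partial>chain L p) = (\<integral>S. dens L (S(Suc L := p)) * h S \<partial>cfg L)"
  using measurable_dens_upd[OF p] unfolding chain_def
  by (subst integral_real_density) (auto simp: dens_nonneg)

lemma measurable_integral_chain:
  fixes h :: "'n config \<Rightarrow> real"
  assumes [measurable]: "h \<in> borel_measurable (cfg (Suc L))"
  shows "(\<lambda>x. \<integral>S. h (S(Suc L := x)) \<partial>chain L x) \<in> borel_measurable surf"
proof -
  interpret sigma_finite_measure "cfg L :: 'n config measure" by (rule sigma_finite_cfg)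
  have "(\<lambda>x. \<integral>S. h (S(Suc L := x)) \<partial>chain L x) \<in> borel_measurable surf \<longleftrightarrow>
    (\<lambda>x. \<integral>S. dens L (S(Suc L := x)) * h (S(Suc L := x)) \<partial>cfg L) \<in> borel_measurable surf"
    by (rule measurable_cong, rule integral_chain) (auto intro!: measurable_compose[OF _ assms])
  also have "\<dots>" by measurable
  finally show ?thesis .
qed

definition poincare_const :: ennreal where
  "poincare_const = ennreal (2 * pi\<^sup>2 * M) * mass TYPE('n)"

text \<open>
  Rotating the last spin along a great circle together with the whole chain below it keeps the law of
  the rest, so the conditional expectation inherits the path bound of \<open>F\<close>.
\<close>

lemma conditional_expectation_arc:
  fixes F :: "'n config \<Rightarrow> real"
  assumes F [measurable]: "F \<in> borel_measurable (cfg (Suc L))" and B: "\<And>S. S \<in> spin_configs (Suc L) \<Longrightarrow> \<bar>F S\<bar> \<le> B"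
    and \<Delta>: "\<And>j. j \<in> {1..Suc L} \<Longrightarrow> \<Delta> j \<in> borel_measurable (cfg (Suc L))"
    and path: "path_bound (Suc L) F \<Delta>"
    and uv: "norm u = 1" "norm v = 1" "u \<bullet> v = 0" and ab: "0 \<le> a" "a \<le> b" "b \<le> 2 * pi"
  defines "g \<equiv> \<lambda>x. \<integral>S. F (S(Suc L := x)) \<partial>chain L x"
  shows "ennreal ((g (circ u v b) - g (circ u v a))\<^sup>2) \<le> ennreal (2 * pi) *
     (\<integral>\<^sup>+\<theta>. indicator {a..b} \<theta> * (of_nat (Suc L) *
        (\<integral>\<^sup>+S. (\<Sum>j=1..Suc L. \<Delta> j (S(Suc L := circ u v \<theta>))) \<partial>chain L (circ u v \<theta>))) \<partial>lborel)"
proof -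
  define R where "R = plane_rot u v"
  have R: "orthogonal_transformation (R \<theta>)" for \<theta> unfolding R_def by (rule orthogonal_plane_rot[OF uv])
  have Ru: "R \<theta> u = circ u v \<theta>" for \<theta> unfolding R_def by (rule plane_rot_axis[OF uv(1,3)])
  define rot where "rot \<theta> S = on_first (Suc L) (R \<theta>) (S(Suc L := u))" for \<theta> and S :: "'n config"
  have us: "u \<in> space surf" using uv by simp
  define D where "D S = (\<Sum>j=1..Suc L. \<Delta> j S)" for S
  have D [measurable]: "D \<in> borel_measurable (cfg (Suc L))" unfolding D_def[abs_def] using \<Delta> by (intro borel_measurable_sum) auto
  let ?I = "\<lambda>\<theta>. \<integral>\<^sup>+S. D (S(Suc L := circ u v \<theta>)) \<partial>chain L (circ u v \<theta>)" and ?J = "\<lambda>\<theta> S. indicator {a..b} \<theta> * D (rot \<theta> S)"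
  let ?K = "\<lambda>S. \<integral>\<^sup>+\<theta>. ?J \<theta> S \<partial>lborel" and ?C = "\<lambda>\<theta>. \<integral>\<^sup>+S. ?J \<theta> S \<partial>chain L u"
  interpret P: prob_space "chain L u" by (rule prob_space_chain[OF uv(1)])
  have rotm: "(\<lambda>z. rot (fst z) (snd z)) \<in> measurable (borel \<Otimes>\<^sub>M cfg L) (cfg (Suc L))"
    unfolding rot_def
  proof (rule measurable_on_first)
    show u: "(\<lambda>z :: real \<times> 'n config. (snd z)(Suc L := u)) \<in> measurable (borel \<Otimes>\<^sub>M cfg L) (cfg (Suc L))"
      using us by measurable
    fix i assume i: "i \<in> {1..Suc L}"
    have c: "(\<lambda>z :: real \<times> 'n config. ((snd z)(Suc L := u)) i) \<in> measurable (borel \<Otimes>\<^sub>M cfg L) surf"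
      by (rule measurable_compose[OF u]) (rule measurable_component_singleton[OF i])
    show "(\<lambda>z :: real \<times> 'n config. R (fst z) (((snd z)(Suc L := u)) i)) \<in> measurable (borel \<Otimes>\<^sub>M cfg L) surf"
    proof (rule measurable_into_surface_measure)
      note [measurable] = measurable_compose[OF c borel_measurable_surface_id]
      show "(\<lambda>z :: real \<times> 'n config. R (fst z) (((snd z)(Suc L := u)) i)) \<in> borel_measurable (borel \<Otimes>\<^sub>M cfg L)"
        unfolding R_def plane_rot_def by measurable
      fix z :: "real \<times> 'n config" assume "z \<in> space (borel \<Otimes>\<^sub>M cfg L)"
      from measurable_space[OF c this] show "norm (R (fst z) (((snd z)(Suc L := u)) i)) = 1"
        by (simp add: orthogonal_transformation_norm[OF R])
    qed
  qed simp
  have rotm1: "rot \<theta> \<in> measurable (cfg L) (cfg (Suc L))" for \<theta>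
    using measurable_compose[OF _ rotm, of "\<lambda>S. (\<theta>, S)" "cfg L"] by simp
  have rots: "rot \<theta> S \<in> spin_configs (Suc L)" if "S \<in> spin_configs L" for S \<theta>
    using measurable_space[OF rotm1, of S \<theta>] that by (simp add: space_cfg)
  have rot: "rot \<theta> S = (on_first L (R \<theta>) S)(Suc L := circ u v \<theta>)" for \<theta> S
    by (simp add: rot_def on_first_Suc_upd Ru)
  have cs: "circ u v \<theta> \<in> space surf" for \<theta> by (simp add: norm_circ[OF uv])
  have Fm: "(\<lambda>S. F (rot \<theta> S)) \<in> borel_measurable (chain L u)" for \<theta>
    using measurable_compose[OF rotm1 F] by (simp add: measurable_cong_sets[OF sets_chain refl])
  have Fint: "integrable (chain L u) (\<lambda>S. F (rot \<theta> S))" for \<theta>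
    by (rule P.integrable_const_bound[of _ B]) (use B rots Fm in auto)
  have om: "on_first L (R \<theta>) \<in> measurable (chain L u) (cfg L)" for \<theta>
    using measurable_on_first_orthogonal[OF R] by (simp add: measurable_cong_sets[OF sets_chain refl])
  \<comment> \<open>The rotation turns all conditional expectations along the arc into integrals
    against the single law \<open>chain L u\<close>, so their difference can be taken under the
    integral.\<close>
  have g: "g (circ u v \<theta>) = (\<integral>S. F (rot \<theta> S) \<partial>chain L u)" for \<theta>
  proof -
    have [measurable]: "(\<lambda>S. F (S(Suc L := circ u v \<theta>))) \<in> borel_measurable (cfg L)" using cs by measurable
    have "g (circ u v \<theta>) = (\<integral>S. F (S(Suc L := circ u v \<theta>)) \<partial>chain L (R \<theta> u))" by (simp add: g_def Ru)
    also have "\<dots> = (\<integral>S. F ((on_first L (R \<theta>) S)(Suc L := circ u v \<theta>)) \<partial>chain L u)"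
      unfolding chain_orthogonal[OF R uv(1)] by (rule integral_distr[OF om]) measurable
    finally show ?thesis by (simp add: rot)
  qed
  have dm: "(\<lambda>S. F (rot b S) - F (rot a S)) \<in> borel_measurable (chain L u)"
    using Fm[of a] Fm[of b] by (rule borel_measurable_diff[rotated])
  have di: "integrable (chain L u) (\<lambda>S. F (rot b S) - F (rot a S))" using Fint by simp
  have d2: "integrable (chain L u) (\<lambda>S. (F (rot b S) - F (rot a S))\<^sup>2)"
  proof (rule P.integrable_const_bound[of _ "(2 * B)\<^sup>2"])
    have "(F (rot b S) - F (rot a S))\<^sup>2 \<le> (2 * B)\<^sup>2" if "S \<in> spin_configs L" for S
      using B[OF rots[OF that, of a]] B[OF rots[OF that, of b]] by (intro abs_le_square_iff[THEN iffD1]) linarith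
    thus "AE S in chain L u. norm ((F (rot b S) - F (rot a S))\<^sup>2) \<le> (2 * B)\<^sup>2" by (intro AE_I2) simp
  qed (use dm in measurable)
  interpret PP: pair_sigma_finite "chain L u" "lborel :: real measure" ..
  have m: "(\<lambda>z. indicator {a..b} (snd z) * D (rot (snd z) (fst z))) \<in> borel_measurable (chain L u \<Otimes>\<^sub>M lborel)"
  proof -
    have sets: "sets (chain L u \<Otimes>\<^sub>M lborel) = sets (cfg L \<Otimes>\<^sub>M borel)" by (intro sets_pair_measure_cong) auto
    have "(\<lambda>z. rot (snd z) (fst z)) \<in> measurable (cfg L \<Otimes>\<^sub>M borel) (cfg (Suc L))"
      using measurable_compose[OF measurable_pair_swap' rotm] by (simp add: case_prod_unfold)
    from measurable_compose[OF this D]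
    have "(\<lambda>z. indicator {a..b} (snd z) * D (rot (snd z) (fst z))) \<in> borel_measurable (cfg L \<Otimes>\<^sub>M borel)"
      by (rule borel_measurable_times_ennreal[rotated]) measurable
    thus ?thesis by (simp add: measurable_cong_sets[OF sets refl])
  qed
  \<comment> \<open>Jensen's inequality for the square, in the form that a variance is
    nonnegative.\<close>
  have "(g (circ u v b) - g (circ u v a))\<^sup>2 = (P.expectation (\<lambda>S. F (rot b S) - F (rot a S)))\<^sup>2"
    using Fint by (simp add: g)
  also have "\<dots> \<le> P.expectation (\<lambda>S. (F (rot b S) - F (rot a S))\<^sup>2)"
    using P.variance_positive[of "\<lambda>S. F (rot b S) - F (rot a S)"] P.variance_eq[OF di d2] by simp
  finally have "ennreal ((g (circ u v b) - g (circ u v a))\<^sup>2) \<le> ennreal (P.expectation (\<lambda>S. (F (rot b S) - F (rot a S))\<^sup>2))"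
    by (rule ennreal_leI)
  also have "\<dots> = (\<integral>\<^sup>+S. ennreal ((F (rot b S) - F (rot a S))\<^sup>2) \<partial>chain L u)"
    by (rule nn_integral_eq_integral[OF d2, symmetric]) simp
  also have "\<dots> \<le> (\<integral>\<^sup>+S. ennreal (2 * pi * real (Suc L)) * ?K S \<partial>chain L u)"
  proof (rule nn_integral_mono)
    fix S assume "S \<in> space (chain L u)"
    hence "S(Suc L := u) \<in> spin_configs (Suc L)" using spin_configs_upd uv by auto
    from path[unfolded path_bound_def, rule_format, OF uv order_refl this ab]
    show "ennreal ((F (rot b S) - F (rot a S))\<^sup>2) \<le>
       ennreal (2 * pi * real (Suc L)) * ?K S"
      by (simp only: rot_def R_def D_def)
  qed
  also have "\<dots> = ennreal (2 * pi * real (Suc L)) *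
     (\<integral>\<^sup>+S. ?K S \<partial>chain L u)"
    by (rule nn_integral_cmult) (rule lborel.borel_measurable_nn_integral, simp add: case_prod_unfold m)
  also have "(\<integral>\<^sup>+S. ?K S \<partial>chain L u) =
     (\<integral>\<^sup>+\<theta>. ?C \<theta> \<partial>lborel)"
    by (rule PP.Fubini'[symmetric]) (simp add: case_prod_unfold m)
  also have "(\<integral>\<^sup>+\<theta>. ?C \<theta> \<partial>lborel) =
    (\<integral>\<^sup>+\<theta>. indicator {a..b} \<theta> * ?I \<theta> \<partial>lborel)"
  proof (rule nn_integral_cong)
    fix \<theta> :: real
    have m: "(\<lambda>S. D (S(Suc L := circ u v \<theta>))) \<in> borel_measurable (cfg L)" using cs by measurable
    \<comment> \<open>The symmetry is used backwards here, to return from \<open>chain L u\<close>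
      to the law below the rotated spin.\<close>
    have "?I \<theta> = (\<integral>\<^sup>+S. D (rot \<theta> S) \<partial>chain L u)"
      using nn_integral_chain_orthogonal[OF R uv(1) m] by (simp add: rot Ru)
    thus "?C \<theta> =
      indicator {a..b} \<theta> * ?I \<theta>"
      by (cases "\<theta> \<in> {a..b}") auto
  qed
  also have "ennreal (2 * pi * real (Suc L)) * \<dots> = ennreal (2 * pi) *
     (\<integral>\<^sup>+\<theta>. indicator {a..b} \<theta> * (of_nat (Suc L) * ?I \<theta>) \<partial>lborel)"
  proof -
    have c: "circ u v \<in> measurable borel surf"
      by (rule measurable_into_surface_measure, unfold circ_def[abs_def], measurable)
        (simp add: circ_def[symmetric] norm_circ uv)
    note [measurable] = measurable_compose[OF c measurable_nn_integral_chain[OF D]]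
    have "(\<integral>\<^sup>+\<theta>. indicator {a..b} \<theta> * (of_nat (Suc L) * ?I \<theta>) \<partial>lborel)
      = (\<integral>\<^sup>+\<theta>. of_nat (Suc L) * (indicator {a..b} \<theta> * ?I \<theta>) \<partial>lborel)"
      by (simp add: mult_ac)
    also have "\<dots> = of_nat (Suc L) * (\<integral>\<^sup>+\<theta>. indicator {a..b} \<theta> * ?I \<theta> \<partial>lborel)"
      by (rule nn_integral_cmult) measurable
    moreover have "ennreal (2 * pi * real (Suc L)) = ennreal (2 * pi) * of_nat (Suc L)"
      unfolding ennreal_of_nat_eq_real_of_nat by (rule ennreal_mult) auto
    ultimately show ?thesis by (simp only: mult.assoc)
  qed
  finally show ?thesis by (simp only: D_def)
qed

text \<open>Conditioning on the last spin splits the second moment: the spins below cost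
  \<open>L\<^sup>2\<close> by hypothesis, the conditional expectation \<open>g\<close> costs
  \<open>Suc L\<close> by the one spin inequality, and
  \<open>L\<^sup>2 + Suc L \<le> (Suc L)\<^sup>2\<close>. The bound for \<open>L\<close> spins is an
  assumption so that the step applies inside the induction and once more on top of it. The profile
  \<open>w'\<close> of the last spin is separate from \<open>w\<close> to admit a uniform last
  spin.\<close>

lemma joint_poincare_step:
  fixes F :: "'n config \<Rightarrow> real" and w' :: "real \<Rightarrow> real" and p :: "real ^ 'n"
  assumes IH: "\<And>q F \<Delta>. norm q = 1 \<Longrightarrow> F \<in> borel_measurable (cfg L) \<Longrightarrow> (\<And>S. S \<in> spin_configs L \<Longrightarrow> \<bar>F S\<bar> \<le> B) \<Longrightarrow>
       (\<And>j. j \<in> {1..L} \<Longrightarrow> \<Delta> j \<in> borel_measurable (cfg L)) \<Longrightarrow> path_bound L F \<Delta> \<Longrightarrow>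
       \<exists>c. (\<integral>\<^sup>+S. ennreal ((F S - c)\<^sup>2) \<partial>chain L q) \<le>
         poincare_const * of_nat (L\<^sup>2) * (\<Sum>j=1..L. \<integral>\<^sup>+S. \<Delta> j S \<partial>chain L q)"
    and w': "mono w'" "\<And>t. 0 \<le> w' t" "\<And>t. \<bar>t\<bar> \<le> 1 \<Longrightarrow> w' t \<le> M"
    and p: "norm p = 1" and w'_mass: "(\<integral>\<^sup>+x. ennreal (w' (x \<bullet> p)) \<partial>(surf :: (real^'n) measure)) = 1"
    and F [measurable]: "F \<in> borel_measurable (cfg (Suc L))" and B: "\<And>S. S \<in> spin_configs (Suc L) \<Longrightarrow> \<bar>F S\<bar> \<le> B"
    and \<Delta>: "\<And>j. j \<in> {1..Suc L} \<Longrightarrow> \<Delta> j \<in> borel_measurable (cfg (Suc L))"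
    and path: "path_bound (Suc L) F \<Delta>"
  defines "\<mu> \<equiv> joint (\<lambda>x. w' (x \<bullet> p)) L"
  shows "\<exists>c. (\<integral>\<^sup>+S. ennreal ((F S - c)\<^sup>2) \<partial>\<mu>) \<le>
         poincare_const * of_nat ((Suc L)\<^sup>2) * (\<Sum>j=1..Suc L. \<integral>\<^sup>+S. \<Delta> j S \<partial>\<mu>)"
proof -
  let ?X = "\<lambda>x. \<integral>\<^sup>+S. (\<Sum>j=1..Suc L. \<Delta> j (S(Suc L := x))) \<partial>chain L x"
  let ?H = "\<lambda>h x. \<integral>\<^sup>+S. h (S(Suc L := x)) \<partial>chain L x"
  have [measurable]: "w' \<in> borel_measurable borel" using w'(1) by (rule borel_measurable_mono)
  have \<omega> [measurable]: "(\<lambda>x. w' (x \<bullet> p)) \<in> borel_measurable surf" by measurable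
  define \<kappa> where "\<kappa> = density surf (\<lambda>x. ennreal (w' (x \<bullet> p)))"
  have \<kappa>sets [measurable_cong]: "sets \<kappa> = sets surf" by (simp add: \<kappa>_def)
  have \<kappa>: "prob_space \<kappa>"
  proof (rule prob_spaceI)
    have "emeasure \<kappa> (space \<kappa>) = (\<integral>\<^sup>+x. 1 \<partial>\<kappa>)" by simp
    also have "\<dots> = (\<integral>\<^sup>+x. ennreal (w' (x \<bullet> p)) * 1 \<partial>surf)" unfolding \<kappa>_def by (rule nn_integral_density) auto
    finally show "emeasure \<kappa> (space \<kappa>) = 1" using w'_mass by simp
  qed
  have J: "(\<integral>\<^sup>+S. h S \<partial>\<mu>) = (\<integral>\<^sup>+x. ?H h x \<partial>\<kappa>)" if [measurable]: "h \<in> borel_measurable (cfg (Suc L))" for h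
  proof -
    have "(\<integral>\<^sup>+S. h S \<partial>\<mu>) = (\<integral>\<^sup>+x. ennreal (w' (x \<bullet> p)) * ?H h x \<partial>surf)"
      unfolding \<mu>_def by (rule nn_integral_joint) (auto simp: w')
    also have "\<dots> = (\<integral>\<^sup>+x. ?H h x \<partial>\<kappa>)"
      unfolding \<kappa>_def by (rule nn_integral_density[symmetric]) measurable
    finally show ?thesis .
  qed
  define g where "g = (\<lambda>x. \<integral>S. F (S(Suc L := x)) \<partial>chain L x)"
  have g [measurable]: "g \<in> borel_measurable surf" unfolding g_def by (rule measurable_integral_chain[OF F])
  have Fx [measurable]: "(\<lambda>S. F (S(Suc L := x))) \<in> borel_measurable (cfg L)" if "norm x = 1" for x
  proof -
    have "x \<in> space surf" using that by simp
    thus ?thesis by measurable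
  qed
  have gB: "\<bar>g x\<bar> \<le> B" if x: "norm x = 1" for x
  proof -
    interpret prob_space "chain L x" by (rule prob_space_chain[OF x])
    have bd: "\<bar>F (S(Suc L := x))\<bar> \<le> B" if "S \<in> spin_configs L" for S using B spin_configs_upd[OF that x] by blast
    have i: "integrable (chain L x) (\<lambda>S. F (S(Suc L := x)))"
      by (rule integrable_const_bound[of _ B]) (use bd Fx[OF x] in auto)
    have "g x \<le> B" unfolding g_def by (rule integral_le_const[OF i]) (use bd in \<open>auto simp: abs_le_iff\<close>)
    moreover have "- B \<le> g x" unfolding g_def by (rule integral_ge_const[OF i]) (use bd in \<open>force simp: abs_le_iff\<close>)
    ultimately show ?thesis by (simp add: abs_le_iff)
  qed
  define E where "E j = (\<integral>\<^sup>+S. \<Delta> j S \<partial>\<mu>)" for j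
  define c where "c = (\<integral>y. g y \<partial>\<kappa>)"
  let ?S = "\<Sum>j=1..Suc L. E j" and ?V = "\<integral>\<^sup>+x. ennreal ((g x - c)\<^sup>2) \<partial>\<kappa>"
  define \<Phi> where "\<Phi> x = of_nat (Suc L) * ?X x" for x
  have D [measurable]: "(\<lambda>S. \<Sum>j=1..Suc L. \<Delta> j S) \<in> borel_measurable (cfg (Suc L))" using \<Delta> by (intro borel_measurable_sum) auto
  have \<Phi>m [measurable]: "\<Phi> \<in> borel_measurable surf" unfolding \<Phi>_def
    by (rule borel_measurable_times_ennreal[OF borel_measurable_const measurable_nn_integral_chain[OF D]])
  have "?V \<le> ennreal (2 * pi\<^sup>2 * M) * mass TYPE('n) * (\<integral>\<^sup>+x. \<Phi> x \<partial>\<kappa>)"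
    unfolding \<kappa>_def c_def
  proof (rule sphere_poincare[OF N p w' _ \<Phi>m g gB])
    show "prob_space (density surf (\<lambda>x. ennreal (w' (x \<bullet> p))))" using \<kappa> by (simp add: \<kappa>_def)
    fix u v :: "real^'n" and a b :: real
    assume "norm u = 1" "norm v = 1" "u \<bullet> v = 0" "0 \<le> a" "a \<le> b" "b \<le> 2 * pi"
    from conditional_expectation_arc[OF F B \<Delta> path this]
    show "ennreal ((g (circ u v b) - g (circ u v a))\<^sup>2) \<le> ennreal (2 * pi) * (\<integral>\<^sup>+\<theta>. indicator {a..b} \<theta> * \<Phi> (circ u v \<theta>) \<partial>lborel)"
      unfolding g_def \<Phi>_def .
  qed
  also have "(\<integral>\<^sup>+x. \<Phi> x \<partial>\<kappa>) = of_nat (Suc L) * ?S"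
  proof -
    have "(\<integral>\<^sup>+x. \<Phi> x \<partial>\<kappa>) = of_nat (Suc L) * (\<integral>\<^sup>+x. ?X x \<partial>\<kappa>)"
      unfolding \<Phi>_def using measurable_nn_integral_chain[OF D] by (intro nn_integral_cmult) (simp add: measurable_cong_sets[OF \<kappa>sets refl])
    also have "(\<integral>\<^sup>+x. ?X x \<partial>\<kappa>) = (\<integral>\<^sup>+S. (\<Sum>j=1..Suc L. \<Delta> j S) \<partial>\<mu>)"
      by (rule J[OF D, symmetric])
    also have "\<dots> = ?S"
      unfolding E_def using \<Delta> by (intro nn_integral_sum) (simp add: \<mu>_def measurable_cong_sets[OF sets_joint refl])
    finally show ?thesis .
  qed
  finally have var_g: "?V \<le> poincare_const * (of_nat (Suc L) * ?S)"
    by (simp only: poincare_const_def)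
  define A where "A x = (\<integral>\<^sup>+S. (\<Sum>j=1..L. \<Delta> j (S(Suc L := x))) \<partial>chain L x)" for x
  have D' [measurable]: "(\<lambda>S. \<Sum>j=1..L. \<Delta> j S) \<in> borel_measurable (cfg (Suc L))" using \<Delta> by (intro borel_measurable_sum) auto
  have Am [measurable]: "A \<in> borel_measurable surf" unfolding A_def by (rule measurable_nn_integral_chain[OF D'])
  have inner: "(\<integral>\<^sup>+S. ennreal ((F (S(Suc L := x)) - c)\<^sup>2) \<partial>chain L x) \<le>
     poincare_const * of_nat (L\<^sup>2) * A x + ennreal ((g x - c)\<^sup>2)" if x: "norm x = 1" for x
  proof -
    let ?Q = "\<lambda>c. \<integral>\<^sup>+S. ennreal ((F (S(Suc L := x)) - c)\<^sup>2) \<partial>chain L x"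
    interpret prob_space "chain L x" by (rule prob_space_chain[OF x])
    have bd: "\<bar>F (S(Suc L := x))\<bar> \<le> B" if "S \<in> spin_configs L" for S using B spin_configs_upd[OF that x] by blast
    have bd': "\<bar>F (S(Suc L := x))\<bar> \<le> B" if "S \<in> space (chain L x)" for S using bd that by simp
    have Fxc: "(\<lambda>S. F (S(Suc L := x))) \<in> borel_measurable (chain L x)" using Fx[OF x] by (simp add: measurable_cong_sets[OF sets_chain refl])
    have shift: "?Q c =
        ?Q (g x) + ennreal ((g x - c)\<^sup>2)" for c
      unfolding g_def by (rule nn_variance_shift[OF Fxc bd'])
    have \<Delta>x: "(\<lambda>S. \<Delta> j (S(Suc L := x))) \<in> borel_measurable (cfg L)" if j: "j \<in> {1..L}" for j
    proof -
      have "x \<in> space surf" using x by simp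
      hence "(\<lambda>S. S(Suc L := x)) \<in> measurable (cfg L) (cfg (Suc L))" by measurable
      thus ?thesis by (rule measurable_compose) (use \<Delta> j in auto)
    qed
    obtain c' where "?Q c' \<le>
         poincare_const * of_nat (L\<^sup>2) * (\<Sum>j=1..L. \<integral>\<^sup>+S. \<Delta> j (S(Suc L := x)) \<partial>chain L x)"
      using IH[OF x Fx[OF x] bd \<Delta>x path_bound_fix_last[OF path x]] by blast
    also have "(\<Sum>j=1..L. \<integral>\<^sup>+S. \<Delta> j (S(Suc L := x)) \<partial>chain L x) = A x"
      unfolding A_def using \<Delta>x by (intro nn_integral_sum[symmetric]) (simp add: measurable_cong_sets[OF sets_chain refl])
    finally have "?Q c' \<le> poincare_const * of_nat (L\<^sup>2) * A x" .
    \<comment> \<open>The hypothesis provides some centre \<open>c'\<close>; the conditional mean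
      \<open>g x\<close> is at least as good.\<close>
    moreover have "?Q (g x) \<le> ?Q c'"
      unfolding shift[of c'] by simp
    ultimately have "?Q (g x) \<le> poincare_const * of_nat (L\<^sup>2) * A x"
      by (rule order_trans[rotated])
    thus ?thesis unfolding shift[of c] by (rule add_right_mono)
  qed
  have "(\<integral>\<^sup>+S. ennreal ((F S - c)\<^sup>2) \<partial>\<mu>) = (\<integral>\<^sup>+x. (\<integral>\<^sup>+S. ennreal ((F (S(Suc L := x)) - c)\<^sup>2) \<partial>chain L x) \<partial>\<kappa>)"
    by (rule J) measurable
  also have "\<dots> \<le> (\<integral>\<^sup>+x. poincare_const * of_nat (L\<^sup>2) * A x + ennreal ((g x - c)\<^sup>2) \<partial>\<kappa>)"
    by (rule nn_integral_mono, rule inner) (simp add: \<kappa>_def)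
  also have "\<dots> = poincare_const * of_nat (L\<^sup>2) * (\<integral>\<^sup>+x. A x \<partial>\<kappa>) + ?V"
    by (subst nn_integral_add, measurable, subst nn_integral_cmult) measurable
  also have "(\<integral>\<^sup>+x. A x \<partial>\<kappa>) = (\<Sum>j=1..L. E j)"
  proof -
    have "(\<integral>\<^sup>+x. A x \<partial>\<kappa>) = (\<integral>\<^sup>+S. (\<Sum>j=1..L. \<Delta> j S) \<partial>\<mu>)" unfolding A_def by (rule J[OF D', symmetric])
    also have "\<dots> = (\<Sum>j=1..L. E j)"
      unfolding E_def using \<Delta> by (intro nn_integral_sum) (simp add: \<mu>_def measurable_cong_sets[OF sets_joint refl])
    finally show ?thesis .
  qed
  \<comment> \<open>Enlarging the sum over \<open>L\<close> spins to \<open>Suc L\<close> spins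
    gives both terms a common factor.\<close>
  also have "poincare_const * of_nat (L\<^sup>2) * (\<Sum>j=1..L. E j) + ?V \<le>
    poincare_const * of_nat (L\<^sup>2) * ?S + poincare_const * (of_nat (Suc L) * ?S)"
    by (intro add_mono mult_left_mono var_g sum_mono2) auto
  also have "\<dots> = poincare_const * of_nat (L\<^sup>2 + Suc L) * ?S"
    by (simp only: of_nat_add distrib_left distrib_right mult.assoc)
  also have "\<dots> \<le> poincare_const * of_nat ((Suc L)\<^sup>2) * ?S"
    by (intro mult_right_mono mult_left_mono of_nat_mono) (auto simp: power2_eq_square)
  finally show ?thesis unfolding E_def by blast
qed

text \<open>The centre \<open>c\<close> is left existential, so that the induction need not keep
  track of means.\<close>

lemma chain_poincare:
  fixes F :: "'n config \<Rightarrow> real"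
  assumes "norm p = 1" "F \<in> borel_measurable (cfg L)" "\<And>S. S \<in> spin_configs L \<Longrightarrow> \<bar>F S\<bar> \<le> B"
    "\<And>j. j \<in> {1..L} \<Longrightarrow> \<Delta> j \<in> borel_measurable (cfg L)" "path_bound L F \<Delta>"
  shows "\<exists>c. (\<integral>\<^sup>+S. ennreal ((F S - c)\<^sup>2) \<partial>chain L p) \<le>
         poincare_const * of_nat (L\<^sup>2) * (\<Sum>j=1..L. \<integral>\<^sup>+S. \<Delta> j S \<partial>chain L p)"
  using assms
proof (induction L arbitrary: p F \<Delta>)
  \<comment> \<open>Without spins there is a single configuration, the function that is
    \<open>undefined\<close> everywhere, and nothing fluctuates.\<close>
  case 0
  have "(\<integral>\<^sup>+S. ennreal ((F S - F (\<lambda>_. undefined))\<^sup>2) \<partial>chain 0 p) = (\<integral>\<^sup>+S. 0 \<partial>chain 0 p)"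
    by (rule nn_integral_cong) (simp add: spin_configs_def)
  thus ?case by (intro exI[of _ "F (\<lambda>_. undefined)"]) simp
next
  case (Suc L)
  have "W p = (\<lambda>x. w (x \<bullet> p))" by (rule ext) (rule W)
  hence eq: "chain (Suc L) p = joint (\<lambda>x. w (x \<bullet> p)) L" by (simp only: chain_Suc)
  show ?case
    unfolding eq
  proof (rule joint_poincare_step[OF Suc.IH])
    show "(\<integral>\<^sup>+x. ennreal (w (x \<bullet> p)) \<partial>surf) = 1" using W_mass[OF Suc.prems(1)] by (simp add: W)
  qed (use Suc.prems mono_w w_nonneg w_le in auto)
qed

end

section \<open>Smooth functions of spin configurations\<close>

lemma topology_eq_id:
  assumes "topspace X = topspace Y" "continuous_map X Y (\<lambda>x. x)" "continuous_map Y X (\<lambda>x. x)"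
  shows "X = Y"
proof (rule topology_eq[THEN iffD2], intro allI iffI)
  fix S
  { assume S: "openin X S"
    have "openin Y {x \<in> topspace Y. x \<in> S}" using assms(3) S by (simp add: openin_continuous_map_preimage)
    moreover have "{x \<in> topspace Y. x \<in> S} = S" using openin_subset[OF S] assms(1) by auto
    ultimately show "openin Y S" by simp }
  { assume S: "openin Y S"
    have "openin X {x \<in> topspace X. x \<in> S}" using assms(2) S by (simp add: openin_continuous_map_preimage)
    moreover have "{x \<in> topspace X. x \<in> S} = S" using openin_subset[OF S] assms(1) by auto
    ultimately show "openin X S" by simp }
qed

abbreviation configs :: "nat \<Rightarrow> ('n::finite) config set" where
  "configs L \<equiv> PiE {1..L} (\<lambda>_. UNIV)"

text \<open>Configurations are functions on all naturals, frozen outside \<open>{1..L}\<close>, so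
  the finite product carries the subspace topology of the full one. This opens the way to
  \<open>continuous_on\<close> and \<open>compact\<close>.\<close>

lemma euclidean_configs_eq: "euclidean_configs L = top_of_set (configs L :: ('n::finite) config set)"
proof (rule topology_eq_id)
  let ?C = "configs L :: 'n config set"
  show "topspace (euclidean_configs L) = topspace (top_of_set ?C)"
    by (simp add: euclidean_configs_def)
  show "continuous_map (euclidean_configs L) (top_of_set ?C) (\<lambda>x. x)"
    unfolding continuous_map_in_subtopology euclidean_product_topology[symmetric] continuous_map_componentwise_UNIV
  proof (intro conjI allI)
    show "continuous_map (euclidean_configs L) euclidean (\<lambda>x :: 'n config. x i)" for i
    proof (cases "i \<in> {1..L}")
      case True
      thus ?thesis unfolding euclidean_configs_def by (rule continuous_map_product_projection)
    next
      case False
      have "continuous_map (euclidean_configs L) euclidean (\<lambda>x :: 'n config. undefined :: real^'n)" by simp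
      thus ?thesis
        by (rule continuous_map_eq) (use False in \<open>auto simp: euclidean_configs_def PiE_def extensional_def\<close>)
    qed
  qed (auto simp: euclidean_configs_def)
  show "continuous_map (top_of_set ?C) (euclidean_configs L) (\<lambda>x. x)"
    unfolding euclidean_configs_def continuous_map_componentwise
    by (auto simp: PiE_def intro!: continuous_on_subset[OF continuous_on_product_coordinates])
qed

lemma openin_configs_ball:
  assumes U: "openin (euclidean_configs L) U" and x: "x \<in> U"
  obtains d where "d > 0" "\<And>y. y \<in> configs L \<Longrightarrow> (\<And>i. i \<in> {1..L} \<Longrightarrow> dist (y i) (x i) < d) \<Longrightarrow> y \<in> (U :: ('n::finite) config set)"
proof -
  obtain V where V: "\<And>i. i \<in> {1..L} \<Longrightarrow> open (V i)" "x \<in> PiE {1..L} V" "PiE {1..L} V \<subseteq> U"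
    using U x unfolding euclidean_configs_def openin_product_topology_alt by (auto simp: Ball_def) metis
  have "\<forall>i\<in>{1..L}. \<exists>e>0. ball (x i) e \<subseteq> V i"
    using V(1,2) by (auto simp: PiE_def Pi_def open_contains_ball)
  then obtain e where e: "\<And>i. i \<in> {1..L} \<Longrightarrow> e i > 0 \<and> ball (x i) (e i) \<subseteq> V i" by metis
  \<comment> \<open>The inserted 1 keeps the minimum meaningful for \<open>L = 0\<close>.\<close>
  define d where "d = Min (insert 1 (e ` {1..L}))"
  have d0: "d > 0" using e by (auto simp: d_def)
  have de: "d \<le> e i" if "i \<in> {1..L}" for i unfolding d_def using that by (intro Min_le) auto
  show ?thesis
  proof (rule that[OF d0])
    fix y assume y: "y \<in> configs L" "\<And>i. i \<in> {1..L} \<Longrightarrow> dist (y i) (x i) < d"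
    have "y i \<in> V i" if "i \<in> {1..L}" for i
      using e[OF that] de[OF that] y(2)[OF that] by (auto simp: dist_commute subset_iff)
    thus "y \<in> U" using y(1) V(3) by (auto simp: PiE_def Pi_def)
  qed
qed

lemma continuous_configs_ball:
  fixes G :: "('n::finite) config \<Rightarrow> real"
  assumes U: "openin (euclidean_configs L) U" and G: "continuous_on U G" and x: "x \<in> U" and "e > 0"
  obtains d where "d > 0" "\<And>y. y \<in> configs L \<Longrightarrow> (\<And>i. i \<in> {1..L} \<Longrightarrow> dist (y i) (x i) < d) \<Longrightarrow> y \<in> U \<and> \<bar>G y - G x\<bar> < e"
proof -
  have "openin (top_of_set U) (U \<inter> G -` ball (G x) e)"
    using G by (rule continuous_openin_preimage_gen) simp
  hence "openin (euclidean_configs L) (U \<inter> G -` ball (G x) e)"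
    using U unfolding euclidean_configs_eq by (rule openin_trans)
  moreover have "x \<in> U \<inter> G -` ball (G x) e" using x \<open>e > 0\<close> by simp
  ultimately obtain d where "d > 0" "\<And>y. y \<in> configs L \<Longrightarrow> (\<And>i. i \<in> {1..L} \<Longrightarrow> dist (y i) (x i) < d) \<Longrightarrow> y \<in> U \<inter> G -` ball (G x) e"
    by (rule openin_configs_ball) blast
  thus ?thesis by (intro that[of d]) (auto simp: dist_real_def abs_minus_commute)
qed

section \<open>Differentiability of local extensions\<close>

definition displace :: "nat \<Rightarrow> ('n::finite) config \<Rightarrow> (nat \<Rightarrow> real ^ 'n) \<Rightarrow> 'n config" where
  "displace L x h = (\<lambda>i. if i \<in> {1..L} then x i + h i else x i)"

lemma displace_configs: "x \<in> configs L \<Longrightarrow> displace L x h \<in> configs L"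
  by (auto simp: displace_def PiE_def extensional_def)

text \<open>Changing the coordinates one at a time reduces differentiability to the mean value theorem.\<close>

lemma C1_differentiable:
  fixes F :: "('n::finite) config \<Rightarrow> real"
  assumes U: "openin (euclidean_configs L) U" and x: "x \<in> U"
    and G: "\<And>i j y. i \<in> {1..L} \<Longrightarrow> y \<in> U \<Longrightarrow>
        ((\<lambda>t. F (y(i := y i + t *\<^sub>R axis j 1))) has_real_derivative G i j y) (at 0)"
    and cont: "\<And>i j. i \<in> {1..L} \<Longrightarrow> continuous_on U (G i j)" and e: "e > 0"
  obtains d where "d > 0" "\<And>h. (\<And>i. i \<in> {1..L} \<Longrightarrow> norm (h i) < d) \<Longrightarrow>
     \<bar>F (displace L x h) - F x - (\<Sum>i=1..L. (\<chi> j. G i j x) \<bullet> h i)\<bar> \<le> e * (\<Sum>i=1..L. norm (h i))"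
proof -
  define N where "N = real CARD('n)"
  have N: "N > 0" by (simp add: N_def)
  \<comment> \<open>The coordinatewise errors add up to absolute values of coordinates, whose sum
    exceeds the norms by at most a factor \<open>N\<close>.\<close>
  define e' where "e' = e / N"
  have e': "e' > 0" using e N by (simp add: e'_def)
  define I where "I = {1..L} \<times> (UNIV :: 'n set)"
  have finI: "finite I" by (simp add: I_def)
  have xc: "x \<in> configs L" using openin_subset[OF U] x by (auto simp: euclidean_configs_def)
  obtain d0 where d0: "d0 > 0" "\<And>y. y \<in> configs L \<Longrightarrow> (\<And>i. i \<in> {1..L} \<Longrightarrow> dist (y i) (x i) < d0) \<Longrightarrow> y \<in> U"
    using openin_configs_ball[OF U x] by blast
  have "\<forall>k\<in>I. \<exists>d>0. \<forall>y. y \<in> configs L \<longrightarrow> (\<forall>i\<in>{1..L}. dist (y i) (x i) < d) \<longrightarrow> \<bar>G (fst k) (snd k) y - G (fst k) (snd k) x\<bar> < e'"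
  proof
    fix k assume "k \<in> I"
    hence k: "fst k \<in> {1..L}" by (auto simp: I_def)
    show "\<exists>d>0. \<forall>y. y \<in> configs L \<longrightarrow> (\<forall>i\<in>{1..L}. dist (y i) (x i) < d) \<longrightarrow> \<bar>G (fst k) (snd k) y - G (fst k) (snd k) x\<bar> < e'"
      using continuous_configs_ball[OF U cont[OF k, of "snd k"] x e'] by metis
  qed
  then obtain dk where dk: "\<And>k. k \<in> I \<Longrightarrow> dk k > 0"
    "\<And>k y. k \<in> I \<Longrightarrow> y \<in> configs L \<Longrightarrow> (\<And>i. i \<in> {1..L} \<Longrightarrow> dist (y i) (x i) < dk k) \<Longrightarrow> \<bar>G (fst k) (snd k) y - G (fst k) (snd k) x\<bar> < e'"
    unfolding bchoice_iff by metis
  define d where "d = Min (insert d0 (dk ` I))"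
  have d: "d > 0" "d \<le> d0" "\<And>k. k \<in> I \<Longrightarrow> d \<le> dk k" using d0 dk finI by (auto simp: d_def)
  show ?thesis
  proof (rule that[OF d(1)])
    fix h :: "nat \<Rightarrow> real^'n" assume h: "\<And>i. i \<in> {1..L} \<Longrightarrow> norm (h i) < d"
    let ?g = "\<lambda>k. G (fst k) (snd k) x * h (fst k) $ snd k" and ?a = "\<lambda>k. \<bar>h (fst k) $ snd k\<bar>"
    \<comment> \<open>The increment restricted to the coordinates in \<open>J\<close>; the induction
      over \<open>J\<close> switches on one coordinate at a time.\<close>
    define hJ where "hJ J i = (\<chi> j. if (i, j) \<in> J then h i $ j else 0)" for J i
    have near: "y \<in> U \<and> (\<forall>i j. i \<in> {1..L} \<longrightarrow> \<bar>G i j y - G i j x\<bar> \<le> e')"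
      if "y \<in> configs L" "\<And>i. i \<in> {1..L} \<Longrightarrow> dist (y i) (x i) < d" for y
    proof (intro conjI allI impI)
      show "y \<in> U"
      proof (rule d0(2)[OF that(1)])
        show "dist (y i) (x i) < d0" if "i \<in> {1..L}" for i using \<open>\<And>i. i \<in> {1..L} \<Longrightarrow> dist (y i) (x i) < d\<close>[OF that] d(2) by linarith
      qed
      fix i j assume "i \<in> {1..L}"
      hence k: "(i, j) \<in> I" by (simp add: I_def)
      have "\<bar>G (fst (i, j)) (snd (i, j)) y - G (fst (i, j)) (snd (i, j)) x\<bar> < e'"
      proof (rule dk(2)[OF k that(1)])
        show "dist (y i') (x i') < dk (i, j)" if "i' \<in> {1..L}" for i'
          using \<open>\<And>i. i \<in> {1..L} \<Longrightarrow> dist (y i) (x i) < d\<close>[OF that] d(3)[OF k] by linarith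
      qed
      thus "\<bar>G i j y - G i j x\<bar> \<le> e'" by simp
    qed
    have "\<bar>F (displace L x (hJ J)) - F x - (\<Sum>k\<in>J. ?g k)\<bar> \<le> e' * (\<Sum>k\<in>J. ?a k)"
      if "J \<subseteq> I" for J
      using finite_subset[OF that finI] that
    proof (induction J rule: finite_induct)
      case empty
      have "displace L x (hJ {}) = x" by (auto simp: displace_def hJ_def fun_eq_iff zero_vec_def[symmetric])
      thus ?case by simp
    next
      case (insert k J)
      obtain i j where k: "k = (i, j)" by (cases k)
      have i: "i \<in> {1..L}" using insert.prems k by (auto simp: I_def)
      define z where "z = displace L x (hJ J)"
      let ?z = "\<lambda>t. z(i := z i + t *\<^sub>R axis j 1)"
      define \<phi> where "\<phi> t = F (?z t)" for t
      define t0 where "t0 = h i $ j"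
      have pts: "?z t \<in> U \<and> (\<forall>i' j'. i' \<in> {1..L} \<longrightarrow> \<bar>G i' j' (?z t) - G i' j' x\<bar> \<le> e')"
        if t: "\<bar>t\<bar> \<le> \<bar>t0\<bar>" for t
      proof -
        have zc: "?z t \<in> configs L"
          using displace_configs[OF xc, of "hJ J"] i by (auto simp: z_def PiE_def extensional_def)
        have "dist ((?z t) i') (x i') < d" if i': "i' \<in> {1..L}" for i'
        proof -
          have "norm ((?z t) i' - x i') \<le> norm (h i')"
          proof (rule norm_le_componentwise_cart)
            fix j'
            \<comment> \<open>The coordinate in motion is not yet in \<open>J\<close>, so it still
              starts from its value at \<open>x\<close>, and every intermediate point is
              componentwise at most as far from \<open>x\<close> as the full displacement.\<close>
            have "(i, j) \<notin> J" using insert.hyps k by simp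
            thus "norm (((?z t) i' - x i') $ j') \<le> norm (h i' $ j')"
              using t i' by (auto simp: z_def displace_def hJ_def t0_def axis_def)
          qed
          thus ?thesis using h[OF i'] by (simp add: dist_norm)
        qed
        hence "?z t \<in> U \<and>
          (\<forall>i' j'. i' \<in> {1..L} \<longrightarrow> \<bar>G i' j' (?z t) - G i' j' x\<bar> \<le> e')"
          by (rule near[OF zc])
        thus ?thesis .
      qed
      have der: "(\<phi> has_real_derivative G i j (?z t)) (at t)" if "\<bar>t\<bar> \<le> \<bar>t0\<bar>" for t
      proof -
        have "((\<lambda>s. \<phi> (s + t)) has_real_derivative G i j (?z t)) (at 0)"
          using G[OF i conjunct1[OF pts[OF that]], of j] by (simp add: \<phi>_def scaleR_add_left add_ac)
        thus ?thesis using DERIV_shift[of \<phi> _ 0 t] by simp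
      qed
      have "norm ((\<phi> t0 - G i j x * t0) - (\<phi> 0 - G i j x * 0)) \<le> e' * norm (t0 - 0)"
      proof (rule field_differentiable_bound[where S = "{-\<bar>t0\<bar>..\<bar>t0\<bar>}" and f' = "\<lambda>t. G i j (?z t) - G i j x"])
        fix t assume "t \<in> {-\<bar>t0\<bar>..\<bar>t0\<bar>}"
        hence t: "\<bar>t\<bar> \<le> \<bar>t0\<bar>" by auto
        show "((\<lambda>t. \<phi> t - G i j x * t) has_field_derivative G i j (?z t) - G i j x) (at t within {- \<bar>t0\<bar>..\<bar>t0\<bar>})"
          using has_field_derivative_at_within[OF der[OF t]] by (auto intro!: derivative_eq_intros)
        show "norm (G i j (?z t) - G i j x) \<le> e'" using pts[OF t] i by simp
      qed auto
      hence step: "\<bar>\<phi> t0 - \<phi> 0 - G i j x * t0\<bar> \<le> e' * \<bar>t0\<bar>" by (simp add: algebra_simps)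
      have "displace L x (hJ (insert k J)) = z(i := z i + t0 *\<^sub>R axis j 1)"
        using i insert.hyps by (auto simp: displace_def z_def hJ_def fun_eq_iff vec_eq_iff t0_def k axis_def)
      hence "F (displace L x (hJ (insert k J))) = \<phi> t0" by (simp add: \<phi>_def)
      moreover have "F (displace L x (hJ J)) = \<phi> 0" by (simp add: \<phi>_def z_def)
      ultimately show ?case using step insert.IH insert.prems insert.hyps
        by (simp add: k t0_def[symmetric] distrib_left)
    qed
    from this[of I] have *: "\<bar>F (displace L x (hJ I)) - F x - (\<Sum>k\<in>I. ?g k)\<bar> \<le> e' * (\<Sum>k\<in>I. ?a k)"
      by simp
    have eq1: "displace L x (hJ I) = displace L x h"
      by (auto simp: displace_def hJ_def I_def fun_eq_iff vec_eq_iff)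
    have eq2: "(\<Sum>k\<in>I. ?g k) = (\<Sum>i=1..L. (\<chi> j. G i j x) \<bullet> h i)"
      by (simp add: I_def sum.cartesian_product[symmetric] case_prod_unfold inner_vec_def sum.cartesian_product)
    have le: "e' * (\<Sum>k\<in>I. ?a k) \<le> e * (\<Sum>i=1..L. norm (h i))"
    proof -
      have "(\<Sum>k\<in>I. ?a k) \<le> (\<Sum>k\<in>I. norm (h (fst k)))"
        by (intro sum_mono component_le_norm_cart)
      also have "\<dots> = N * (\<Sum>i=1..L. norm (h i))"
      proof -
        have "(\<Sum>k\<in>I. norm (h (fst k))) = (\<Sum>i=1..L. \<Sum>j\<in>(UNIV :: 'n set). norm (h i))"
          by (simp only: I_def sum.cartesian_product case_prod_unfold)
        thus ?thesis by (simp add: N_def sum_distrib_left)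
      qed
      finally have "e' * (\<Sum>k\<in>I. ?a k) \<le> e' * (N * (\<Sum>i=1..L. norm (h i)))"
        using e' by (intro mult_left_mono) auto
      also have "\<dots> = e * (\<Sum>i=1..L. norm (h i))" using N by (simp add: e'_def)
      finally show ?thesis .
    qed
    show "\<bar>F (displace L x h) - F x - (\<Sum>i=1..L. (\<chi> j. G i j x) \<bullet> h i)\<bar> \<le> e * (\<Sum>i=1..L. norm (h i))"
      using *[unfolded eq1 eq2] le by (rule order_trans)
  qed
qed

section \<open>Derivatives and gradients on the product of spheres\<close>

text \<open>Frechet differentiability relative to the product of spheres, with the sum of the spin
  distances as norm. At a point of the product it determines \<open>V\<close> only up to components
  normal to the spheres.\<close>

definition spin_derivative :: "nat \<Rightarrow> (('n::finite) config \<Rightarrow> real) \<Rightarrow> 'n config \<Rightarrow> (nat \<Rightarrow> real ^ 'n) \<Rightarrow> bool" where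
  "spin_derivative L f x V \<longleftrightarrow> (\<forall>e>0. \<exists>d>0. \<forall>S\<in>spin_configs L. (\<forall>i\<in>{1..L}. norm (S i - x i) < d) \<longrightarrow>
     \<bar>f S - f x - (\<Sum>i=1..L. V i \<bullet> (S i - x i))\<bar> \<le> e * (\<Sum>i=1..L. norm (S i - x i)))"

lemma spin_derivativeE:
  assumes "spin_derivative L f x V" "e > 0"
  obtains d where "d > 0" "\<And>S. S \<in> spin_configs L \<Longrightarrow> (\<And>i. i \<in> {1..L} \<Longrightarrow> norm (S i - x i) < d) \<Longrightarrow>
     \<bar>f S - f x - (\<Sum>i=1..L. V i \<bullet> (S i - x i))\<bar> \<le> e * (\<Sum>i=1..L. norm (S i - x i))"
proof -
  from assms(1)[unfolded spin_derivative_def, THEN spec, THEN mp, OF assms(2)]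
  obtain d where d: "d > 0" "\<forall>S\<in>spin_configs L. (\<forall>i\<in>{1..L}. norm (S i - x i) < d) \<longrightarrow>
     \<bar>f S - f x - (\<Sum>i=1..L. V i \<bullet> (S i - x i))\<bar> \<le> e * (\<Sum>i=1..L. norm (S i - x i))" by (elim exE conjE)
  show thesis
    by (rule that[OF d(1)], rule d(2)[THEN bspec, THEN mp], assumption, rule ballI)
qed

lemma spin_configs_subset: "spin_configs L \<subseteq> configs L"
  by (auto simp: spin_configs_def)

text \<open>Here \<open>V\<close> is the ambient gradient of a local extension. It is continuous but
  in general not tangential; the normal part is removed in \<open>spin_gradient_eq\<close>.\<close>

lemma smooth_local:
  fixes f :: "('n::finite) config \<Rightarrow> real"
  assumes "smooth L f" "S \<in> spin_configs L"
  obtains U F V where "openin (euclidean_configs L) U" "S \<in> U" "continuous_on U F"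
    "\<And>x. x \<in> U \<inter> spin_configs L \<Longrightarrow> F x = f x"
    "\<And>i. i \<in> {1..L} \<Longrightarrow> continuous_on U (\<lambda>x. V x i :: real ^ 'n)"
    "\<And>x. x \<in> U \<inter> spin_configs L \<Longrightarrow> spin_derivative L f x (V x)"
proof -
  obtain U F where U: "openin (euclidean_configs L) U" "S \<in> U" and C: "\<And>k. C_on k L U F"
    and F: "\<And>x. x \<in> U \<inter> spin_configs L \<Longrightarrow> F x = f x"
    using assms unfolding smooth_def by metis
  have sub: "subtopology (euclidean_configs L) U = top_of_set U"
    using openin_subset[OF U(1)] unfolding euclidean_configs_eq
    by (simp add: subtopology_subtopology Int_absorb1)
  have cF: "continuous_on U F" using C[of 0] by (simp add: sub)
  have "\<forall>i\<in>{1..L}. \<forall>j. \<exists>G. (\<forall>x\<in>U. ((\<lambda>t. F (x(i := x i + t *\<^sub>R axis j 1))) has_real_derivative G x) (at 0)) \<and> continuous_on U G"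
    using C[of "Suc 0"] by (simp add: sub)
  then obtain G where G: "\<And>i j y. i \<in> {1..L} \<Longrightarrow> y \<in> U \<Longrightarrow> ((\<lambda>t. F (y(i := y i + t *\<^sub>R axis j 1))) has_real_derivative G i j y) (at 0)"
    and cG: "\<And>i j. i \<in> {1..L} \<Longrightarrow> continuous_on U (G i j)"
    by metis
  show ?thesis
  proof (rule that[OF U cF F, of "\<lambda>x i. \<chi> j. G i j x"])
    show "continuous_on U (\<lambda>x. \<chi> j. G i j x)" if "i \<in> {1..L}" for i
      using cG[OF that] by (intro continuous_on_vec_lambda) auto
    fix x assume x: "x \<in> U \<inter> spin_configs L"
    hence xU: "x \<in> U" and xs: "x \<in> spin_configs L" by auto
    show "spin_derivative L f x (\<lambda>i. \<chi> j. G i j x)"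
      unfolding spin_derivative_def
    proof (intro allI impI)
      fix e :: real assume "e > 0"
      obtain d1 where d1: "d1 > 0" "\<And>h. (\<And>i. i \<in> {1..L} \<Longrightarrow> norm (h i) < d1) \<Longrightarrow>
         \<bar>F (displace L x h) - F x - (\<Sum>i=1..L. (\<chi> j. G i j x) \<bullet> h i)\<bar> \<le> e * (\<Sum>i=1..L. norm (h i))"
        using C1_differentiable[OF U(1) xU G cG \<open>e > 0\<close>] by blast
      obtain d2 where d2: "d2 > 0" "\<And>y. y \<in> configs L \<Longrightarrow> (\<And>i. i \<in> {1..L} \<Longrightarrow> dist (y i) (x i) < d2) \<Longrightarrow> y \<in> U"
        using openin_configs_ball[OF U(1) xU] by blast
      show "\<exists>d>0. \<forall>S\<in>spin_configs L. (\<forall>i\<in>{1..L}. norm (S i - x i) < d) \<longrightarrow>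
         \<bar>f S - f x - (\<Sum>i=1..L. (\<chi> j. G i j x) \<bullet> (S i - x i))\<bar> \<le> e * (\<Sum>i=1..L. norm (S i - x i))"
      proof (intro exI[of _ "min d1 d2"] conjI ballI impI)
        fix S assume S: "S \<in> spin_configs L" and near: "\<forall>i\<in>{1..L}. norm (S i - x i) < min d1 d2"
        have "displace L x (\<lambda>i. S i - x i) = S"
          using S xs by (auto simp: displace_def spin_configs_def PiE_def extensional_def fun_eq_iff)
        moreover have "S \<in> U"
          using S spin_configs_subset near by (intro d2(2)) (auto simp: dist_norm)
        ultimately show "\<bar>f S - f x - (\<Sum>i=1..L. (\<chi> j. G i j x) \<bullet> (S i - x i))\<bar> \<le> e * (\<Sum>i=1..L. norm (S i - x i))"
          using d1(2)[of "\<lambda>i. S i - x i"] near F[of S] F[OF x] S by auto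
      qed (use d1 d2 in auto)
    qed
  qed
qed

text \<open>With the linear part subtracted, the remainder \<open>R\<close> is of smaller order than
  the displacement of the spins, which is at most linear in time; so \<open>R\<close> has derivative
  0.\<close>

lemma spin_derivative_curve:
  fixes c :: "real \<Rightarrow> ('n::finite) config"
  assumes f: "spin_derivative L f (c t0) V" and c: "\<And>t. c t \<in> spin_configs L"
    and d: "\<And>i. i \<in> {1..L} \<Longrightarrow> ((\<lambda>t. c t i) has_vector_derivative c' i) (at t0)"
  shows "((\<lambda>t. f (c t)) has_real_derivative (\<Sum>i=1..L. V i \<bullet> c' i)) (at t0)"
proof -
  define R where "R t = f (c t) - (\<Sum>i=1..L. V i \<bullet> c t i)" for t
  define K where "K = (\<Sum>i=1..L. norm (c' i) + 1)"
  have K: "K \<ge> 0" by (auto simp: K_def intro!: sum_nonneg add_nonneg_nonneg)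
  have Ki: "norm (c' i) + 1 \<le> K" if "i \<in> {1..L}" for i
    unfolding K_def using that by (intro member_le_sum) auto
  have "\<forall>i\<in>{1..L}. \<exists>d>0. \<forall>t. \<bar>t - t0\<bar> < d \<longrightarrow> norm (c t i - c t0 i) \<le> (norm (c' i) + 1) * \<bar>t - t0\<bar>"
  proof
    fix i assume i: "i \<in> {1..L}"
    have "((\<lambda>t. c t i) has_derivative (\<lambda>s. s *\<^sub>R c' i)) (at t0)" using d[OF i] by (simp add: has_vector_derivative_def)
    then obtain e where e: "e > 0" "\<And>t. \<bar>t - t0\<bar> < e \<Longrightarrow> norm (c t i - c t0 i - (t - t0) *\<^sub>R c' i) \<le> 1 * \<bar>t - t0\<bar>"
      unfolding has_derivative_at_alt real_norm_def using zero_less_one by metis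
    have "norm (c t i - c t0 i) \<le> (norm (c' i) + 1) * \<bar>t - t0\<bar>" if "\<bar>t - t0\<bar> < e" for t
    proof -
      have "norm (c t i - c t0 i) \<le> norm ((t - t0) *\<^sub>R c' i) + norm (c t i - c t0 i - (t - t0) *\<^sub>R c' i)"
        by (rule norm_triangle_sub)
      also have "\<dots> \<le> \<bar>t - t0\<bar> * norm (c' i) + 1 * \<bar>t - t0\<bar>"
        using e(2)[OF that] by (intro add_mono) auto
      finally show ?thesis by (simp add: algebra_simps)
    qed
    thus "\<exists>d>0. \<forall>t. \<bar>t - t0\<bar> < d \<longrightarrow> norm (c t i - c t0 i) \<le> (norm (c' i) + 1) * \<bar>t - t0\<bar>" using e(1) by blast
  qed
  then obtain di where di: "\<And>i. i \<in> {1..L} \<Longrightarrow> di i > 0"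
    "\<And>i t. i \<in> {1..L} \<Longrightarrow> \<bar>t - t0\<bar> < di i \<Longrightarrow> norm (c t i - c t0 i) \<le> (norm (c' i) + 1) * \<bar>t - t0\<bar>" by metis
  define d0 where "d0 = Min (insert 1 (di ` {1..L}))"
  have d0: "d0 > 0" using di by (auto simp: d0_def)
  have d0i: "d0 \<le> di i" if "i \<in> {1..L}" for i unfolding d0_def using that by (intro Min_le) auto
  have "(R has_derivative (\<lambda>_. 0)) (at t0)"
    unfolding has_derivative_at_alt
  proof (intro conjI allI impI)
    fix e :: real assume e: "e > 0"
    define e1 where "e1 = e / (K + 1)"
    have e1: "e1 > 0" using e K by (simp add: e1_def)
    obtain d1 where d1: "d1 > 0" "\<And>S. S \<in> spin_configs L \<Longrightarrow> (\<And>i. i \<in> {1..L} \<Longrightarrow> norm (S i - c t0 i) < d1) \<Longrightarrow>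
      \<bar>f S - f (c t0) - (\<Sum>i=1..L. V i \<bullet> (S i - c t0 i))\<bar> \<le> e1 * (\<Sum>i=1..L. norm (S i - c t0 i))"
      by (rule spin_derivativeE[OF f e1]) blast
    show "\<exists>d>0. \<forall>t. norm (t - t0) < d \<longrightarrow> norm (R t - R t0 - 0) \<le> e * norm (t - t0)"
    proof (intro exI[of _ "min d0 (d1 / (K + 1))"] conjI allI impI)
      fix t assume t: "norm (t - t0) < min d0 (d1 / (K + 1))"
      have inc: "norm (c t i - c t0 i) \<le> (norm (c' i) + 1) * \<bar>t - t0\<bar>" if "i \<in> {1..L}" for i
        using t d0i[OF that] by (intro di(2)[OF that]) auto
      have "norm (c t i - c t0 i) < d1" if i: "i \<in> {1..L}" for i
      proof -
        have "norm (c t i - c t0 i) \<le> (K + 1) * \<bar>t - t0\<bar>"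
          using inc[OF i] Ki[OF i] by (meson abs_ge_zero add_increasing2 mult_right_mono order_trans zero_le_one)
        also have "\<dots> < d1" using t K by (simp add: pos_less_divide_eq mult.commute)
        finally show ?thesis .
      qed
      hence "\<bar>f (c t) - f (c t0) - (\<Sum>i=1..L. V i \<bullet> (c t i - c t0 i))\<bar> \<le> e1 * (\<Sum>i=1..L. norm (c t i - c t0 i))"
        using d1(2)[OF c] by blast
      also have "\<dots> \<le> e1 * (\<Sum>i=1..L. (norm (c' i) + 1) * \<bar>t - t0\<bar>)"
        using e1 inc by (intro mult_left_mono sum_mono) auto
      also have "\<dots> = e1 * K * \<bar>t - t0\<bar>" by (simp add: K_def sum_distrib_right)
      also have "\<dots> \<le> e * \<bar>t - t0\<bar>"
      proof (rule mult_right_mono)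
        show "e1 * K \<le> e" using e K by (simp add: e1_def field_simps)
      qed simp
      finally show "norm (R t - R t0 - 0) \<le> e * norm (t - t0)"
        by (simp add: R_def inner_diff_right sum_subtractf algebra_simps)
    qed (use d0 d1 K in auto)
  qed simp
  moreover have "(*) (0::real) = (\<lambda>_. 0)" by auto
  ultimately have "(R has_real_derivative 0) (at t0)" by (simp only: has_field_derivative_def)
  moreover have "((\<lambda>t. \<Sum>i=1..L. V i \<bullet> c t i) has_real_derivative (\<Sum>i=1..L. V i \<bullet> c' i)) (at t0)"
  proof (rule DERIV_sum)
    fix i assume "i \<in> {1..L}"
    from has_derivative_inner_right[OF d[OF this, unfolded has_vector_derivative_def], of "V i"]
    show "((\<lambda>t. V i \<bullet> c t i) has_real_derivative V i \<bullet> c' i) (at t0)"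
      by (simp add: has_field_derivative_def mult.commute[of _ "V i \<bullet> c' i"] mult_commute_abs)
  qed
  ultimately have "((\<lambda>t. R t + (\<Sum>i=1..L. V i \<bullet> c t i)) has_real_derivative 0 + (\<Sum>i=1..L. V i \<bullet> c' i)) (at t0)"
    by (rule DERIV_add)
  thus ?thesis by (simp add: R_def)
qed

lemma circ_has_vector_derivative:
  "((circ u v) has_vector_derivative (cos \<theta> *\<^sub>R v - sin \<theta> *\<^sub>R u)) (at \<theta>)"
  for u v :: "'a::real_normed_vector"
  unfolding circ_def[abs_def] by (auto intro!: derivative_eq_intros simp: has_vector_derivative_def fun_eq_iff algebra_simps)

text \<open>The normal part of \<open>V i\<close> is invisible along the sphere because
  \<open>S i \<bullet> (y - S i)\<close> equals \<open>- (norm (y - S i))\<^sup>2 / 2\<close>, a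
  second order quantity. Two tangent representatives would be told apart by the great circle that
  leaves \<open>S i\<close> in the direction of their difference.\<close>

lemma spin_gradient_eq:
  fixes S :: "('n::finite) config"
  assumes f: "spin_derivative L f S V" and S: "S \<in> spin_configs L" and i: "i \<in> {1..L}"
  shows "spin_gradient i f S = V i - (V i \<bullet> S i) *\<^sub>R S i"
proof -
  define v where "v = V i - (V i \<bullet> S i) *\<^sub>R S i"
  have Si: "norm (S i) = 1" using S i by (auto simp: spin_configs_def)
  have up: "S(i := y) \<in> spin_configs L" if "norm y = 1" for y
    using that S i by (auto simp: spin_configs_def PiE_def extensional_def Pi_def)
  have vS: "v \<bullet> S i = 0" using Si by (simp add: v_def inner_diff_left norm_eq_1)
  have "((\<lambda>y. f (S(i := y))) has_derivative (\<lambda>h. v \<bullet> h)) (at (S i) within sphere 0 1)"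
    unfolding has_derivative_within_alt
  proof (intro conjI allI impI)
    show "bounded_linear ((\<bullet>) v)" by (rule bounded_linear_inner_right)
    fix e :: real assume "e > 0"
    hence "e / 2 > 0" by simp
    then obtain d where d: "d > 0" "\<And>S'. S' \<in> spin_configs L \<Longrightarrow> (\<And>j. j \<in> {1..L} \<Longrightarrow> norm (S' j - S j) < d) \<Longrightarrow>
      \<bar>f S' - f S - (\<Sum>j=1..L. V j \<bullet> (S' j - S j))\<bar> \<le> (e/2) * (\<Sum>j=1..L. norm (S' j - S j))"
      by (rule spin_derivativeE[OF f]) blast
    \<comment> \<open>Half of \<open>e\<close> pays for the remainder of \<open>f\<close>, the other
      half for the second order normal term, which the radius \<open>e / k\<close> keeps small; the
      added 1 makes \<open>k\<close> positive.\<close>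
    define k where "k = \<bar>V i \<bullet> S i\<bar> + 1"
    have k: "k > 0" by (simp add: k_def)
    show "\<exists>d>0. \<forall>y\<in>sphere 0 1. norm (y - S i) < d \<longrightarrow> norm (f (S(i := y)) - f (S(i := S i)) - v \<bullet> (y - S i)) \<le> e * norm (y - S i)"
    proof (intro exI[of _ "min d (e / k)"] conjI ballI impI)
      fix y :: "real^'n" assume "y \<in> sphere 0 1" and near: "norm (y - S i) < min d (e / k)"
      hence y: "norm y = 1" by simp
      define n where "n = norm (y - S i)"
      have sums: "(\<Sum>j=1..L. V j \<bullet> ((S(i := y)) j - S j)) = V i \<bullet> (y - S i)"
        "(\<Sum>j=1..L. norm ((S(i := y)) j - S j)) = n"
        using i by (subst sum.remove[of _ i]; auto simp: n_def)+
      have "\<bar>f (S(i := y)) - f S - V i \<bullet> (y - S i)\<bar> \<le> (e/2) * n"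
        using d(2)[OF up[OF y]] near d(1) unfolding sums by (auto simp: n_def)
      moreover have "V i \<bullet> (y - S i) - v \<bullet> (y - S i) = - (V i \<bullet> S i) * n\<^sup>2 / 2"
      proof -
        have "n\<^sup>2 = 2 - 2 * (y \<bullet> S i)" using norm_diff_unit[OF y Si] by (simp add: n_def dist_norm)
        moreover have "S i \<bullet> (y - S i) = y \<bullet> S i - 1" using Si by (simp add: inner_diff_right norm_eq_1 inner_commute)
        ultimately have "S i \<bullet> (y - S i) = - n\<^sup>2 / 2" by linarith
        moreover have "V i \<bullet> (y - S i) - v \<bullet> (y - S i) = (V i \<bullet> S i) * (S i \<bullet> (y - S i))"
          by (simp add: v_def inner_diff_left)
        ultimately show ?thesis by simp
      qed
      moreover have "\<bar>- (V i \<bullet> S i) * n\<^sup>2 / 2\<bar> \<le> (e/2) * n"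
      proof -
        have n0: "n \<ge> 0" by (simp add: n_def)
        have "\<bar>V i \<bullet> S i\<bar> * n \<le> k * n" using n0 by (intro mult_right_mono) (auto simp: k_def)
        also have "\<dots> \<le> e" using near k by (simp add: n_def pos_less_divide_eq mult.commute)
        finally have "\<bar>V i \<bullet> S i\<bar> * n * n \<le> e * n" using n0 by (rule mult_right_mono)
        thus ?thesis by (simp add: abs_mult power2_eq_square mult.assoc)
      qed
      ultimately show "norm (f (S(i := y)) - f (S(i := S i)) - v \<bullet> (y - S i)) \<le> e * norm (y - S i)"
        unfolding n_def[symmetric] real_norm_def fun_upd_triv by linarith
    qed (use d k \<open>e > 0\<close> in auto)
  qed
  note vd = this
  have uniq: "v' = v" if v': "v' \<bullet> S i = 0" and d': "((\<lambda>y. f (S(i := y))) has_derivative (\<lambda>h. v' \<bullet> h)) (at (S i) within sphere 0 1)" for v'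
  proof (rule ccontr)
    assume ne: "v' \<noteq> v"
    define u where "u = sgn (v' - v)"
    have u: "norm u = 1" "S i \<bullet> u = 0"
      using ne v' vS by (auto simp: u_def norm_sgn sgn_div_norm inner_diff_right inner_commute)
    have c0: "circ (S i) u 0 = S i" by (simp add: circ_def)
    have cs: "circ (S i) u ` UNIV \<subseteq> sphere 0 1" using norm_circ[OF Si u] by auto
    have cd: "(circ (S i) u has_derivative (\<lambda>t. t *\<^sub>R u)) (at 0)"
      using circ_has_vector_derivative[of "S i" u 0] by (simp add: has_vector_derivative_def)
    have comp: "((\<lambda>t. f (S(i := circ (S i) u t))) has_derivative (\<lambda>t. a \<bullet> (t *\<^sub>R u))) (at 0)"
      if "((\<lambda>y. f (S(i := y))) has_derivative (\<lambda>h. a \<bullet> h)) (at (S i) within sphere 0 1)" for a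
    proof (rule has_derivative_in_compose[OF cd])
      show "((\<lambda>y. f (S(i := y))) has_derivative (\<lambda>h. a \<bullet> h)) (at (circ (S i) u 0) within range (circ (S i) u))"
        unfolding c0 by (rule has_derivative_subset[OF that cs])
    qed
    have "(\<lambda>t::real. v' \<bullet> (t *\<^sub>R u)) = (\<lambda>t. v \<bullet> (t *\<^sub>R u))"
      by (rule has_derivative_unique[OF comp[OF d'] comp[OF vd]])
    from fun_cong[OF this, of 1] have "(v' - v) \<bullet> u = 0" by (simp add: inner_diff_left)
    hence "norm (v' - v) = 0" by (simp add: u_def sgn_div_norm power2_norm_eq_inner[symmetric] power2_eq_square)
    thus False using ne by simp
  qed
  show ?thesis unfolding spin_gradient_def v_def[symmetric]
    by (rule the_equality, rule conjI[OF vS vd], erule conjE, rule uniq)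
qed

lemma continuous_on_spin_configsI:
  fixes h :: "('n::finite) config \<Rightarrow> 'b::topological_space"
  assumes "\<And>S. S \<in> spin_configs L \<Longrightarrow> \<exists>U g. openin (euclidean_configs L) U \<and> S \<in> U \<and> continuous_on (U \<inter> spin_configs L) g \<and>
     (\<forall>x\<in>U \<inter> spin_configs L. g x = h x)"
  shows "continuous_on (spin_configs L) h"
  unfolding continuous_on_eq_continuous_within
proof
  fix S :: "'n config" assume S: "S \<in> spin_configs L"
  obtain U g where U: "openin (euclidean_configs L) U" "S \<in> U" "continuous_on (U \<inter> spin_configs L) g"
     "\<forall>x\<in>U \<inter> spin_configs L. g x = h x" using assms[OF S] by blast
  obtain T where T: "open T" "U = configs L \<inter> T"
    using U(1) unfolding euclidean_configs_eq openin_open by blast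
  have eq: "U \<inter> spin_configs L = T \<inter> spin_configs L" using T(2) spin_configs_subset by blast
  have "continuous_on (U \<inter> spin_configs L) h" using U(3,4) continuous_on_cong[OF refl, of "U \<inter> spin_configs L" g h] by simp
  hence "continuous (at S within T \<inter> spin_configs L) h"
    unfolding eq using S U(2) T(2) by (auto simp: continuous_on_eq_continuous_within)
  moreover have "at S within T \<inter> spin_configs L = at S within spin_configs L"
    using S U(2) T by (intro at_within_nhd[of S T]) auto
  ultimately show "continuous (at S within spin_configs L) h" by simp
qed

lemma smooth_continuous_on:
  fixes f :: "('n::finite) config \<Rightarrow> real"
  assumes "smooth L f"
  shows "continuous_on (spin_configs L) f"
proof (rule continuous_on_spin_configsI)
  fix S :: "'n config" assume "S \<in> spin_configs L"
  from smooth_local[OF assms this] obtain U F where "openin (euclidean_configs L) U" "S \<in> U" "continuous_on U F"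
    "\<And>x. x \<in> U \<inter> spin_configs L \<Longrightarrow> F x = f x" by metis
  thus "\<exists>U g. openin (euclidean_configs L) U \<and> S \<in> U \<and> continuous_on (U \<inter> spin_configs L) g \<and>
     (\<forall>x\<in>U \<inter> spin_configs L. g x = f x)"
    by (intro exI[of _ U] exI[of _ F]) (auto intro: continuous_on_subset)
qed

text \<open>Locally the gradient is the tangential projection of the gradient of one extension.
  Continuity on a compact space then gives the measurability and integrability that the Dirichlet
  form requires.\<close>

lemma smooth_gradient_continuous_on:
  fixes f :: "('n::finite) config \<Rightarrow> real"
  assumes "smooth L f" "i \<in> {1..L}"
  shows "continuous_on (spin_configs L) (spin_gradient i f)"
proof (rule continuous_on_spin_configsI)
  fix S :: "'n config" assume "S \<in> spin_configs L"
  from smooth_local[OF assms(1) this] obtain U V where U: "openin (euclidean_configs L) U" "S \<in> U"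
    and V: "\<And>i. i \<in> {1..L} \<Longrightarrow> continuous_on U (\<lambda>x. V x i)"
     "\<And>x. x \<in> U \<inter> spin_configs L \<Longrightarrow> spin_derivative L f x (V x)" by metis
  show "\<exists>U g. openin (euclidean_configs L) U \<and> S \<in> U \<and> continuous_on (U \<inter> spin_configs L) g \<and>
     (\<forall>x\<in>U \<inter> spin_configs L. g x = spin_gradient i f x)"
  proof (intro exI[of _ U] exI[of _ "\<lambda>x. V x i - (V x i \<bullet> x i) *\<^sub>R x i"] conjI ballI)
    have "continuous_on (U \<inter> spin_configs L) (\<lambda>x. V x i)" by (rule continuous_on_subset[OF V(1)[OF assms(2)]]) auto
    thus "continuous_on (U \<inter> spin_configs L) (\<lambda>x. V x i - (V x i \<bullet> x i) *\<^sub>R x i)"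
      by (intro continuous_intros) (auto intro: continuous_on_subset[OF continuous_on_product_coordinates])
    show "V x i - (V x i \<bullet> x i) *\<^sub>R x i = spin_gradient i f x" if "x \<in> U \<inter> spin_configs L" for x
      using spin_gradient_eq[OF V(2)[OF that] _ assms(2)] that by simp
  qed (use U in auto)
qed

text \<open>A tangential velocity does not see the normal part by which \<open>V\<close> differs
  from the spherical gradient.\<close>

lemma smooth_curve:
  fixes c :: "real \<Rightarrow> ('n::finite) config"
  assumes "smooth L f" and c: "\<And>t. c t \<in> spin_configs L"
    and d: "\<And>i. i \<in> {1..L} \<Longrightarrow> ((\<lambda>t. c t i) has_vector_derivative c' i) (at t0)"
    and tan: "\<And>i. i \<in> {1..L} \<Longrightarrow> c t0 i \<bullet> c' i = 0"
  shows "((\<lambda>t. f (c t)) has_real_derivative (\<Sum>i=1..L. spin_gradient i f (c t0) \<bullet> c' i)) (at t0)"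
proof -
  from smooth_local[OF assms(1) c[of t0]] obtain V where V: "spin_derivative L f (c t0) V"
    by (metis IntI c)
  have "V i \<bullet> c' i = spin_gradient i f (c t0) \<bullet> c' i" if "i \<in> {1..L}" for i
    using spin_gradient_eq[OF V c that] tan[OF that] by (simp add: inner_diff_left)
  with spin_derivative_curve[OF V c d] show ?thesis by simp
qed

section \<open>Continuous observables and the path bound\<close>

text \<open>The Borel sets of a countable product are generated by the coordinates, and those
  outside \<open>{1..L}\<close> are constantly \<open>undefined\<close>, so the inclusion into the
  full product is Borel measurable.\<close>

lemma borel_measurable_cfgI:
  fixes h :: "('n::finite) config \<Rightarrow> 'b::topological_space"
  assumes "continuous_on (spin_configs L) h"
  shows "h \<in> borel_measurable (cfg L)"
proof -
  have "(\<lambda>S. S) \<in> measurable (cfg L) (PiM UNIV (\<lambda>_. borel :: (real^'n) measure))"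
  proof (rule measurable_PiM_single')
    fix i :: nat
    show "(\<lambda>S. S i) \<in> borel_measurable (cfg L :: 'n config measure)"
    proof (cases "i \<in> {1..L}")
      case True
      show ?thesis
        by (rule measurable_compose[OF measurable_component_singleton[OF True] borel_measurable_surface_id])
    next
      case False
      have "(\<lambda>S. undefined) \<in> borel_measurable (cfg L :: 'n config measure)" by simp
      moreover have "undefined = S i" if "S \<in> space (cfg L :: 'n config measure)" for S
        using that False by (auto simp: space_PiM PiE_def extensional_def)
      ultimately show ?thesis using measurable_cong[of "cfg L" "\<lambda>S. undefined" "\<lambda>S. S i" borel] by blast
    qed
  qed (auto simp: space_PiM)
  hence id: "(\<lambda>S. S) \<in> borel_measurable (cfg L :: 'n config measure)"
    by (simp add: measurable_cong_sets[OF refl sets_PiM_equal_borel])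
  have "(\<lambda>S. S) \<in> measurable (cfg L) (restrict_space borel (spin_configs L :: 'n config set))"
    using id by (rule measurable_restrict_space2[rotated]) (auto simp: space_cfg)
  moreover have "h \<in> borel_measurable (restrict_space borel (spin_configs L))"
    by (rule borel_measurable_continuous_on_restrict[OF assms])
  ultimately show ?thesis by (rule measurable_compose)
qed

lemma compact_spin_configs: "compact (spin_configs L :: ('n::finite) config set)"
proof -
  have "compactin (euclidean_configs L) (spin_configs L :: 'n config set)"
    unfolding euclidean_configs_def spin_configs_def compactin_PiE by simp
  thus ?thesis unfolding euclidean_configs_eq by (simp add: compactin_subtopology)
qed

lemma continuous_on_spin_configs_bounded:
  fixes h :: "('n::finite) config \<Rightarrow> 'b::real_normed_vector"
  assumes "continuous_on (spin_configs L) h"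
  obtains B where "\<And>S. S \<in> spin_configs L \<Longrightarrow> norm (h S) \<le> B"
  using compact_imp_bounded[OF compact_continuous_image[OF assms compact_spin_configs]]
  by (auto simp: bounded_iff)


text \<open>The fundamental theorem of calculus, then Cauchy-Schwarz; the indicator is written twice
  in \<open>?K\<close> so that one copy can be split off as the second factor.\<close>

lemma sq_length_integral_bound:
  fixes \<phi> :: "real \<Rightarrow> real"
  assumes ab: "a \<le> b" and d: "\<And>t. (h has_real_derivative \<phi> t) (at t)" and \<phi>: "continuous_on UNIV \<phi>"
  shows "ennreal ((h b - h a)\<^sup>2) \<le> ennreal (b - a) * (\<integral>\<^sup>+t. indicator {a..b} t * ennreal ((\<phi> t)\<^sup>2) \<partial>lborel)"
proof -
  let ?k = "\<lambda>x. indicator {a..b} x * ennreal \<bar>\<phi> x\<bar>"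
  let ?K = "\<integral>\<^sup>+x. indicator {a..b} x * ?k x \<partial>lborel"
  have [measurable]: "\<phi> \<in> borel_measurable borel" using \<phi> by (rule borel_measurable_continuous_onI)
  have "has_bochner_integral lborel (\<lambda>x. indicator {a..b} x *\<^sub>R \<phi> x) (h b - h a)"
  proof (rule has_bochner_integral_FTC_Icc[OF ab])
    show "(h has_vector_derivative \<phi> x) (at x within {a..b})" for x
      using d[of x] by (simp add: has_real_derivative_iff_has_vector_derivative has_vector_derivative_at_within)
    show "continuous_on {a..b} \<phi>" using \<phi> continuous_on_subset by blast
  qed
  hence "ennreal (norm (h b - h a)) \<le> (\<integral>\<^sup>+x. ennreal (norm (indicator {a..b} x *\<^sub>R \<phi> x)) \<partial>lborel)"
    by (rule has_bochner_integral_norm_bound)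
  also have "\<dots> = ?K"
    by (intro nn_integral_cong) (auto simp: indicator_def)
  finally have "(ennreal (norm (h b - h a)))\<^sup>2 \<le> ?K\<^sup>2"
    by (rule power_mono) simp
  also have "\<dots> \<le> (\<integral>\<^sup>+x. (indicator {a..b} x)\<^sup>2 \<partial>lborel) * (\<integral>\<^sup>+x. (?k x)\<^sup>2 \<partial>lborel)"
    by (rule Cauchy_Schwarz_nn_integral) measurable
  also have "(\<integral>\<^sup>+x. (indicator {a..b} x)\<^sup>2 \<partial>lborel) = (\<integral>\<^sup>+x. indicator {a..b} x \<partial>lborel)"
    by (intro nn_integral_cong) (auto simp: indicator_def)
  also have "\<dots> = ennreal (b - a)" using ab by simp
  also have "(\<integral>\<^sup>+x. (?k x)\<^sup>2 \<partial>lborel) = (\<integral>\<^sup>+t. indicator {a..b} t * ennreal ((\<phi> t)\<^sup>2) \<partial>lborel)"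
    by (intro nn_integral_cong) (auto simp: indicator_def ennreal_power)
  finally show ?thesis by (simp add: ennreal_power)
qed

text \<open>Each rotating spin has speed at most 1, so the derivative along the path is at most a
  sum of \<open>m\<close> gradient norms. Cauchy-Schwarz for this sum gives the factor
  \<open>m\<close>, Cauchy-Schwarz in the angle the factor \<open>b - a\<close>, which is at most
  \<open>2 * pi\<close>.\<close>

lemma smooth_path_bound:
  fixes f :: "('n::finite) config \<Rightarrow> real"
  assumes f: "smooth L f"
  shows "path_bound L f (\<lambda>j S. ennreal ((norm (spin_gradient j f S))\<^sup>2))"
  unfolding path_bound_def
proof (intro allI impI)
  fix u v :: "real^'n" and m and S :: "'n config" and a b :: real
  assume uv: "norm u = 1" "norm v = 1" "u \<bullet> v = 0" and m: "m \<le> L" and S: "S \<in> spin_configs L"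
    and ab: "0 \<le> a" "a \<le> b" "b \<le> 2 * pi"
  define c where "c \<theta> = on_first m (plane_rot u v \<theta>) S" for \<theta>
  let ?n = "\<lambda>\<theta> i. norm (spin_gradient i f (c \<theta>))"
  \<comment> \<open>The infinitesimal generator of the rotation. It is skew, so velocities are
    tangent to the spheres, and Bessel's inequality bounds its norm by 1.\<close>
  define A where "A z = (z \<bullet> u) *\<^sub>R v - (z \<bullet> v) *\<^sub>R u" for z :: "real^'n"
  have R: "orthogonal_transformation (plane_rot u v \<theta>)" for \<theta> by (rule orthogonal_plane_rot[OF uv])
  have c: "c \<theta> \<in> spin_configs L" for \<theta>
    using S m by (auto simp: c_def on_first_def spin_configs_def PiE_def Pi_def extensional_def orthogonal_transformation_norm[OF R])
  have nA: "norm (A z) \<le> 1" if "norm z = 1" for z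
  proof -
    have "(norm (A z))\<^sup>2 = (z \<bullet> u)\<^sup>2 + (z \<bullet> v)\<^sup>2"
      unfolding power2_norm_eq_inner A_def using uv
      by (simp add: inner_diff_left inner_diff_right norm_eq_1 inner_commute power2_eq_square)
    also have "\<dots> \<le> (norm z)\<^sup>2"
    proof -
      have "0 \<le> (norm (z - (z \<bullet> u) *\<^sub>R u - (z \<bullet> v) *\<^sub>R v))\<^sup>2" by simp
      also have "\<dots> = (norm z)\<^sup>2 - ((z \<bullet> u)\<^sup>2 + (z \<bullet> v)\<^sup>2)"
        unfolding power2_norm_eq_inner using uv
        by (simp add: inner_diff_left inner_diff_right norm_eq_1 inner_commute power2_eq_square)
      finally show ?thesis by simp
    qed
    finally show ?thesis using that by (simp add: power_le_one_iff abs_square_le_1)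
  qed
  have dR: "((\<lambda>\<theta>. plane_rot u v \<theta> y) has_vector_derivative A (plane_rot u v \<theta> y)) (at \<theta>)" for y \<theta>
  proof -
    have "A (plane_rot u v \<theta> y) = (- sin \<theta> * (y \<bullet> u) - cos \<theta> * (y \<bullet> v)) *\<^sub>R u + (cos \<theta> * (y \<bullet> u) - sin \<theta> * (y \<bullet> v)) *\<^sub>R v"
      using uv by (simp add: A_def plane_rot_def inner_add_left inner_commute[of v u] norm_eq_1 algebra_simps)
    moreover have "((\<lambda>\<theta>. plane_rot u v \<theta> y) has_vector_derivative
       (- sin \<theta> * (y \<bullet> u) - cos \<theta> * (y \<bullet> v)) *\<^sub>R u + (cos \<theta> * (y \<bullet> u) - sin \<theta> * (y \<bullet> v)) *\<^sub>R v) (at \<theta>)"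
      unfolding plane_rot_def by (auto intro!: derivative_eq_intros simp: has_vector_derivative_def fun_eq_iff algebra_simps)
    ultimately show ?thesis by simp
  qed
  define c' where "c' \<theta> i = (if i \<in> {1..m} then A (c \<theta> i) else 0)" for \<theta> i
  define \<phi> where "\<phi> \<theta> = (\<Sum>i=1..L. spin_gradient i f (c \<theta>) \<bullet> c' \<theta> i)" for \<theta>
  have der: "((\<lambda>\<theta>. f (c \<theta>)) has_real_derivative \<phi> \<theta>) (at \<theta>)" for \<theta>
    unfolding \<phi>_def
  proof (rule smooth_curve[OF f c])
    show "((\<lambda>\<theta>. c \<theta> i) has_vector_derivative c' \<theta> i) (at \<theta>)" if "i \<in> {1..L}" for i
      using dR[of "S i" \<theta>] by (cases "i \<in> {1..m}") (simp_all add: c_def c'_def on_first_def del: atLeastAtMost_iff)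
    show "c \<theta> i \<bullet> c' \<theta> i = 0" if "i \<in> {1..L}" for i
      by (simp add: c'_def A_def inner_diff_right)
  qed
  have cc: "continuous_on UNIV c"
  proof (rule continuous_on_coordinatewise_then_product)
    fix i show "continuous_on UNIV (\<lambda>\<theta>. c \<theta> i)"
      unfolding c_def on_first_def plane_rot_def by (cases "i \<in> {1..m}") (auto intro!: continuous_intros)
  qed
  have gc: "continuous_on UNIV (\<lambda>\<theta>. spin_gradient i f (c \<theta>))" if "i \<in> {1..L}" for i
    by (rule continuous_on_compose2[OF smooth_gradient_continuous_on[OF f that] cc]) (use c in auto)
  have cic: "continuous_on UNIV (\<lambda>\<theta>. c \<theta> i)" for i by (rule continuous_on_product_then_coordinatewise[OF cc])
  have c'c: "continuous_on UNIV (\<lambda>\<theta>. c' \<theta> i)" for i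
    unfolding c'_def A_def using cic by (cases "i \<in> {1..m}") (auto intro!: continuous_intros)
  have \<phi>c: "continuous_on UNIV \<phi>" unfolding \<phi>_def using gc c'c by (intro continuous_intros) auto
  have \<phi>_le: "(\<phi> \<theta>)\<^sup>2 \<le> real m * (\<Sum>j=1..m. (?n \<theta> j)\<^sup>2)" for \<theta>
  proof -
    have "\<phi> \<theta> = (\<Sum>i=1..m. spin_gradient i f (c \<theta>) \<bullet> A (c \<theta> i))"
      unfolding \<phi>_def c'_def using m by (intro sum.mono_neutral_cong_right) auto
    also have "\<bar>\<dots>\<bar> \<le> (\<Sum>i=1..m. ?n \<theta> i)"
    proof (rule order_trans[OF sum_abs], rule sum_mono)
      fix i assume i: "i \<in> {1..m}"
      have "norm (c \<theta> i) = 1" using c[of \<theta>] i m by (auto simp: spin_configs_def)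
      hence "norm (A (c \<theta> i)) \<le> 1" by (rule nA)
      hence "?n \<theta> i * norm (A (c \<theta> i)) \<le> ?n \<theta> i"
        by (simp add: mult_left_le)
      thus "\<bar>spin_gradient i f (c \<theta>) \<bullet> A (c \<theta> i)\<bar> \<le> ?n \<theta> i"
        using Cauchy_Schwarz_ineq2 order_trans by blast
    qed
    finally have "\<bar>\<phi> \<theta>\<bar>\<^sup>2 \<le> (\<Sum>i=1..m. ?n \<theta> i)\<^sup>2" by (rule power_mono) simp
    also have "\<dots> \<le> (\<Sum>j=1..m. (?n \<theta> j)\<^sup>2) * card {1..m}" by (rule sum_squared_le_sum_of_squares)
    finally show ?thesis by (simp add: mult.commute)
  qed
  define D where "D \<theta> = (\<Sum>j=1..m. ennreal ((?n \<theta> j)\<^sup>2))" for \<theta>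
  have [measurable]: "D \<in> borel_measurable borel"
    unfolding D_def
  proof (rule borel_measurable_sum)
    fix j assume "j \<in> {1..m}"
    hence "(\<lambda>\<theta>. spin_gradient j f (c \<theta>)) \<in> borel_measurable borel" using gc m by (intro borel_measurable_continuous_onI) auto
    thus "(\<lambda>\<theta>. ennreal ((?n \<theta> j)\<^sup>2)) \<in> borel_measurable borel" by measurable
  qed
  have "ennreal ((f (c b) - f (c a))\<^sup>2) \<le> ennreal (b - a) * (\<integral>\<^sup>+\<theta>. indicator {a..b} \<theta> * ennreal ((\<phi> \<theta>)\<^sup>2) \<partial>lborel)"
    by (rule sq_length_integral_bound[OF ab(2) der \<phi>c])
  also have "\<dots> \<le> ennreal (2 * pi) * (\<integral>\<^sup>+\<theta>. ennreal (real m) * (indicator {a..b} \<theta> * D \<theta>) \<partial>lborel)"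
  proof (rule mult_mono[OF _ nn_integral_mono])
    show "ennreal (b - a) \<le> ennreal (2 * pi)" using ab by (intro ennreal_leI) auto
    fix \<theta> :: real
    have "ennreal ((\<phi> \<theta>)\<^sup>2) \<le> ennreal (real m * (\<Sum>j=1..m. (?n \<theta> j)\<^sup>2))"
      by (rule ennreal_leI[OF \<phi>_le])
    also have "\<dots> = ennreal (real m) * D \<theta>" unfolding D_def by (simp add: ennreal_mult' sum_ennreal)
    finally show "indicator {a..b} \<theta> * ennreal ((\<phi> \<theta>)\<^sup>2) \<le> ennreal (real m) * (indicator {a..b} \<theta> * D \<theta>)"
      by (auto simp: indicator_def)
  qed auto
  also have "\<dots> = ennreal (2 * pi * real m) * (\<integral>\<^sup>+\<theta>. indicator {a..b} \<theta> * D \<theta> \<partial>lborel)"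
    by (subst nn_integral_cmult) (auto simp: ennreal_mult mult.assoc)
  finally show "ennreal ((f (on_first m (plane_rot u v b) S) - f (on_first m (plane_rot u v a) S))\<^sup>2) \<le>
       ennreal (2 * pi * real m) *
         (\<integral>\<^sup>+\<theta>. indicator {a..b} \<theta> * (\<Sum>j=1..m. ennreal ((norm (spin_gradient j f (on_first m (plane_rot u v \<theta>) S)))\<^sup>2)) \<partial>lborel)"
    unfolding c_def D_def .
qed

section \<open>The Gibbs measure\<close>

lemma spin_measure_eq: "spin_measure L = cfg L" by (simp add: spin_measure_def)

lemma nn_integral_exp_inner:
  fixes p q :: "real ^ 'n::finite"
  assumes "norm p = 1" "norm q = 1"
  shows "(\<integral>\<^sup>+x. ennreal (exp (\<beta> * (x \<bullet> p))) \<partial>surf) = (\<integral>\<^sup>+x. ennreal (exp (\<beta> * (x \<bullet> q))) \<partial>surf)"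
proof -
  obtain Q where Q: "orthogonal_transformation Q" "Q p = q"
    using orthogonal_transformation_exists[of p q] assms by auto
  have i: "Q x \<bullet> q = x \<bullet> p" for x using Q by (auto simp: orthogonal_transformation_def)
  have "(\<integral>\<^sup>+x. ennreal (exp (\<beta> * (x \<bullet> q))) \<partial>surf) = (\<integral>\<^sup>+x. ennreal (exp (\<beta> * (x \<bullet> q))) \<partial>distr surf surf Q)"
    by (simp add: distr_surface_orthogonal[OF Q(1)])
  also have "\<dots> = (\<integral>\<^sup>+x. ennreal (exp (\<beta> * (Q x \<bullet> q))) \<partial>surf)"
    by (rule nn_integral_distr[OF measurable_orthogonal_surface[OF Q(1)]]) measurable
  finally show ?thesis by (simp add: i)
qed

section \<open>Normalization of the one spin kernel\<close>

text \<open>By rotation invariance any unit vector gives the same value;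
  \<open>axis undefined 1\<close> is a fixed choice.\<close>

definition kernel_mass :: "'n::finite itself \<Rightarrow> real \<Rightarrow> real" where
  "kernel_mass _ \<beta> = (\<integral>x. exp (\<beta> * (x \<bullet> axis undefined 1)) \<partial>(surf :: (real ^ 'n) measure))"

definition total_mass :: "'n::finite itself \<Rightarrow> real" where
  "total_mass _ = measure (surf :: (real ^ 'n) measure) (sphere 0 1)"

lemma mass_eq: "mass TYPE('n::finite) = ennreal (total_mass TYPE('n))"
  unfolding total_mass_def by (rule surf.emeasure_eq_measure)

lemma total_mass_pos: "total_mass TYPE('n::finite) > 0"
  using mass_pos[where 'n='n] unfolding mass_eq by simp

lemma kernel_mass:
  fixes p :: "real ^ 'n::finite"
  assumes "norm p = 1" "0 \<le> \<beta>"
  shows "(\<integral>\<^sup>+x. ennreal (exp (\<beta> * (x \<bullet> p))) \<partial>surf) = ennreal (kernel_mass TYPE('n) \<beta>)"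
proof -
  have "(\<integral>\<^sup>+x. ennreal (exp (\<beta> * (x \<bullet> p))) \<partial>surf) = (\<integral>\<^sup>+x. ennreal (exp (\<beta> * (x \<bullet> axis undefined 1))) \<partial>(surf :: (real ^ 'n) measure))"
    by (rule nn_integral_exp_inner) (simp_all add: assms)
  also have "\<dots> = ennreal (kernel_mass TYPE('n) \<beta>)"
    unfolding kernel_mass_def
  proof (rule nn_integral_eq_integral)
    show "integrable surf (\<lambda>x :: real^'n. exp (\<beta> * (x \<bullet> axis undefined 1)))"
    proof (rule surf.integrable_const_bound[of _ "exp \<beta>"])
      have "x \<bullet> axis undefined 1 \<le> 1" if "norm x = 1" for x :: "real^'n"
        using Cauchy_Schwarz_ineq2[of x "axis undefined 1"] that by simp
      thus "AE x :: real^'n in surf. norm (exp (\<beta> * (x \<bullet> axis undefined 1))) \<le> exp \<beta>"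
        using assms(2) by (intro AE_I2) (simp add: mult_left_le)
    qed measurable
  qed simp
  finally show ?thesis .
qed

text \<open>On the cap of height \<open>1 / \<beta>\<close> the exponent is within 1 of its maximum
  \<open>\<beta>\<close>, so only a factor \<open>exp 1\<close> is lost there. The cap estimate
  requires height at most 1, that is \<open>\<beta> \<ge> 1\<close>.\<close>

lemma kernel_mass_ge:
  assumes "\<beta> \<ge> 1"
  shows "kernel_mass TYPE('n::finite) \<beta> \<ge> exp (\<beta> - 1) * (1/4 * (sqrt (1 / \<beta>) / (2 * real CARD('n))) ^ (CARD('n) - 1))"
proof -
  define e :: "real ^ 'n" where "e = axis undefined 1"
  have e: "norm e = 1" by (simp add: e_def)
  define B where "B = {x. norm x = 1 \<and> x \<bullet> e \<ge> 1 - 1 / \<beta>}"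
  define k where "k = 1/4 * (sqrt (1 / \<beta>) / (2 * real CARD('n))) ^ (CARD('n) - 1)"
  have B: "B \<in> sets surf" unfolding B_def by (rule sets_cap)
  have k: "ennreal k \<le> emeasure surf B" unfolding k_def B_def using assms by (intro emeasure_cap_ge[OF e]) auto
  have k0: "k \<ge> 0" using assms by (simp add: k_def)
  have "ennreal (exp (\<beta> - 1) * k) = ennreal (exp (\<beta> - 1)) * ennreal k" using k0 by (simp add: ennreal_mult)
  also have "\<dots> \<le> ennreal (exp (\<beta> - 1)) * emeasure surf B" by (rule mult_left_mono[OF k]) simp
  also have "\<dots> = (\<integral>\<^sup>+x. ennreal (exp (\<beta> - 1)) * indicator B x \<partial>surf)" using B by (simp add: nn_integral_cmult)
  also have "\<dots> \<le> (\<integral>\<^sup>+x. ennreal (exp (\<beta> * (x \<bullet> e))) \<partial>surf)"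
  proof (rule nn_integral_mono)
    fix x
    have "exp (\<beta> - 1) \<le> exp (\<beta> * (x \<bullet> e))" if "x \<in> B"
    proof -
      have "\<beta> * (1 - 1 / \<beta>) \<le> \<beta> * (x \<bullet> e)" using that assms by (intro mult_left_mono) (auto simp: B_def)
      thus ?thesis using assms by (simp add: algebra_simps)
    qed
    thus "ennreal (exp (\<beta> - 1)) * indicator B x \<le> ennreal (exp (\<beta> * (x \<bullet> e)))"
      by (auto simp: indicator_def intro!: ennreal_leI)
  qed
  also have "\<dots> = ennreal (kernel_mass TYPE('n) \<beta>)" using assms by (intro kernel_mass[OF e]) simp
  finally have "exp (\<beta> - 1) * k \<le> kernel_mass TYPE('n) \<beta>"
    using kernel_mass_def[of "TYPE('n)" \<beta>] by (subst (asm) ennreal_le_iff) (auto intro!: integral_nonneg_AE)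
  thus ?thesis by (simp add: k_def)
qed

lemma kernel_mass_pos: "\<beta> \<ge> 1 \<Longrightarrow> kernel_mass TYPE('n::finite) \<beta> > 0"
  by (rule less_le_trans[OF _ kernel_mass_ge]) simp_all

text \<open>It shows that the uniform density does not exceed the supremum
  \<open>exp \<beta> / kernel_mass\<close> of the kernel, so the constant \<open>M\<close> also
  covers the uniform last spin.\<close>

lemma kernel_mass_le:
  assumes "\<beta> \<ge> 0"
  shows "kernel_mass TYPE('n::finite) \<beta> \<le> exp \<beta> * total_mass TYPE('n)"
proof -
  define e :: "real ^ 'n" where "e = axis undefined 1"
  have e: "norm e = 1" by (simp add: e_def)
  have "ennreal (kernel_mass TYPE('n) \<beta>) = (\<integral>\<^sup>+x. ennreal (exp (\<beta> * (x \<bullet> e))) \<partial>surf)"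
    by (rule kernel_mass[OF e assms, symmetric])
  also have "\<dots> \<le> (\<integral>\<^sup>+x. ennreal (exp \<beta>) \<partial>(surf :: (real^'n) measure))"
  proof (rule nn_integral_mono)
    fix x :: "real^'n" assume "x \<in> space surf"
    hence "x \<bullet> e \<le> 1" using Cauchy_Schwarz_ineq2[of x e] e by simp
    thus "ennreal (exp (\<beta> * (x \<bullet> e))) \<le> ennreal (exp \<beta>)" using assms by (intro ennreal_leI) (simp add: mult_left_le)
  qed
  also have "\<dots> = ennreal (exp \<beta> * total_mass TYPE('n))"
    by (simp add: mass_eq ennreal_mult total_mass_def)
  finally show ?thesis by (subst (asm) ennreal_le_iff) (simp_all add: total_mass_def)
qed

lemma spin_chain_exp:
  assumes "CARD('n::finite) \<ge> 2" "\<beta> \<ge> 1"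
  shows "spin_chain (\<lambda>t. exp (\<beta> * t) / kernel_mass TYPE('n) \<beta>) (exp \<beta> / kernel_mass TYPE('n) \<beta>)
     (\<lambda>p x :: real^'n. exp (\<beta> * (x \<bullet> p)) / kernel_mass TYPE('n) \<beta>)"
proof
  have z: "kernel_mass TYPE('n) \<beta> > 0" by (rule kernel_mass_pos[OF assms(2)])
  show "mono (\<lambda>t. exp (\<beta> * t) / kernel_mass TYPE('n) \<beta>)"
    using assms z by (intro monoI divide_right_mono) auto
  show "0 \<le> exp (\<beta> * t) / kernel_mass TYPE('n) \<beta>" for t using z by simp
  show "exp (\<beta> * t) / kernel_mass TYPE('n) \<beta> \<le> exp \<beta> / kernel_mass TYPE('n) \<beta>" if "\<bar>t\<bar> \<le> 1" for t
    using that assms z by (intro divide_right_mono) (auto simp: mult_left_le)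
  show "(\<integral>\<^sup>+x. ennreal (exp (\<beta> * (x \<bullet> p)) / kernel_mass TYPE('n) \<beta>) \<partial>surf) = 1" if "norm p = 1" for p :: "real^'n"
  proof -
    have "(\<integral>\<^sup>+x. ennreal (exp (\<beta> * (x \<bullet> p)) / kernel_mass TYPE('n) \<beta>) \<partial>surf) =
      (\<integral>\<^sup>+x. ennreal (exp (\<beta> * (x \<bullet> p))) / ennreal (kernel_mass TYPE('n) \<beta>) \<partial>surf)"
      using z by (simp add: divide_ennreal)
    also have "\<dots> = (\<integral>\<^sup>+x. ennreal (exp (\<beta> * (x \<bullet> p))) \<partial>surf) / ennreal (kernel_mass TYPE('n) \<beta>)"
      by (rule nn_integral_divide) measurable
    also have "\<dots> = 1" using z assms kernel_mass[OF that, of \<beta>] by (simp add: divide_ennreal)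
    finally show ?thesis .
  qed
qed (use assms in auto)

section \<open>Variance under the Gibbs measure and the gap\<close>

text \<open>A row of \<open>Suc L\<close> spins has \<open>L\<close> bonds, so its Boltzmann weight
  is \<open>z ^ L * dens L\<close>. Since the chain is already normalized, the partition function
  must be \<open>s * z ^ L\<close>, and the two densities agree pointwise.\<close>

lemma gibbs_eq_joint:
  fixes \<beta> :: real and L :: nat
  assumes N: "CARD('n::finite) \<ge> 2" and \<beta>: "\<beta> \<ge> 1"
  defines "J \<equiv> spin_chain.joint (\<lambda>p x :: real^'n. exp (\<beta> * (x \<bullet> p)) / kernel_mass TYPE('n) \<beta>) (\<lambda>_. 1 / total_mass TYPE('n)) L"
  shows "gibbs_measure (Suc L) \<beta> = J" "prob_space J"
    "\<And>S :: 'n config. 0 < exp (- \<beta> * hamiltonian (Suc L) S) / partition_function TYPE('n) (Suc L) \<beta>"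
proof -
  let ?h = "\<lambda>S :: 'n config. exp (- \<beta> * hamiltonian (Suc L) S)" and ?Z = "partition_function TYPE('n) (Suc L) \<beta>"
  define z where "z = kernel_mass TYPE('n) \<beta>"
  define s where "s = total_mass TYPE('n)"
  have z: "z > 0" unfolding z_def by (rule kernel_mass_pos[OF \<beta>])
  have s: "s > 0" unfolding s_def by (rule total_mass_pos)
  interpret spin_chain "\<lambda>t. exp (\<beta> * t) / z" "exp \<beta> / z" "\<lambda>p x :: real^'n. exp (\<beta> * (x \<bullet> p)) / z"
    unfolding z_def by (rule spin_chain_exp[OF N \<beta>])
  have J: "J = joint (\<lambda>_. 1 / s) L" by (simp add: J_def z_def s_def)
  let ?I = "\<integral>\<^sup>+S. 1 \<partial>joint (\<lambda>_. 1 / s) L"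
  have dens: "dens L S = ?h S / z ^ L" for S
    by (simp add: dens_def hamiltonian_def prod_dividef exp_sum[symmetric] sum_distrib_left
        sum_negf Suc_eq_plus1[symmetric])
  have "?I = (\<integral>\<^sup>+x. ennreal (1 / s) * (\<integral>\<^sup>+S. 1 \<partial>chain L x) \<partial>surf)"
    using s by (intro nn_integral_joint) auto
  also have "\<dots> = (\<integral>\<^sup>+x. ennreal (1 / s) \<partial>(surf :: (real^'n) measure))"
    using prob_space.emeasure_space_1[OF prob_space_chain] by (intro nn_integral_cong) simp
  also have "\<dots> = 1" using s by (simp add: mass_eq s_def[symmetric] ennreal_mult[symmetric])
  finally have one: "?I = 1" .
  show pj: "prob_space J" unfolding J by (rule prob_spaceI) (use one in simp)
  have "?I = (\<integral>\<^sup>+S. ennreal (1 / s * dens L S) * 1 \<partial>cfg (Suc L))"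
    unfolding joint_def by (rule nn_integral_density) measurable
  with one have int: "(\<integral>\<^sup>+S. ennreal (1 / s * dens L S) \<partial>cfg (Suc L)) = 1" by simp
  have "(\<integral>S. 1 / s * dens L S \<partial>cfg (Suc L)) = 1"
    by (rule integral_eq_nn_integral[THEN trans]) (use s dens_nonneg int in auto)
  moreover have "?h S = s * z ^ L * (1 / s * dens L S)" for S
    using s z by (simp add: dens)
  ultimately have "?Z = s * z ^ L"
    unfolding partition_function_def spin_measure_eq by simp
  hence eq: "?h S / ?Z = 1 / s * dens L S" for S
    by (simp add: dens)
  show "gibbs_measure (Suc L) \<beta> = J"
    unfolding gibbs_measure_def spin_measure_eq eq J joint_def ..
  show "0 < ?h S / ?Z" for S :: "'n config"
  proof -
    have "0 < 1 / s * dens L S" using s z by (simp add: dens)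
    thus ?thesis by (simp only: eq)
  qed
qed

text \<open>The Poincare step is applied once more on top of \<open>chain_poincare\<close>, with a
  constant profile for the last spin. The factor \<open>\<beta>\<close> undoes the
  \<open>1 / \<beta>\<close> in the Dirichlet form.\<close>

lemma gibbs_variance_le:
  fixes f :: "('n::finite) config \<Rightarrow> real"
  assumes N: "CARD('n) \<ge> 2" and \<beta>: "\<beta> \<ge> 1" and f: "smooth (Suc L) f"
  shows "prob_space.variance (gibbs_measure (Suc L) \<beta>) f \<le>
    2 * pi\<^sup>2 * (exp \<beta> / kernel_mass TYPE('n) \<beta>) * total_mass TYPE('n) * (real (Suc L))\<^sup>2 * (\<beta> * dirichlet_form (Suc L) \<beta> f)"
proof -
  define z where "z = kernel_mass TYPE('n) \<beta>"
  define s where "s = total_mass TYPE('n)"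
  have z: "z > 0" unfolding z_def by (rule kernel_mass_pos[OF \<beta>])
  have s: "s > 0" unfolding s_def by (rule total_mass_pos)
  interpret spin_chain "\<lambda>t. exp (\<beta> * t) / z" "exp \<beta> / z" "\<lambda>p x :: real^'n. exp (\<beta> * (x \<bullet> p)) / z"
    unfolding z_def by (rule spin_chain_exp[OF N \<beta>])
  define \<mu> where "\<mu> = joint (\<lambda>_. 1 / s) L"
  have gibbs: "gibbs_measure (Suc L) \<beta> = \<mu>" unfolding \<mu>_def s_def z_def by (rule gibbs_eq_joint(1)[OF N \<beta>])
  have "prob_space \<mu>" unfolding \<mu>_def s_def z_def by (rule gibbs_eq_joint(2)[OF N \<beta>])
  then interpret \<mu>: prob_space \<mu> .
  have sets\<mu>: "sets \<mu> = sets (cfg (Suc L))" and space\<mu>: "space \<mu> = spin_configs (Suc L)" by (simp_all add: \<mu>_def)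
  have fc: "continuous_on (spin_configs (Suc L)) f" by (rule smooth_continuous_on[OF f])
  have fm: "f \<in> borel_measurable (cfg (Suc L))" by (rule borel_measurable_cfgI[OF fc])
  obtain B where B: "\<And>S. S \<in> spin_configs (Suc L) \<Longrightarrow> \<bar>f S\<bar> \<le> B"
    using continuous_on_spin_configs_bounded[OF fc] by (auto simp: real_norm_def)
  let ?\<Delta> = "\<lambda>j S. (norm (spin_gradient j f S))\<^sup>2"
  have \<Delta>c: "continuous_on (spin_configs (Suc L)) (?\<Delta> j)" if "j \<in> {1..Suc L}" for j
    using smooth_gradient_continuous_on[OF f that] by (intro continuous_intros)
  have \<Delta>m: "?\<Delta> j \<in> borel_measurable (cfg (Suc L))" if "j \<in> {1..Suc L}" for j
    by (rule borel_measurable_cfgI[OF \<Delta>c[OF that]])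
  have \<Delta>int: "(\<integral>\<^sup>+S. ennreal (?\<Delta> j S) \<partial>\<mu>) = ennreal (\<integral>S. ?\<Delta> j S \<partial>\<mu>)" if j: "j \<in> {1..Suc L}" for j
  proof (rule nn_integral_eq_integral)
    obtain b where b: "\<And>S. S \<in> spin_configs (Suc L) \<Longrightarrow> norm (?\<Delta> j S) \<le> b"
      using continuous_on_spin_configs_bounded[OF \<Delta>c[OF j]] by blast
    show "integrable \<mu> (?\<Delta> j)"
      by (rule \<mu>.integrable_const_bound[of _ b])
        (use b \<Delta>m[OF j] in \<open>auto simp: space\<mu> measurable_cong_sets[OF sets\<mu> refl]\<close>)
  qed simp
  let ?E = "\<Sum>j=1..Suc L. \<integral>\<^sup>+S. ennreal (?\<Delta> j S) \<partial>\<mu>"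
  \<comment> \<open>A constant profile does not see the direction, so any unit vector serves as
    \<open>p\<close>.\<close>
  define e :: "real ^ 'n" where "e = axis undefined 1"
  have "\<exists>c. (\<integral>\<^sup>+S. ennreal ((f S - c)\<^sup>2) \<partial>\<mu>) \<le>
         poincare_const * of_nat ((Suc L)\<^sup>2) * ?E"
    unfolding \<mu>_def
  proof (rule joint_poincare_step[OF chain_poincare, where w' = "\<lambda>_. 1 / s" and p = e])
    show "1 / s \<le> exp \<beta> / z" using kernel_mass_le[where 'n='n, of \<beta>] s z \<beta> unfolding s_def[symmetric] z_def[symmetric]
      by (simp add: field_simps)
    show "(\<integral>\<^sup>+x. ennreal (1 / s) \<partial>(surf :: (real^'n) measure)) = 1"
      using s by (simp add: mass_eq s_def[symmetric] ennreal_mult[symmetric])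
    show "path_bound (Suc L) f (\<lambda>j S. ennreal (?\<Delta> j S))" by (rule smooth_path_bound[OF f])
  qed (use s B fm \<Delta>m in \<open>auto simp: e_def monoI\<close>)
  then obtain c where c: "(\<integral>\<^sup>+S. ennreal ((f S - c)\<^sup>2) \<partial>\<mu>) \<le>
         poincare_const * of_nat ((Suc L)\<^sup>2) * ?E" by blast
  have fm': "f \<in> borel_measurable \<mu>" using fm by (simp add: measurable_cong_sets[OF sets\<mu> refl])
  have vi: "integrable \<mu> (\<lambda>S. (f S - c)\<^sup>2)" for c
    by (rule \<mu>.integrable_bounded(2)[OF fm', of B]) (simp add: B space\<mu>)
  define D where "D = (\<Sum>j=1..Suc L. \<integral>S. ?\<Delta> j S \<partial>\<mu>)"
  have D0: "D \<ge> 0" unfolding D_def by (intro sum_nonneg integral_nonneg_AE) auto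
  have "ennreal (\<mu>.variance f) = (\<integral>\<^sup>+S. ennreal ((f S - \<mu>.expectation f)\<^sup>2) \<partial>\<mu>)"
    by (intro nn_integral_eq_integral[symmetric] vi AE_I2 zero_le_power2)
  also have "\<dots> \<le> (\<integral>\<^sup>+S. ennreal ((f S - c)\<^sup>2) \<partial>\<mu>)"
    using \<mu>.nn_variance_shift[OF fm', of B c] B by (simp add: space\<mu>)
  also have "\<dots> \<le> poincare_const * of_nat ((Suc L)\<^sup>2) * ?E" by (rule c)
  also have "?E = (\<Sum>j=1..Suc L. ennreal (\<integral>S. ?\<Delta> j S \<partial>\<mu>))"
    by (rule sum.cong[OF refl \<Delta>int])
  also have "\<dots> = ennreal D" unfolding D_def by (rule sum_ennreal) (auto intro!: integral_nonneg_AE)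
  also have "poincare_const * of_nat ((Suc L)\<^sup>2) * ennreal D = ennreal (2 * pi\<^sup>2 * (exp \<beta> / z) * s * (real (Suc L))\<^sup>2 * D)"
    unfolding poincare_const_def mass_eq s_def[symmetric] ennreal_of_nat_eq_real_of_nat
    using s z D0 by (simp add: ennreal_mult[symmetric] del: of_nat_Suc)
  finally have "\<mu>.variance f \<le> 2 * pi\<^sup>2 * (exp \<beta> / z) * s * (real (Suc L))\<^sup>2 * D"
    using s z D0 by (subst (asm) ennreal_le_iff) auto
  moreover have "D = \<beta> * dirichlet_form (Suc L) \<beta> f"
    unfolding dirichlet_form_def gibbs D_def using \<beta> by simp
  ultimately show ?thesis unfolding gibbs by (simp only: s_def z_def)
qed

text \<open>A zero variance would turn the quotient into 0 and make the gap vanish. A continuous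
  nonconstant function differs from its mean on a nonempty open set; a product of balls inside it
  has positive surface measure, and the Gibbs density is strictly positive.\<close>

lemma gibbs_variance_pos:
  fixes f :: "('n::finite) config \<Rightarrow> real"
  assumes N: "CARD('n) \<ge> 2" and \<beta>: "\<beta> \<ge> 1" and f: "smooth (Suc L) f" and nc: "\<not> f constant_on spin_configs (Suc L)"
  shows "prob_space.variance (gibbs_measure (Suc L) \<beta>) f > 0"
proof -
  define \<rho> where "\<rho> S = exp (- \<beta> * hamiltonian (Suc L) S) / partition_function TYPE('n) (Suc L) \<beta>" for S :: "'n config"
  have \<rho>: "\<rho> S > 0" for S unfolding \<rho>_def by (rule gibbs_eq_joint(3)[OF N \<beta>])
  define \<mu> where "\<mu> = (gibbs_measure (Suc L) \<beta> :: 'n config measure)"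
  have \<mu>: "\<mu> = density (cfg (Suc L)) (\<lambda>S. ennreal (\<rho> S))" by (simp add: \<mu>_def gibbs_measure_def spin_measure_eq \<rho>_def)
  have "prob_space \<mu>" unfolding \<mu>_def gibbs_eq_joint(1)[OF N \<beta>] by (rule gibbs_eq_joint(2)[OF N \<beta>])
  then interpret \<mu>: prob_space \<mu> .
  have sets\<mu>: "sets \<mu> = sets (cfg (Suc L))" and space\<mu>: "space \<mu> = spin_configs (Suc L)" by (simp_all add: \<mu> space_cfg)
  have fc: "continuous_on (spin_configs (Suc L)) f" by (rule smooth_continuous_on[OF f])
  have fm: "f \<in> borel_measurable (cfg (Suc L))" by (rule borel_measurable_cfgI[OF fc])
  have fm': "f \<in> borel_measurable \<mu>" using fm by (simp add: measurable_cong_sets[OF sets\<mu> refl])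
  obtain B where B: "\<And>S. S \<in> spin_configs (Suc L) \<Longrightarrow> \<bar>f S\<bar> \<le> B"
    using continuous_on_spin_configs_bounded[OF fc] by (auto simp: real_norm_def)
  define m where "m = \<mu>.expectation f"
  have vi: "integrable \<mu> (\<lambda>S. (f S - m)\<^sup>2)"
    by (rule \<mu>.integrable_bounded(2)[OF fm', of B]) (simp add: B space\<mu>)
  have "\<mu>.variance f \<noteq> 0"
  proof
    assume "\<mu>.variance f = 0"
    hence "AE S in \<mu>. (f S - m)\<^sup>2 = 0"
      using integral_nonneg_eq_0_iff_AE[OF vi] by (simp add: m_def)
    hence ae: "AE S in cfg (Suc L). f S = m"
    proof -
      have [measurable]: "\<rho> \<in> borel_measurable (cfg (Suc L))"
      proof -
        have [measurable]: "(\<lambda>S :: 'n config. S i) \<in> borel_measurable (cfg (Suc L))" if "i \<in> {1..Suc L}" for i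
          by (rule measurable_compose[OF measurable_component_singleton[OF that] borel_measurable_surface_id])
        have "(\<lambda>S :: 'n config. \<Sum>i=1..Suc L - 1. S i \<bullet> S (i + 1)) \<in> borel_measurable (cfg (Suc L))"
          by (intro borel_measurable_sum borel_measurable_inner) auto
        thus ?thesis unfolding \<rho>_def hamiltonian_def by measurable
      qed
      assume "AE S in \<mu>. (f S - m)\<^sup>2 = 0"
      thus ?thesis unfolding \<mu> by (subst (asm) AE_density) (use \<rho> in \<open>auto elim!: eventually_mono\<close>)
    qed
    obtain S where S: "S \<in> spin_configs (Suc L)" "f S \<noteq> m"
      using nc unfolding constant_on_def by blast
    have "openin (top_of_set (spin_configs (Suc L))) (spin_configs (Suc L) \<inter> f -` (- {m}))"
      by (rule continuous_openin_preimage_gen[OF fc]) auto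
    then obtain T where T: "open T" "spin_configs (Suc L) \<inter> f -` (- {m}) = spin_configs (Suc L) \<inter> T"
      by (auto simp: openin_open)
    have "openin (euclidean_configs (Suc L)) (configs (Suc L) \<inter> T)"
      unfolding euclidean_configs_eq openin_open using T(1) by blast
    moreover have "S \<in> configs (Suc L) \<inter> T" using S T(2) spin_configs_subset by blast
    ultimately obtain d where d: "d > 0"
      "\<And>y. y \<in> configs (Suc L) \<Longrightarrow> (\<And>i. i \<in> {1..Suc L} \<Longrightarrow> dist (y i) (S i) < d) \<Longrightarrow> y \<in> configs (Suc L) \<inter> T"
      using openin_configs_ball by blast
    let ?b = "\<lambda>i. emeasure surf (ball (S i) d \<inter> sphere 0 1)"
    define A where "A = PiE {1..Suc L} (\<lambda>i. ball (S i) d \<inter> sphere 0 1)"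
    have bs: "ball (S i) d \<inter> sphere 0 1 \<in> sets surf" for i by (simp add: sets_surface_measure_iff)
    have "emeasure (cfg (Suc L)) A = (\<Prod>i\<in>{1..Suc L}. ?b i)"
      unfolding A_def by (rule cfg.emeasure_PiM) (use bs in auto)
    also have "\<dots> \<noteq> 0"
    proof -
      have "?b i > 0" if "i \<in> {1..Suc L}" for i
        using S(1) that d(1) by (intro emeasure_surface_open_pos[of "S i"]) (auto simp: spin_configs_def)
      hence nz: "?b i \<noteq> 0" if "i \<in> {1..Suc L}" for i using that by fastforce
      have "(\<Prod>i\<in>A. h i) \<noteq> 0" if "finite A" "\<And>i. i \<in> A \<Longrightarrow> h i \<noteq> 0" for A :: "nat set" and h :: "nat \<Rightarrow> ennreal"
        using that by (induction A rule: finite_induct) auto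
      from this[OF finite_atLeastAtMost nz] show ?thesis .
    qed
    finally have pos: "emeasure (cfg (Suc L)) A \<noteq> 0" .
    have Am: "A \<in> sets (cfg (Suc L))" unfolding A_def by (rule sets_PiM_I_finite) (use bs in auto)
    have "AE S in cfg (Suc L). S \<notin> A"
      using ae
    proof (rule AE_mp, intro AE_I2 impI)
      fix S' assume "f S' = m"
      show "S' \<notin> A"
      proof
        assume A: "S' \<in> A"
        have "S' \<in> spin_configs (Suc L)" using A by (auto simp: A_def spin_configs_def PiE_def Pi_def)
        moreover have "S' \<in> T"
          using d(2)[of S'] A by (auto simp: A_def PiE_def Pi_def dist_commute)
        ultimately have "f S' \<noteq> m" using T(2) by blast
        thus False using \<open>f S' = m\<close> by simp
      qed
    qed
    hence "emeasure (cfg (Suc L)) A = 0"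
      using Am by (subst (asm) AE_iff_measurable[OF Am]) (use sets.sets_into_space[OF Am] in auto)
    thus False using pos by simp
  qed
  moreover have "\<mu>.variance f \<ge> 0" by (intro integral_nonneg_AE) auto
  ultimately show ?thesis unfolding \<mu>_def by linarith
qed

lemma relaxation_time_le:
  assumes N: "CARD('n::finite) \<ge> 2" and \<beta>: "\<beta> \<ge> 1" and L: "L \<ge> 1"
  shows "relaxation_time TYPE('n) L \<beta> \<le>
     ennreal (2 * pi\<^sup>2 * (exp \<beta> / kernel_mass TYPE('n) \<beta>) * total_mass TYPE('n) * (real L)\<^sup>2 * \<beta>)"
proof -
  obtain L' where L': "L = Suc L'" using L by (cases L) auto
  define K where "K = 2 * pi\<^sup>2 * (exp \<beta> / kernel_mass TYPE('n) \<beta>) * total_mass TYPE('n) * (real L)\<^sup>2 * \<beta>"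
  have K: "K > 0"
    unfolding K_def using kernel_mass_pos[OF \<beta>, where 'n='n] total_mass_pos[where 'n='n] L \<beta> by simp
  have "ennreal (1 / K) \<le> spectral_gap TYPE('n) L \<beta>"
    unfolding spectral_gap_def
  proof (rule INF_greatest)
    fix f :: "'n config \<Rightarrow> real"
    assume "f \<in> {f. smooth L f \<and> \<not> f constant_on spin_configs L}"
    hence f: "smooth L f" "\<not> f constant_on spin_configs L" by auto
    have pos: "prob_space.variance (gibbs_measure L \<beta>) f > 0"
      using gibbs_variance_pos[OF N \<beta>, of L' f] f unfolding L' by blast
    have "prob_space.variance (gibbs_measure L \<beta>) f \<le> K * dirichlet_form L \<beta> f"
      using gibbs_variance_le[OF N \<beta>, of L' f] f unfolding L' K_def by (simp add: mult_ac)
    hence "1 / K \<le> dirichlet_form L \<beta> f / prob_space.variance (gibbs_measure L \<beta>) f"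
      using K pos by (simp add: field_simps)
    thus "ennreal (1 / K) \<le> ennreal (dirichlet_form L \<beta> f / prob_space.variance (gibbs_measure L \<beta>) f)"
      by (rule ennreal_leI)
  qed
  \<comment> \<open>In \<open>[0, \<infinity>]\<close> this product form together with positivity of
    the gap is enough to invert, without knowing that the gap is finite.\<close>
  hence "1 \<le> spectral_gap TYPE('n) L \<beta> * ennreal K"
  proof -
    have "1 = ennreal (1 / K) * ennreal K" using K by (simp add: ennreal_mult[symmetric])
    also assume "ennreal (1 / K) \<le> spectral_gap TYPE('n) L \<beta>"
    hence "ennreal (1 / K) * ennreal K \<le> spectral_gap TYPE('n) L \<beta> * ennreal K" by (rule mult_right_mono) simp
    finally show ?thesis .
  qed
  moreover have "spectral_gap TYPE('n) L \<beta> > 0"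
    using \<open>ennreal (1 / K) \<le> _\<close> K by (metis ennreal_less_zero_iff less_le_trans zero_less_divide_1_iff)
  ultimately show ?thesis unfolding relaxation_time_def K_def[symmetric]
    by (intro divide_le_posI_ennreal) (simp_all add: mult.commute)
qed

theorem theorem1p1:
  assumes "CARD('n::finite) \<ge> 2"
  shows "(\<exists>C::real. \<forall>L\<ge>2. \<forall>\<beta>\<ge>1.
            relaxation_time TYPE('n) L \<beta>
              \<le> ennreal (C * (real L)\<^sup>2 * \<beta> powr ((real CARD('n) + 1) / 2)))
       \<and> (\<exists>p::nat. \<forall>L\<ge>2. \<exists>K::real. \<forall>\<beta>\<ge>1. relaxation_time TYPE('n) L \<beta> \<le> ennreal (K * \<beta> ^ p))"
proof -
  define N where "N = CARD('n)"
  \<comment> \<open>The last factor collects what remains of \<open>exp \<beta> / z\<close> after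
    the cap bound: \<open>exp 1\<close> from the cap height, 4 and \<open>(2 * N) ^ (N - 1)\<close>
    from the box inside the cone.\<close>
  define C where "C = 2 * pi\<^sup>2 * total_mass TYPE('n) * (4 * exp 1 * (2 * real N) ^ (N - 1))"
  have N: "N \<ge> 2" using assms by (simp add: N_def)
  have C: "C > 0" using total_mass_pos[where 'n='n] N by (simp add: C_def)
  have main: "relaxation_time TYPE('n) L \<beta> \<le> ennreal (C * (real L)\<^sup>2 * \<beta> powr ((real N + 1) / 2))"
    if L: "L \<ge> 2" and \<beta>: "\<beta> \<ge> 1" for L \<beta>
  proof -
    define z where "z = kernel_mass TYPE('n) \<beta>"
    let ?T = "2 * pi\<^sup>2 * (exp \<beta> / z) * total_mass TYPE('n) * (real L)\<^sup>2 * \<beta>"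
    let ?R = "4 * exp 1 * (2 * real N) ^ (N - 1) * sqrt \<beta> ^ (N - 1)"
    have z: "z > 0" unfolding z_def by (rule kernel_mass_pos[OF \<beta>])
    have ratio: "exp \<beta> / z \<le> ?R"
    proof -
      have "exp \<beta> = exp (\<beta> - 1) * (1/4 * (sqrt (1 / \<beta>) / (2 * real N)) ^ (N - 1)) * ?R"
        using \<beta> N by (simp add: exp_diff real_sqrt_divide power_divide power_mult_distrib)
      also have "\<dots> \<le> z * ?R"
        using kernel_mass_ge[OF \<beta>, where 'n='n] \<beta> unfolding z_def N_def by (intro mult_right_mono) auto
      finally show ?thesis using z by (simp add: pos_divide_le_eq mult.commute)
    qed
    \<comment> \<open>The supremum of the density contributes \<open>(N - 1) / 2\<close> to the
      exponent and the normalization of the Dirichlet form contributes 1.\<close>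
    have pw: "sqrt \<beta> ^ (N - 1) * \<beta> = \<beta> powr ((real N + 1) / 2)"
    proof -
      have "sqrt \<beta> ^ (N - 1) * \<beta> = (\<beta> powr (1/2)) powr real (N - 1) * \<beta> powr 1"
        using \<beta> by (simp add: powr_half_sqrt powr_realpow)
      also have "\<dots> = \<beta> powr (real (N - 1) / 2 + 1)" by (simp add: powr_powr powr_add)
      also have "real (N - 1) / 2 + 1 = (real N + 1) / 2" using N by (simp add: field_simps of_nat_diff)
      finally show ?thesis .
    qed
    have "?T \<le>
       2 * pi\<^sup>2 * ?R * total_mass TYPE('n) * (real L)\<^sup>2 * \<beta>"
      using total_mass_pos[where 'n='n] \<beta> by (intro mult_right_mono mult_left_mono ratio) auto
    also have "\<dots> = C * (real L)\<^sup>2 * (sqrt \<beta> ^ (N - 1) * \<beta>)" by (simp add: C_def mult_ac)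
    finally have "?T \<le> C * (real L)\<^sup>2 * \<beta> powr ((real N + 1) / 2)"
      unfolding pw .
    with relaxation_time_le[OF assms \<beta>, of L] L show ?thesis
      unfolding z_def by (meson ennreal_leI order_trans one_le_numeral)
  qed
  show ?thesis
  proof (intro conjI exI allI impI)
    show "relaxation_time TYPE('n) L \<beta> \<le> ennreal (C * (real L)\<^sup>2 * \<beta> powr ((real CARD('n) + 1) / 2))"
      if "2 \<le> L" "1 \<le> \<beta>" for L \<beta> using main[OF that] by (simp add: N_def)
    \<comment> \<open>The exponent has to be a natural number here; \<open>N + 1\<close> exceeds
      \<open>(N + 1) / 2\<close>, and \<open>\<beta> \<ge> 1\<close> makes powers monotone in the
      exponent.\<close>
    show "relaxation_time TYPE('n) L \<beta> \<le> ennreal (C * (real L)\<^sup>2 * \<beta> ^ (N + 1))" if "2 \<le> L" "1 \<le> \<beta>" for L \<beta>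
    proof -
      have "\<beta> powr ((real N + 1) / 2) \<le> \<beta> powr real (N + 1)" using that by (intro powr_mono) auto
      also have "\<dots> = \<beta> ^ (N + 1)" using that by (intro powr_realpow) auto
      finally have "C * (real L)\<^sup>2 * \<beta> powr ((real N + 1) / 2) \<le> C * (real L)\<^sup>2 * \<beta> ^ (N + 1)"
        using C by (intro mult_left_mono) auto
      thus ?thesis using main[OF that] by (meson ennreal_leI order_trans)
    qed
  qed
qed

end
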